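(* Let $G$ split as a finite graph of groups where each edge group has finite index in its vertex groups. Then the following are equivalent: (1) $G$ has finite stature with respect to its vertex groups. (2) $G$ has finite commensurable depth with respect to its vertex groups. (3) There is a normal subgroup $N\subset G$ such that $N$ is of finite index in each vertex group, and the quotient $G/N$ is a finitely generated virtually free group.
   Context: Finite stature: let $\{H_\lambda\}_{\lambda\in\Lambda}$ be a collection of subgroups of $G$. $(G,\{H_\lambda\})$ has finite stature if for each $\mu\in\Lambda$ there are finitely many $H_\mu$-conjugacy classes of infinite subgroups of the form $H_\mu\cap C$, where $C$ is an intersection of (possibly infinitely many) $G$-conjugates of elements of $\{H_\lambda\}$. Here the collection is the collection of vertex groups. Commensurable depth: for a collection $\Lambda=\{H_1,\dots,H_r\}$ of subgroups of $G$, the commensurable depth $\delta_c(G,\Lambda)$ is the largest integer $d$ such that there is a strictly increasing chain $L_1<\cdots<L_d$ where each $L_i$ is an intersection of finitely many $G$-conjugates of elements of $\Lambda$; it is $\infty$ if there are arbitrarily long such chains. It is finite commensurable depth if $\delta_c(G,\Lambda)<\infty$. Here $\Lambda$ is the collection of vertex groups. *)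

theory Defs
  imports
    "HOL-Algebra.Coset"
    "HOL-Algebra.Generated_Groups"
    "HOL-Library.Extended_Nat"
    "Graph_Theory.Digraph_Component"
begin

section \<open>Groups given by generators and relations\<close>

text \<open>The letter \<open>(x, True)\<close> is the generator \<open>x\<close>, and \<open>(x, False)\<close> is its formal inverse.
  A relation \<open>r = s\<close> is given as the pair \<open>(r, s)\<close> of words.\<close>

type_synonym 'x word = "('x \<times> bool) list"

definition words :: "'x set \<Rightarrow> 'x word set" where
  "words X = lists (X \<times> UNIV)"

inductive word_eq :: "'x set \<Rightarrow> ('x word \<times> 'x word) set \<Rightarrow> 'x word \<Rightarrow> 'x word \<Rightarrow> bool"
  for X R where
  refl: "u \<in> words X \<Longrightarrow> word_eq X R u u"
| sym: "word_eq X R u v \<Longrightarrow> word_eq X R v u"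
| trans: "word_eq X R u v \<Longrightarrow> word_eq X R v w \<Longrightarrow> word_eq X R u w"
| cancel: "u \<in> words X \<Longrightarrow> w \<in> words X \<Longrightarrow> x \<in> X \<Longrightarrow>
    word_eq X R (u @ [(x, b), (x, \<not> b)] @ w) (u @ w)"
| rel: "u \<in> words X \<Longrightarrow> w \<in> words X \<Longrightarrow> (r, s) \<in> R \<Longrightarrow> r \<in> words X \<Longrightarrow> s \<in> words X \<Longrightarrow>
    word_eq X R (u @ r @ w) (u @ s @ w)"

definition word_class :: "'x set \<Rightarrow> ('x word \<times> 'x word) set \<Rightarrow> 'x word \<Rightarrow> 'x word set" where
  "word_class X R u = {v. word_eq X R u v}"

definition presented_group :: "'x set \<Rightarrow> ('x word \<times> 'x word) set \<Rightarrow> 'x word set monoid" where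
  "presented_group X R =
     \<lparr>carrier = word_class X R ` words X,
      monoid.mult = (\<lambda>A B. \<Union>u\<in>A. \<Union>v\<in>B. word_class X R (u @ v)),
      one = word_class X R []\<rparr>"

lemma word_eq_words: "word_eq X R u v \<Longrightarrow> u \<in> words X \<and> v \<in> words X"
  by (induction rule: word_eq.induct) (auto simp: words_def)

lemma word_eq_context:
  "word_eq X R u v \<Longrightarrow> p \<in> words X \<Longrightarrow> q \<in> words X \<Longrightarrow> word_eq X R (p @ u @ q) (p @ v @ q)"
proof (induction rule: word_eq.induct)
  case (refl u)
  then show ?case by (auto intro!: word_eq.refl simp: words_def)
next
  case (sym u v)
  then show ?case by (blast intro: word_eq.sym)
next
  case (trans u v w)
  then show ?case by (blast intro: word_eq.trans)
next
  case (cancel u w x b)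
  then show ?case
    using word_eq.cancel[of "p @ u" X "w @ q" x R b] by (simp add: words_def)
next
  case (rel u w r s)
  then show ?case
    using word_eq.rel[of "p @ u" X "w @ q" r s R] by (simp add: words_def)
qed

lemma word_eq_append:
  assumes "word_eq X R u u'" "word_eq X R v v'"
  shows "word_eq X R (u @ v) (u' @ v')"
proof -
  have "word_eq X R (u @ v) (u' @ v)"
    using word_eq_context[OF assms(1), of "[]" v] word_eq_words[OF assms(2)]
    by (simp add: words_def)
  moreover have "word_eq X R (u' @ v) (u' @ v')"
    using word_eq_context[OF assms(2), of u' "[]"] word_eq_words[OF assms(1)]
    by (simp add: words_def)
  ultimately show ?thesis by (rule word_eq.trans)
qed

lemma word_class_eqI: "word_eq X R u v \<Longrightarrow> word_class X R u = word_class X R v"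
  unfolding word_class_def by (blast intro: word_eq.trans word_eq.sym)

lemma presented_group_mult:
  assumes "u \<in> words X" "v \<in> words X"
  shows "word_class X R u \<otimes>\<^bsub>presented_group X R\<^esub> word_class X R v = word_class X R (u @ v)"
proof -
  have "word_class X R (u' @ v') = word_class X R (u @ v)"
    if "u' \<in> word_class X R u" "v' \<in> word_class X R v" for u' v'
    using that by (metis mem_Collect_eq word_class_def word_class_eqI word_eq_append)
  moreover have "u \<in> word_class X R u" "v \<in> word_class X R v"
    using assms by (auto simp: word_class_def intro: word_eq.refl)
  ultimately have "(\<Union>u'\<in>word_class X R u. \<Union>v'\<in>word_class X R v. word_class X R (u' @ v')) =
      word_class X R (u @ v)"
    by blast
  then show ?thesis
    by (simp add: presented_group_def)
qed

lemma inverse_in_words: "u \<in> words X \<Longrightarrow> rev (map (apsnd Not) u) \<in> words X"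
  by (induction u) (auto simp: words_def)

lemma word_inverse:
  "u \<in> words X \<Longrightarrow> word_eq X R (rev (map (apsnd Not) u) @ u) []"
proof (induction u)
  case Nil
  then show ?case by (simp add: word_eq.refl words_def)
next
  case (Cons a u)
  obtain x b where a: "a = (x, b)" by force
  let ?i = "rev (map (apsnd Not) u)"
  from Cons.prems have x: "x \<in> X" and u: "u \<in> words X"
    by (auto simp: words_def a)
  from u have "?i \<in> words X"
    by (rule inverse_in_words)
  from word_eq.cancel[OF this u x, of R "\<not> b"] Cons.IH[OF u] show ?case
    by (auto simp: a intro: word_eq.trans)
qed

theorem group_presented_group: "group (presented_group X R)"
proof (rule groupI)
  let ?P = "presented_group X R"
  have car: "carrier ?P = word_class X R ` words X" and one: "\<one>\<^bsub>?P\<^esub> = word_class X R []"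
    by (simp_all add: presented_group_def)
  have nil: "[] \<in> words X" and app: "\<And>u v. u \<in> words X \<Longrightarrow> v \<in> words X \<Longrightarrow> u @ v \<in> words X"
    by (auto simp: words_def)
  show "\<one>\<^bsub>?P\<^esub> \<in> carrier ?P"
    using nil by (auto simp: car one)
  fix A assume A: "A \<in> carrier ?P"
  then obtain u where u: "u \<in> words X" "A = word_class X R u" by (auto simp: car)
  show "\<one>\<^bsub>?P\<^esub> \<otimes>\<^bsub>?P\<^esub> A = A"
    using u nil by (simp add: one presented_group_mult)
  have i: "rev (map (apsnd Not) u) \<in> words X"
    using u(1) by (rule inverse_in_words)
  show "\<exists>B\<in>carrier ?P. B \<otimes>\<^bsub>?P\<^esub> A = \<one>\<^bsub>?P\<^esub>"
    using u i word_class_eqI[OF word_inverse[OF u(1), of R]]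
    by (auto simp: one car presented_group_mult)
  fix B assume "B \<in> carrier ?P"
  then obtain v where v: "v \<in> words X" "B = word_class X R v" by (auto simp: car)
  show "A \<otimes>\<^bsub>?P\<^esub> B \<in> carrier ?P"
    using u v app by (auto simp: car presented_group_mult)
  fix C assume "C \<in> carrier ?P"
  then obtain w where w: "w \<in> words X" "C = word_class X R w" by (auto simp: car)
  show "A \<otimes>\<^bsub>?P\<^esub> B \<otimes>\<^bsub>?P\<^esub> C = A \<otimes>\<^bsub>?P\<^esub> (B \<otimes>\<^bsub>?P\<^esub> C)"
    using u v w app by (simp add: presented_group_mult)
qed

definition free_group :: "'x set \<Rightarrow> 'x word set monoid" where
  "free_group X = presented_group X {}"

text \<open>A basis of a free group \<open>F\<close> is a subset of \<open>F\<close>, so it suffices to let the basis range over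
  sets of the element type of \<open>F\<close>.\<close>

definition is_free :: "('a, 'm) monoid_scheme \<Rightarrow> bool" where
  "is_free F \<longleftrightarrow> (\<exists>X :: 'a set. F \<cong> free_group X)"

section \<open>Finite index, finite generation, virtual freeness\<close>

definition finite_index_subgroup :: "'a set \<Rightarrow> ('a, 'm) monoid_scheme \<Rightarrow> bool" where
  "finite_index_subgroup H G \<longleftrightarrow> subgroup H G \<and> finite (rcosets\<^bsub>G\<^esub> H)"

definition finitely_generated :: "('a, 'm) monoid_scheme \<Rightarrow> bool" where
  "finitely_generated G \<longleftrightarrow> (\<exists>S \<subseteq> carrier G. finite S \<and> generate G S = carrier G)"

definition virtually_free :: "('a, 'm) monoid_scheme \<Rightarrow> bool" where
  "virtually_free G \<longleftrightarrow> (\<exists>F. finite_index_subgroup F G \<and> is_free (G\<lparr>carrier := F\<rparr>))"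

section \<open>Graphs of groups\<close>

text \<open>The underlying graph is an arbitrary finite connected multigraph (loops and parallel edges
  are allowed); each edge is listed once, with a chosen orientation.  In \<open>Graph_Theory\<close>,
  \<^const>\<open>connected\<close> ignores orientations, but \<^const>\<open>forest\<close> (hence \<^const>\<open>tree\<close>) only
  excludes directed cycles.  An undirected cycle is one that becomes directed after reversing
  some of the arcs.\<close>

definition reorient :: "'e set \<Rightarrow> ('v, 'e) pre_digraph \<Rightarrow> ('v, 'e) pre_digraph" where
  "reorient S \<Gamma> = \<lparr>verts = verts \<Gamma>, arcs = arcs \<Gamma>,
     tail = (\<lambda>e. if e \<in> S then head \<Gamma> e else tail \<Gamma> e),
     head = (\<lambda>e. if e \<in> S then tail \<Gamma> e else head \<Gamma> e)\<rparr>"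

definition undirected_spanning_tree :: "('v, 'e) pre_digraph \<Rightarrow> ('v, 'e) pre_digraph \<Rightarrow> bool" where
  "undirected_spanning_tree T \<Gamma> \<longleftrightarrow>
     spanning T \<Gamma> \<and> connected T \<and> (\<forall>S. forest (reorient S T))"

record ('v, 'e, 'g, 'h) graph_of_groups =
  base_graph :: "('v, 'e) pre_digraph"
  vertex_group :: "'v \<Rightarrow> 'g monoid"
  edge_group :: "'e \<Rightarrow> 'h monoid"
  tail_map :: "'e \<Rightarrow> 'h \<Rightarrow> 'g"
  head_map :: "'e \<Rightarrow> 'h \<Rightarrow> 'g"

abbreviation gverts :: "('v, 'e, 'g, 'h) graph_of_groups \<Rightarrow> 'v set" where
  "gverts Y \<equiv> verts (base_graph Y)"

abbreviation gedges :: "('v, 'e, 'g, 'h) graph_of_groups \<Rightarrow> 'e set" where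
  "gedges Y \<equiv> arcs (base_graph Y)"

abbreviation tail_group :: "('v, 'e, 'g, 'h) graph_of_groups \<Rightarrow> 'e \<Rightarrow> 'g monoid" where
  "tail_group Y e \<equiv> vertex_group Y (tail (base_graph Y) e)"

abbreviation head_group :: "('v, 'e, 'g, 'h) graph_of_groups \<Rightarrow> 'e \<Rightarrow> 'g monoid" where
  "head_group Y e \<equiv> vertex_group Y (head (base_graph Y) e)"

definition finite_graph_of_groups :: "('v, 'e, 'g, 'h) graph_of_groups \<Rightarrow> bool" where
  "finite_graph_of_groups Y \<longleftrightarrow>
     fin_digraph (base_graph Y) \<and> connected (base_graph Y) \<and>
     (\<forall>v\<in>gverts Y. group (vertex_group Y v)) \<and>
     (\<forall>e\<in>gedges Y. group (edge_group Y e) \<and>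
        tail_map Y e \<in> mon (edge_group Y e) (tail_group Y e) \<and>
        head_map Y e \<in> mon (edge_group Y e) (head_group Y e))"

definition finite_index_edge_groups :: "('v, 'e, 'g, 'h) graph_of_groups \<Rightarrow> bool" where
  "finite_index_edge_groups Y \<longleftrightarrow> (\<forall>e\<in>gedges Y.
     finite_index_subgroup (tail_map Y e ` carrier (edge_group Y e)) (tail_group Y e) \<and>
     finite_index_subgroup (head_map Y e ` carrier (edge_group Y e)) (head_group Y e))"

text \<open>The fundamental group relative to a spanning tree \<open>T\<close>: it is generated by the vertex groups
  and a stable letter \<open>t\<^sub>e\<close> for each edge \<open>e\<close>, subject to the multiplication tables of the vertex
  groups, \<open>t\<^sub>e \<cdot> head_map e a \<cdot> t\<^sub>e\<^sup>-\<^sup>1 = tail_map e a\<close>, and \<open>t\<^sub>e = 1\<close> for the edges of \<open>T\<close>.\<close>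

datatype ('v, 'e, 'g) gog_gen = Elt 'v 'g | Stable 'e

definition gog_gens :: "('v, 'e, 'g, 'h) graph_of_groups \<Rightarrow> ('v, 'e, 'g) gog_gen set" where
  "gog_gens Y = {Elt v g | v g. v \<in> gverts Y \<and> g \<in> carrier (vertex_group Y v)} \<union> Stable ` gedges Y"

definition gog_rels :: "('v, 'e, 'g, 'h) graph_of_groups \<Rightarrow> ('v, 'e) pre_digraph \<Rightarrow>
    (('v, 'e, 'g) gog_gen word \<times> ('v, 'e, 'g) gog_gen word) set" where
  "gog_rels Y T =
     {([(Elt v g, True), (Elt v h, True)], [(Elt v (g \<otimes>\<^bsub>vertex_group Y v\<^esub> h), True)]) | v g h.
        v \<in> gverts Y \<and> g \<in> carrier (vertex_group Y v) \<and> h \<in> carrier (vertex_group Y v)} \<union>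
     {([(Stable e, True), (Elt (head (base_graph Y) e) (head_map Y e a), True), (Stable e, False)],
       [(Elt (tail (base_graph Y) e) (tail_map Y e a), True)]) | e a.
        e \<in> gedges Y \<and> a \<in> carrier (edge_group Y e)} \<union>
     {([(Stable e, True)], []) | e. e \<in> arcs T}"

definition fundamental_group :: "('v, 'e, 'g, 'h) graph_of_groups \<Rightarrow> ('v, 'e) pre_digraph \<Rightarrow>
    ('v, 'e, 'g) gog_gen word set monoid" where
  "fundamental_group Y T = presented_group (gog_gens Y) (gog_rels Y T)"

text \<open>A splitting of \<open>G\<close> as \<open>Y\<close> is an isomorphism \<open>\<psi>\<close> from the fundamental group to \<open>G\<close>; the
  vertex groups are then regarded as subgroups of \<open>G\<close>.\<close>

definition splitting :: "('a, 'm) monoid_scheme \<Rightarrow> ('v, 'e, 'g, 'h) graph_of_groups \<Rightarrow>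
    ('v, 'e) pre_digraph \<Rightarrow> (('v, 'e, 'g) gog_gen word set \<Rightarrow> 'a) \<Rightarrow> bool" where
  "splitting G Y T \<psi> \<longleftrightarrow> finite_graph_of_groups Y \<and>
     undirected_spanning_tree T (base_graph Y) \<and> \<psi> \<in> iso (fundamental_group Y T) G"

definition vertex_subgroup :: "('v, 'e, 'g, 'h) graph_of_groups \<Rightarrow> ('v, 'e) pre_digraph \<Rightarrow>
    (('v, 'e, 'g) gog_gen word set \<Rightarrow> 'a) \<Rightarrow> 'v \<Rightarrow> 'a set" where
  "vertex_subgroup Y T \<psi> v =
     (\<lambda>g. \<psi> (word_class (gog_gens Y) (gog_rels Y T) [(Elt v g, True)])) ` carrier (vertex_group Y v)"

section \<open>Finite stature and commensurable depth\<close>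

definition conjugate :: "('a, 'm) monoid_scheme \<Rightarrow> 'a \<Rightarrow> 'a set \<Rightarrow> 'a set" where
  "conjugate G g H = (g <#\<^bsub>G\<^esub> H) #>\<^bsub>G\<^esub> inv\<^bsub>G\<^esub> g"

definition conjugates :: "('a, 'm) monoid_scheme \<Rightarrow> 'a set set \<Rightarrow> 'a set set" where
  "conjugates G \<H> = {conjugate G g H | g H. g \<in> carrier G \<and> H \<in> \<H>}"

definition finite_stature :: "('a, 'm) monoid_scheme \<Rightarrow> 'i set \<Rightarrow> ('i \<Rightarrow> 'a set) \<Rightarrow> bool" where
  "finite_stature G \<Lambda> H \<longleftrightarrow> (\<forall>\<mu>\<in>\<Lambda>.
     finite ((\<lambda>D. {conjugate G h D | h. h \<in> H \<mu>}) `
       {D. infinite D \<and> (\<exists>\<A>. \<A> \<noteq> {} \<and> \<A> \<subseteq> conjugates G (H ` \<Lambda>) \<and> D = H \<mu> \<inter> \<Inter>\<A>)}))"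

definition commensurable_depth :: "('a, 'm) monoid_scheme \<Rightarrow> 'a set set \<Rightarrow> enat" where
  "commensurable_depth G \<H> = Sup {enat (length Ls) | Ls. sorted_wrt (\<subset>) Ls \<and>
     set Ls \<subseteq> {\<Inter>\<A> | \<A>. \<A> \<noteq> {} \<and> finite \<A> \<and> \<A> \<subseteq> conjugates G \<H>}}"

end

theory Submission
  imports Defs "HOL-Algebra.Sym_Groups"
begin

text \<open>
  Call the \<open>G\<close>-conjugates of the vertex groups simply conjugates.  All edge groups have finite
  index, so each stable letter commensurates the vertex groups, and so does each vertex group
  (the graph being connected); these generate \<open>G\<close>, hence any two conjugates are commensurable
  (\<open>commensurable_conjugates\<close>) and every finite intersection of conjugates has finite index in each
  vertex group that contains it.

  The pivot of the proof is a fourth condition: some finite intersection of conjugates lies in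
  \<^emph>\<open>all\<close> conjugates.  A longest chain of finite intersections starts with such a subgroup.
  Finite stature gives one as well: conjugation inside a vertex group preserves the index, so the
  finite intersections inside an infinite vertex group have only finitely many indices, and one of
  maximal index cannot be shrunk further.  A subgroup \<open>N\<close> of this kind is the intersection of all
  conjugates, so it is normal, and it has finite index in each vertex group.  Conversely, given such
  a normal \<open>N\<close>, every intersection of conjugates is a union of cosets of \<open>N\<close>, of which a vertex
  group contains boundedly many; this bounds the lengths of chains and the number of intersections
  inside a vertex group.

  What remains is that \<open>G/N\<close> is finitely generated and virtually free.  It is generated by the finite
  images of the vertex groups and by the stable letters, and it inherits the universal property of
  the fundamental group: compatible homomorphisms on these images and values for the stable letters
  extend to \<open>G/N\<close> (\<open>quotient_universal_for\<close>).

  A homomorphism to a finite group that is injective on the vertex groups is built from free actions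
  (\<open>finite_quotient_embedding\<close>): if \<open>n\<close> is a common multiple of their orders, every vertex group acts
  freely on \<open>n\<close> points, the two actions of an edge group obtained from its two ends are isomorphic,
  and an isomorphism between them serves as the image of the stable letter.

  The kernel of such a homomorphism onto a finite group \<open>P\<close> is free (\<open>kernel_is_free\<close>).  Geometrically
  it is the fundamental group of the quotient of the Bass-Serre tree by the kernel, a finite graph
  with one vertex for each orbit of a vertex group on \<open>P\<close>.  The proof is the Reidemeister-Schreier
  method in the form of a cocycle.  Lifting a spanning tree of this graph singles out finitely many
  elements of the kernel.  Let \<open>F\<close> be the free group on them.  The universal property, applied to the
  wreath product of \<open>F\<close> and \<open>P\<close>, gives a cocycle on \<open>P\<close> with values in \<open>F\<close>; restricted to the kernel it
  is a homomorphism onto \<open>F\<close>, and the evaluation map from \<open>F\<close> to the kernel is its inverse.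

  The tree \<open>T\<close>, on which the stable letters are trivial, enters through two facts: it is connected
  (\<open>grown_tree_connected\<close>), and values prescribed on its edges have a potential on its vertices
  (\<open>grown_tree_potential\<close>), so that whatever is chosen along the edges of \<open>T\<close> can be made trivial.
\<close>

section \<open>Trees\<close>

text \<open>Building a tree by attaching leaves makes its two essential properties, connectedness and the
  existence of potentials, immediate by induction, whatever the orientation of the edges.\<close>

inductive grown_tree :: "('e \<Rightarrow> 'v) \<Rightarrow> ('e \<Rightarrow> 'v) \<Rightarrow> 'v set \<Rightarrow> 'e set \<Rightarrow> bool"
  for src tgt where
  root: "grown_tree src tgt {r} {}"
| leaf_tgt: "grown_tree src tgt S D \<Longrightarrow> src e \<in> S \<Longrightarrow> tgt e \<notin> S \<Longrightarrow>
    grown_tree src tgt (insert (tgt e) S) (insert e D)"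
| leaf_src: "grown_tree src tgt S D \<Longrightarrow> tgt e \<in> S \<Longrightarrow> src e \<notin> S \<Longrightarrow>
    grown_tree src tgt (insert (src e) S) (insert e D)"

lemma grown_tree_ends:
  "grown_tree src tgt S D \<Longrightarrow> e \<in> D \<Longrightarrow> src e \<in> S \<and> tgt e \<in> S"
  by (induction rule: grown_tree.induct) auto

lemma grown_tree_connected:
  "grown_tree src tgt S D \<Longrightarrow> (\<And>e. e \<in> D \<Longrightarrow> f (src e) = f (tgt e)) \<Longrightarrow>
    x \<in> S \<Longrightarrow> y \<in> S \<Longrightarrow> f x = f y"
proof (induction arbitrary: x y rule: grown_tree.induct)
  case (root r)
  then show ?case by simp
next
  case (leaf_tgt S D e)
  have "f z = f (src e)" if "z \<in> insert (tgt e) S" for z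
    using that leaf_tgt.IH[of z "src e"] leaf_tgt.hyps leaf_tgt.prems(1) by auto
  then show ?case using leaf_tgt.prems(2,3) by metis
next
  case (leaf_src S D e)
  have "f z = f (tgt e)" if "z \<in> insert (src e) S" for z
    using that leaf_src.IH[of z "tgt e"] leaf_src.hyps leaf_src.prems(1) by auto
  then show ?case using leaf_src.prems(2,3) by metis
qed

text \<open>A new leaf \<open>w\<close> lies on no earlier edge, so its value \<open>z\<close> can be read off from its only edge.\<close>

lemma grown_tree_potential_leaf:
  assumes tree: "grown_tree src tgt S D" and w: "w \<notin> S"
    and p: "\<forall>v. p v \<in> carrier L" "\<forall>e\<in>D. p (src e) = y e \<otimes>\<^bsub>L\<^esub> p (tgt e)"
    and z: "z \<in> carrier L" "(p(w := z)) (src e) = y e \<otimes>\<^bsub>L\<^esub> (p(w := z)) (tgt e)"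
  shows "\<exists>p. (\<forall>v. p v \<in> carrier L) \<and> (\<forall>e\<in>insert e D. p (src e) = y e \<otimes>\<^bsub>L\<^esub> p (tgt e))"
proof (intro exI[of _ "p(w := z)"] conjI allI ballI)
  show "(p(w := z)) v \<in> carrier L" for v using p(1) z(1) by simp
  show "(p(w := z)) (src e') = y e' \<otimes>\<^bsub>L\<^esub> (p(w := z)) (tgt e')" if e': "e' \<in> insert e D" for e'
  proof (cases "e' \<in> D")
    case True
    then have "src e' \<noteq> w" "tgt e' \<noteq> w" using grown_tree_ends[OF tree] w by metis+
    then show ?thesis using p(2) True by simp
  next
    case False
    then have "e' = e" using e' by simp
    then show ?thesis using z(2) by simp
  qed
qed

lemma grown_tree_potential_free:
  assumes "group L"
  shows "grown_tree src tgt S D \<Longrightarrow> (\<And>e. e \<in> D \<Longrightarrow> y e \<in> carrier L) \<Longrightarrow>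
    \<exists>p. (\<forall>v. p v \<in> carrier L) \<and> (\<forall>e\<in>D. p (src e) = y e \<otimes>\<^bsub>L\<^esub> p (tgt e))"
proof (induction rule: grown_tree.induct)
  interpret L: group L by fact
  case (root r)
  show ?case by (rule exI[of _ "\<lambda>_. \<one>\<^bsub>L\<^esub>"]) simp
next
  interpret L: group L by fact
  case (leaf_tgt S D e)
  then obtain p where p: "\<forall>v. p v \<in> carrier L" "\<forall>e\<in>D. p (src e) = y e \<otimes>\<^bsub>L\<^esub> p (tgt e)"
    by auto
  have "src e \<noteq> tgt e" "y e \<in> carrier L" using leaf_tgt.hyps leaf_tgt.prems by auto
  then show ?case
    using p(1) L.m_assoc[of "y e" "inv\<^bsub>L\<^esub> y e" "p (src e)"]
    by (intro grown_tree_potential_leaf[OF leaf_tgt.hyps(1,3) p,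
          where z = "inv\<^bsub>L\<^esub> y e \<otimes>\<^bsub>L\<^esub> p (src e)"]) simp_all
next
  interpret L: group L by fact
  case (leaf_src S D e)
  then obtain p where p: "\<forall>v. p v \<in> carrier L" "\<forall>e\<in>D. p (src e) = y e \<otimes>\<^bsub>L\<^esub> p (tgt e)"
    by auto
  have "src e \<noteq> tgt e" "y e \<in> carrier L" using leaf_src.hyps leaf_src.prems by auto
  then show ?case
    using p(1)
    by (intro grown_tree_potential_leaf[OF leaf_src.hyps(1,3) p, where z = "y e \<otimes>\<^bsub>L\<^esub> p (tgt e)"])
      simp_all
qed

text \<open>A potential can be multiplied on the right by any element, so it may be taken to be trivial at a
  given vertex.\<close>

lemma grown_tree_potential:
  assumes "group L" "grown_tree src tgt S D" "\<And>e. e \<in> D \<Longrightarrow> y e \<in> carrier L"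
  obtains p where "\<And>v. p v \<in> carrier L" "\<And>e. e \<in> D \<Longrightarrow> p (src e) = y e \<otimes>\<^bsub>L\<^esub> p (tgt e)"
    "p r = \<one>\<^bsub>L\<^esub>"
proof -
  interpret L: group L by fact
  have "\<exists>p. (\<forall>v. p v \<in> carrier L) \<and> (\<forall>e\<in>D. p (src e) = y e \<otimes>\<^bsub>L\<^esub> p (tgt e))"
    by (rule grown_tree_potential_free[OF assms])
  then obtain p where p: "\<And>v. p v \<in> carrier L"
    "\<And>e. e \<in> D \<Longrightarrow> p (src e) = y e \<otimes>\<^bsub>L\<^esub> p (tgt e)"
    by metis
  show thesis
  proof (rule that[of "\<lambda>v. p v \<otimes>\<^bsub>L\<^esub> inv\<^bsub>L\<^esub> p r"])
    fix e assume "e \<in> D"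
    then show "p (src e) \<otimes>\<^bsub>L\<^esub> inv\<^bsub>L\<^esub> p r = y e \<otimes>\<^bsub>L\<^esub> (p (tgt e) \<otimes>\<^bsub>L\<^esub> inv\<^bsub>L\<^esub> p r)"
      using p(1) assms(3) by (simp only: p(2) L.m_assoc L.inv_closed)
  qed (simp_all add: p(1))
qed

text \<open>Undirected paths in \<open>\<Gamma>\<close> are directed paths after the arcs in \<open>R\<close> have been reversed; this is how
  they meet the condition that every \<open>reorient R T\<close> is a forest.\<close>

definition simple_path ::
    "('v, 'e) pre_digraph \<Rightarrow> 'e set \<Rightarrow> 'e set \<Rightarrow> 'v set \<Rightarrow> 'v \<Rightarrow> 'e list \<Rightarrow> 'v \<Rightarrow> bool" where
  "simple_path \<Gamma> R D S x p y \<longleftrightarrow>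
     pre_digraph.cas (reorient R \<Gamma>) x p y \<and> set p \<subseteq> D \<and>
     distinct (pre_digraph.awalk_verts (reorient R \<Gamma>) x p) \<and>
     set (pre_digraph.awalk_verts (reorient R \<Gamma>) x p) \<subseteq> S"

lemma cas_reorient_cong:
  "(\<forall>e\<in>set p. e \<in> R \<longleftrightarrow> e \<in> R') \<Longrightarrow>
    pre_digraph.cas (reorient R \<Gamma>) x p y = pre_digraph.cas (reorient R' \<Gamma>) x p y \<and>
    pre_digraph.awalk_verts (reorient R \<Gamma>) x p = pre_digraph.awalk_verts (reorient R' \<Gamma>) x p"
proof (induction p arbitrary: x)
  case Nil
  show ?case by (simp add: pre_digraph.cas.simps pre_digraph.awalk_verts.simps)
next
  case (Cons e p)
  have "tail (reorient R \<Gamma>) e = tail (reorient R' \<Gamma>) e"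
    "head (reorient R \<Gamma>) e = head (reorient R' \<Gamma>) e"
    using Cons.prems by (simp_all add: reorient_def)
  then show ?case
    using Cons.IH[of "head (reorient R' \<Gamma>) e"] Cons.prems
    by (simp add: pre_digraph.cas.simps pre_digraph.awalk_verts.simps)
qed

lemma simple_path_cong:
  assumes "simple_path \<Gamma> R D S x p y" "\<And>e. e \<in> D \<Longrightarrow> e \<in> R \<longleftrightarrow> e \<in> R'"
  shows "simple_path \<Gamma> R' D S x p y"
proof -
  have "\<forall>e\<in>set p. e \<in> R \<longleftrightarrow> e \<in> R'"
    using assms unfolding simple_path_def by blast
  from cas_reorient_cong[OF this, of \<Gamma> x y] show ?thesis
    using assms(1) unfolding simple_path_def by metis
qed

lemma walk_snoc:
  "pre_digraph.cas \<Gamma> x p (tail \<Gamma> e) \<Longrightarrow>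
    pre_digraph.cas \<Gamma> x (p @ [e]) (head \<Gamma> e) \<and>
    pre_digraph.awalk_verts \<Gamma> x (p @ [e]) = pre_digraph.awalk_verts \<Gamma> x p @ [head \<Gamma> e]"
proof (induction p arbitrary: x)
  case Nil
  then show ?case by (simp add: pre_digraph.cas.simps pre_digraph.awalk_verts.simps)
next
  case (Cons e' p)
  then show ?case using Cons.IH[of "head \<Gamma> e'"]
    by (simp add: pre_digraph.cas.simps pre_digraph.awalk_verts.simps)
qed

text \<open>The new leaf is off the old paths, so a path remains simple when the new edge is attached at
  either end.  The new edge does not occur in an old path, so its orientation is free to choose.\<close>

lemma simple_path_leaf:
  assumes IH: "\<And>x y. x \<in> S \<Longrightarrow> y \<in> S \<Longrightarrow> \<exists>R p. simple_path \<Gamma> R D S x p y"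
    and e: "e \<notin> D" and w: "w \<notin> S" and s: "s \<in> S"
    and ends: "tail \<Gamma> e = s \<and> head \<Gamma> e = w \<or> tail \<Gamma> e = w \<and> head \<Gamma> e = s"
    and xy: "x \<in> insert w S" "y \<in> insert w S"
  shows "\<exists>R p. simple_path \<Gamma> R (insert e D) (insert w S) x p y"
proof -
  (* Orientations of e in which it is traversed from s to w, and from w to s. *)
  obtain O1 O2 where O: "O1 \<subseteq> {e}" "O2 \<subseteq> {e}"
    "\<And>R. R \<inter> {e} = O1 \<Longrightarrow> tail (reorient R \<Gamma>) e = s \<and> head (reorient R \<Gamma>) e = w"
    "\<And>R. R \<inter> {e} = O2 \<Longrightarrow> tail (reorient R \<Gamma>) e = w \<and> head (reorient R \<Gamma>) e = s"
  proof (cases "tail \<Gamma> e = s \<and> head \<Gamma> e = w")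
    case True
    then show ?thesis by (intro that[of "{}" "{e}"]) (auto simp: reorient_def)
  next
    case False
    then show ?thesis using ends by (intro that[of "{e}" "{}"]) (auto simp: reorient_def)
  qed
  consider "x \<in> S" "y \<in> S" | "x \<in> S" "y = w" | "x = w" "y \<in> S" | "x = w" "y = w"
    using xy by blast
  then show ?thesis
  proof cases
    case 1
    then show ?thesis using IH[of x y] unfolding simple_path_def by blast
  next
    case 2
    obtain R0 p where p0: "simple_path \<Gamma> R0 D S x p s" using IH[OF 2(1) s] by blast
    define R where "R = (R0 - {e}) \<union> O1"
    have p: "simple_path \<Gamma> R D S x p s"
      by (rule simple_path_cong[OF p0]) (use e O(1) in \<open>auto simp: R_def\<close>)
    have "R \<inter> {e} = O1" using O(1) by (auto simp: R_def)
    from O(3)[OF this] have "simple_path \<Gamma> R (insert e D) (insert w S) x (p @ [e]) y"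
      using p walk_snoc[of "reorient R \<Gamma>" x p e] w 2 by (auto simp: simple_path_def)
    then show ?thesis by blast
  next
    case 3
    obtain R0 p where p0: "simple_path \<Gamma> R0 D S s p y" using IH[OF s 3(2)] by blast
    define R where "R = (R0 - {e}) \<union> O2"
    have p: "simple_path \<Gamma> R D S s p y"
      by (rule simple_path_cong[OF p0]) (use e O(2) in \<open>auto simp: R_def\<close>)
    have "R \<inter> {e} = O2" using O(2) by (auto simp: R_def)
    from O(4)[OF this] have "simple_path \<Gamma> R (insert e D) (insert w S) x (e # p) y"
      using p w 3
      by (auto simp: simple_path_def pre_digraph.cas.simps pre_digraph.awalk_verts.simps)
    then show ?thesis by blast
  next
    case 4
    then show ?thesis
      by (intro exI[of _ "{}"] exI[of _ "[]"])
        (auto simp: simple_path_def pre_digraph.cas.simps pre_digraph.awalk_verts.simps)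
  qed
qed

lemma grown_tree_simple_path:
  "grown_tree (tail \<Gamma>) (head \<Gamma>) S D \<Longrightarrow> x \<in> S \<Longrightarrow> y \<in> S \<Longrightarrow> \<exists>R p. simple_path \<Gamma> R D S x p y"
proof (induction arbitrary: x y rule: grown_tree.induct)
  case (root r)
  then show ?case
    by (intro exI[of _ "{}"] exI[of _ "[]"])
      (auto simp: simple_path_def pre_digraph.cas.simps pre_digraph.awalk_verts.simps)
next
  case (leaf_tgt S D e)
  have "e \<notin> D" using grown_tree_ends[OF leaf_tgt.hyps(1)] leaf_tgt.hyps(3) by metis
  from simple_path_leaf[OF leaf_tgt.IH this leaf_tgt.hyps(3,2) _ leaf_tgt.prems] show ?case
    by blast
next
  case (leaf_src S D e)
  have "e \<notin> D" using grown_tree_ends[OF leaf_src.hyps(1)] leaf_src.hyps(3) by metis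
  from simple_path_leaf[OF leaf_src.IH this leaf_src.hyps(3,2) _ leaf_src.prems] show ?case
    by blast
qed

lemma connected_graph_const:
  assumes "connected \<Gamma>" "\<And>e. e \<in> arcs \<Gamma> \<Longrightarrow> P (tail \<Gamma> e) \<longleftrightarrow> P (head \<Gamma> e)"
    "x \<in> verts \<Gamma>" "y \<in> verts \<Gamma>" "P x"
  shows "P y"
proof -
  have "x \<rightarrow>\<^sup>*\<^bsub>with_proj (mk_symmetric \<Gamma>)\<^esub> y"
    using assms(1,3,4) by (auto simp: connected_def strongly_connected_def)
  then have "(x, y) \<in> rtrancl_on (verts \<Gamma>) (parcs (mk_symmetric \<Gamma>))"
    by (simp add: reachable_def)
  then show ?thesis
    by (induction rule: rtrancl_on_induct) (use assms(2,5) in \<open>auto simp: parcs_mk_symmetric\<close>)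
qed

text \<open>Grow a tree inside \<open>T\<close> as far as possible.  By connectedness it reaches every vertex.  It also uses
  every arc, because another arc would close a cycle with a path of the tree that joins its ends.\<close>

lemma grown_tree_of_spanning_tree:
  assumes "undirected_spanning_tree T \<Gamma>" "fin_digraph \<Gamma>"
  shows "grown_tree (tail \<Gamma>) (head \<Gamma>) (verts \<Gamma>) (arcs T)"
proof -
  have sub: "subgraph T \<Gamma>" and VT: "verts \<Gamma> = verts T" and conn: "connected T"
    and forest: "\<And>S. forest (reorient S T)"
    using assms(1) by (auto simp: undirected_spanning_tree_def spanning_def)
  interpret \<Gamma>: fin_digraph \<Gamma> by fact
  interpret T: wf_digraph T using sub by (simp add: subgraph_def)
  have tT: "tail \<Gamma> = tail T" "head \<Gamma> = head T"
    using sub by (auto simp: subgraph_def compatible_def)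
  define good where "good = (\<lambda>S. \<exists>D\<subseteq>arcs T. S \<subseteq> verts T \<and> grown_tree (tail T) (head T) S D)"
  obtain r where r: "r \<in> verts T"
    using conn by (auto simp: connected_def strongly_connected_def)
  have good_r: "good {r}"
    unfolding good_def by (intro exI[of _ "{}"] conjI grown_tree.root) (use r in simp_all)
  have "\<forall>S. good S \<longrightarrow> card S < Suc (card (verts T))"
    using \<Gamma>.finite_verts VT by (auto simp: good_def less_Suc_eq_le intro: card_mono)
  from ex_has_greatest_nat[of good, OF good_r this] obtain S
    where "good S" and max_card: "\<And>S'. good S' \<Longrightarrow> card S' \<le> card S"
    by metis
  then obtain D where SD: "grown_tree (tail T) (head T) S D" "S \<subseteq> verts T" "D \<subseteq> arcs T"
    unfolding good_def by blast
  have max: "card S' \<le> card S"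
    if "grown_tree (tail T) (head T) S' D'" "S' \<subseteq> verts T" "D' \<subseteq> arcs T" for S' D'
    using max_card[of S'] that unfolding good_def by blast
  have finS: "finite S" using SD(2) \<Gamma>.finite_verts VT finite_subset by metis
  have "S \<noteq> {}" using SD(1) by cases auto
  then obtain s where s: "s \<in> S" by blast
  have closed: "tail T e \<in> S \<longleftrightarrow> head T e \<in> S" if e: "e \<in> arcs T" for e
  proof (rule ccontr)
    assume "\<not> ?thesis"
    then consider "tail T e \<in> S" "head T e \<notin> S" | "head T e \<in> S" "tail T e \<notin> S" by blast
    then show False
    proof cases
      case 1
      from max[OF grown_tree.leaf_tgt[OF SD(1) 1]] show False using e SD 1(2) finS by auto
    next
      case 2
      from max[OF grown_tree.leaf_src[OF SD(1) 2]] show False using e SD 2(2) finS by auto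
    qed
  qed
  have "y \<in> S" if "y \<in> verts T" for y
    using connected_graph_const[OF conn, of "\<lambda>v. v \<in> S", OF closed _ that s] s SD(2) by blast
  with SD(2) have S: "S = verts T" by blast
  have "arcs T \<subseteq> D"
  proof
    fix e assume e: "e \<in> arcs T"
    show "e \<in> D"
    proof (rule ccontr)
      (* Otherwise e closes up a path of the tree from its head to its tail. *)
      assume "e \<notin> D"
      obtain R0 p where p0: "simple_path T R0 D S (head T e) p (tail T e)"
        using grown_tree_simple_path[OF SD(1)] e S by (meson T.head_in_verts T.tail_in_verts)
      define R where "R = R0 - {e}"
      have p: "simple_path T R D S (head T e) p (tail T e)"
        by (rule simple_path_cong[OF p0]) (use \<open>e \<notin> D\<close> in \<open>auto simp: R_def\<close>)
      let ?\<Gamma> = "reorient R T" and ?u = "tail T e"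
      have e': "tail ?\<Gamma> e = ?u" "head ?\<Gamma> e = head T e"
        by (auto simp: reorient_def R_def)
      have "pre_digraph.cas ?\<Gamma> ?u (e # p) ?u"
        using p unfolding simple_path_def pre_digraph.cas.simps e' by blast
      moreover have "?u \<in> verts ?\<Gamma>"
        using T.tail_in_verts[OF e] by (simp add: reorient_def)
      moreover have "set p \<subseteq> D"
        using p unfolding simple_path_def by blast
      with e SD(3) have "set (e # p) \<subseteq> arcs ?\<Gamma>"
        by (auto simp: reorient_def)
      moreover have "distinct (pre_digraph.awalk_verts ?\<Gamma> (head T e) p)"
        using p unfolding simple_path_def by blast
      then have "distinct (tl (pre_digraph.awalk_verts ?\<Gamma> ?u (e # p)))"
        by (simp only: pre_digraph.awalk_verts.simps e' list.sel)
      ultimately have "pre_digraph.cycle ?\<Gamma> (e # p)"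
        unfolding pre_digraph.cycle_def pre_digraph.awalk_def by blast
      then show False using forest[of R] by (auto simp: forest_def)
    qed
  qed
  with SD S VT tT show ?thesis by (simp add: subset_antisym)
qed

section \<open>Presented groups and their homomorphisms\<close>

fun word_eval :: "('b, 'c) monoid_scheme \<Rightarrow> ('x \<Rightarrow> 'b) \<Rightarrow> 'x word \<Rightarrow> 'b" where
  "word_eval L f [] = \<one>\<^bsub>L\<^esub>"
| "word_eval L f ((x, b) # w) = (if b then f x else inv\<^bsub>L\<^esub> f x) \<otimes>\<^bsub>L\<^esub> word_eval L f w"

lemma words_Cons [simp]: "(x, b) # w \<in> words X \<longleftrightarrow> x \<in> X \<and> w \<in> words X"
  and words_Nil [simp]: "[] \<in> words X"
  and words_append [simp]: "u @ v \<in> words X \<longleftrightarrow> u \<in> words X \<and> v \<in> words X"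
  by (auto simp: words_def)

context
  fixes L :: "('b, 'c) monoid_scheme" and f :: "'x \<Rightarrow> 'b" and X
  assumes L: "group L" and f: "\<And>x. x \<in> X \<Longrightarrow> f x \<in> carrier L"
begin

interpretation L: group L by (rule L)

lemma word_eval_closed: "w \<in> words X \<Longrightarrow> word_eval L f w \<in> carrier L"
proof (induction w)
  case (Cons a w)
  then show ?case using f by (cases a) auto
qed simp

lemma word_eval_append:
  "u \<in> words X \<Longrightarrow> v \<in> words X \<Longrightarrow>
    word_eval L f (u @ v) = word_eval L f u \<otimes>\<^bsub>L\<^esub> word_eval L f v"
proof (induction u)
  case Nil
  then show ?case using word_eval_closed by simp
next
  case (Cons a u)
  obtain x b where "a = (x, b)" by force
  with Cons show ?case
    using f[of x] word_eval_closed[of u] word_eval_closed[of v] by (simp add: L.m_assoc)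
qed

lemma word_eval_word_eq:
  assumes R: "\<And>r s. (r, s) \<in> R \<Longrightarrow> r \<in> words X \<Longrightarrow> s \<in> words X \<Longrightarrow>
    word_eval L f r = word_eval L f s"
  shows "word_eq X R u v \<Longrightarrow> word_eval L f u = word_eval L f v"
proof (induction rule: word_eq.induct)
  case (cancel u w x b)
  have "word_eval L f ([(x, b), (x, \<not> b)] @ w) = word_eval L f w"
    using f[OF cancel(3)] word_eval_closed[OF cancel(2)] by (simp flip: L.m_assoc)
  then show ?case
    using word_eval_append[OF cancel(1), of "[(x, b), (x, \<not> b)] @ w"]
      word_eval_append[OF cancel(1,2)] cancel(2,3) by simp
next
  case (rel u w r s)
  then show ?case using R[of r s] by (simp add: word_eval_append)
qed simp_all

text \<open>Von Dyck's theorem.\<close>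

lemma presented_group_hom:
  assumes R: "\<And>r s. (r, s) \<in> R \<Longrightarrow> r \<in> words X \<Longrightarrow> s \<in> words X \<Longrightarrow>
    word_eval L f r = word_eval L f s"
  obtains \<Theta> where "\<Theta> \<in> hom (presented_group X R) L"
    "\<And>x. x \<in> X \<Longrightarrow> \<Theta> (word_class X R [(x, True)]) = f x"
proof -
  define \<Theta> where "\<Theta> = (\<lambda>C. word_eval L f (SOME u. u \<in> C))"
  have \<Theta>: "\<Theta> (word_class X R u) = word_eval L f u" if "u \<in> words X" for u
  proof -
    have "u \<in> word_class X R u" using that by (simp add: word_class_def word_eq.refl)
    then have "(SOME u'. u' \<in> word_class X R u) \<in> word_class X R u" by (rule someI)
    then show ?thesis
      using word_eval_word_eq[OF R] unfolding \<Theta>_def word_class_def by fastforce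
  qed
  have "\<Theta> \<in> hom (presented_group X R) L"
  proof (rule homI)
    fix A assume "A \<in> carrier (presented_group X R)"
    then obtain u where u: "u \<in> words X" "A = word_class X R u" by (auto simp: presented_group_def)
    then show "\<Theta> A \<in> carrier L" using \<Theta> word_eval_closed by simp
    fix B assume "B \<in> carrier (presented_group X R)"
    then obtain v where v: "v \<in> words X" "B = word_class X R v" by (auto simp: presented_group_def)
    show "\<Theta> (A \<otimes>\<^bsub>presented_group X R\<^esub> B) = \<Theta> A \<otimes>\<^bsub>L\<^esub> \<Theta> B"
      using u v by (simp add: presented_group_mult \<Theta> word_eval_append)
  qed
  moreover have "\<Theta> (word_class X R [(x, True)]) = f x" if "x \<in> X" for x
    using that f[OF that] by (simp add: \<Theta>)
  ultimately show thesis by (rule that)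
qed

end

lemma word_class_in_carrier: "u \<in> words X \<Longrightarrow> word_class X R u \<in> carrier (presented_group X R)"
  by (simp add: presented_group_def)

text \<open>Not only the group itself but the induction over words behind it: a subgroup that contains the
  letters contains their inverses, hence all products of letters.\<close>

lemma presented_group_generated:
  assumes K: "subgroup K (presented_group X R)"
    and letters: "\<And>x. x \<in> X \<Longrightarrow> word_class X R [(x, True)] \<in> K"
  shows "K = carrier (presented_group X R)"
proof -
  let ?P = "presented_group X R"
  interpret P: group ?P by (rule group_presented_group)
  have letter: "word_class X R [(x, b)] \<in> K" if x: "x \<in> X" for x b
  proof (cases b)
    case True
    then show ?thesis using letters[OF x] by simp
  next
    case False
    have "word_class X R ([(x, False)] @ [(x, True)]) = word_class X R []"
      using word_eq.cancel[of "[]" X "[]" x R False] x by (simp add: word_class_eqI)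
    also have "word_class X R [] = \<one>\<^bsub>?P\<^esub>" by (simp add: presented_group_def)
    finally have "word_class X R [(x, False)] \<otimes>\<^bsub>?P\<^esub> word_class X R [(x, True)] = \<one>\<^bsub>?P\<^esub>"
      using x by (simp add: presented_group_mult)
    then have "inv\<^bsub>?P\<^esub> word_class X R [(x, True)] = word_class X R [(x, False)]"
      using x by (intro P.inv_equality) (auto intro: word_class_in_carrier)
    then show ?thesis
      using subgroup.m_inv_closed[OF K letters[OF x]] False by simp
  qed
  have "word_class X R u \<in> K" if "u \<in> words X" for u
    using that
  proof (induction u)
    case Nil
    then show ?case using subgroup.one_closed[OF K] by (simp add: presented_group_def)
  next
    case (Cons a u)
    obtain x b where a: "a = (x, b)" by force
    have "word_class X R [(x, b)] \<otimes>\<^bsub>?P\<^esub> word_class X R u \<in> K"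
      using Cons a letter by (intro subgroup.m_closed[OF K]) auto
    then show ?case using Cons.prems a by (simp add: presented_group_mult)
  qed
  then have "carrier ?P \<subseteq> K" by (auto simp: presented_group_def)
  then show ?thesis using subgroup.subset[OF K] by blast
qed

section \<open>Groups generated by a graph of subgroups\<close>

lemma (in group_hom) subgroup_vimage:
  assumes "subgroup K H"
  shows "subgroup {x \<in> carrier G. h x \<in> K} G"
proof (rule G.subgroupI)
  show "{x \<in> carrier G. h x \<in> K} \<noteq> {}"
    using subgroup.one_closed[OF assms] by (auto intro!: exI[of _ "\<one>\<^bsub>G\<^esub>"])
qed (auto simp: subgroup.m_inv_closed[OF assms] subgroup.m_closed[OF assms])

text \<open>The data that a splitting induces on a group, without the universal property: vertex subgroups \<open>H v\<close>,
  stable letters \<open>t e\<close> and edge subgroups \<open>A e\<close> inside the vertex subgroup at the target, which \<open>t e\<close>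
  conjugates into the vertex subgroup at the source.  This form passes to quotients.
  The edges in \<open>D\<close> form the spanning tree.\<close>

locale graph_of_subgroups = group Q for Q :: "('q, 'm) monoid_scheme" (structure) +
  fixes V :: "'v set" and E D :: "'e set" and src tgt :: "'e \<Rightarrow> 'v"
    and H :: "'v \<Rightarrow> 'q set" and A :: "'e \<Rightarrow> 'q set" and t :: "'e \<Rightarrow> 'q"
  assumes finite_V: "finite V" and finite_E: "finite E"
    and tree: "grown_tree src tgt V D" and D_sub: "D \<subseteq> E"
    and src_in: "e \<in> E \<Longrightarrow> src e \<in> V" and tgt_in: "e \<in> E \<Longrightarrow> tgt e \<in> V"
    and H_subgroup: "v \<in> V \<Longrightarrow> subgroup (H v) Q"
    and A_subgroup: "e \<in> E \<Longrightarrow> subgroup (A e) Q"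
    and A_sub: "e \<in> E \<Longrightarrow> A e \<subseteq> H (tgt e)"
    and t_closed: "e \<in> E \<Longrightarrow> t e \<in> carrier Q"
    and t_conj: "e \<in> E \<Longrightarrow> a \<in> A e \<Longrightarrow> t e \<otimes> a \<otimes> inv t e \<in> H (src e)"
    and t_tree: "e \<in> D \<Longrightarrow> t e = \<one>"
    and generated: "\<And>K. subgroup K Q \<Longrightarrow> (\<And>v. v \<in> V \<Longrightarrow> H v \<subseteq> K) \<Longrightarrow>
      (\<And>e. e \<in> E \<Longrightarrow> t e \<in> K) \<Longrightarrow> K = carrier Q"
begin

text \<open>The universal property of the fundamental group for homomorphisms to \<open>L\<close>.  It is a property of \<open>L\<close>
  because a locale cannot quantify over the type of the target group.\<close>

definition universal_for :: "('b, 'c) monoid_scheme \<Rightarrow> bool" where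
  "universal_for L \<longleftrightarrow> (\<forall>f s.
     (\<forall>v\<in>V. f v \<in> hom (Q\<lparr>carrier := H v\<rparr>) L) \<longrightarrow>
     (\<forall>e\<in>E. s e \<in> carrier L) \<longrightarrow>
     (\<forall>e\<in>E. \<forall>a\<in>A e. s e \<otimes>\<^bsub>L\<^esub> f (tgt e) a = f (src e) (t e \<otimes> a \<otimes> inv t e) \<otimes>\<^bsub>L\<^esub> s e) \<longrightarrow>
     (\<forall>e\<in>D. s e = \<one>\<^bsub>L\<^esub>) \<longrightarrow>
     (\<exists>\<Theta>\<in>hom Q L. (\<forall>v\<in>V. \<forall>h\<in>H v. \<Theta> h = f v h) \<and> (\<forall>e\<in>E. \<Theta> (t e) = s e)))"

lemma universal_forE:
  assumes "universal_for L"
    and "\<And>v. v \<in> V \<Longrightarrow> f v \<in> hom (Q\<lparr>carrier := H v\<rparr>) L"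
    and "\<And>e. e \<in> E \<Longrightarrow> s e \<in> carrier L"
    and "\<And>e a. e \<in> E \<Longrightarrow> a \<in> A e \<Longrightarrow>
      s e \<otimes>\<^bsub>L\<^esub> f (tgt e) a = f (src e) (t e \<otimes> a \<otimes> inv t e) \<otimes>\<^bsub>L\<^esub> s e"
    and "\<And>e. e \<in> D \<Longrightarrow> s e = \<one>\<^bsub>L\<^esub>"
  obtains \<Theta> where "\<Theta> \<in> hom Q L" "\<And>v h. v \<in> V \<Longrightarrow> h \<in> H v \<Longrightarrow> \<Theta> h = f v h"
    "\<And>e. e \<in> E \<Longrightarrow> \<Theta> (t e) = s e"
proof -
  have "\<exists>\<Theta>\<in>hom Q L. (\<forall>v\<in>V. \<forall>h\<in>H v. \<Theta> h = f v h) \<and> (\<forall>e\<in>E. \<Theta> (t e) = s e)"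
    using assms(1)[unfolded universal_for_def, rule_format, of f s] assms(2-5) by simp
  then show thesis using that by blast
qed

end

text \<open>A group with a fixed splitting.  The vertex and edge groups are studied through their images in \<open>G\<close>.\<close>

locale split_group = group G for G :: "('a, 'm) monoid_scheme" (structure) +
  fixes Y :: "('v, 'e, 'g, 'h) graph_of_groups" and T and \<psi>
  assumes splitting: "splitting G Y T \<psi>"
begin

abbreviation "\<H> \<equiv> vertex_subgroup Y T \<psi>"
abbreviation "\<Gamma> \<equiv> base_graph Y"
abbreviation "X \<equiv> gog_gens Y"
abbreviation "R \<equiv> gog_rels Y T"
abbreviation "P \<equiv> presented_group X R"

definition "stable_letter e = \<psi> (word_class X R [(Stable e, True)])"

definition "vertex_elt v g = \<psi> (word_class X R [(Elt v g, True)])"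

definition "edge_subgroup e =
  (\<lambda>a. vertex_elt (head \<Gamma> e) (head_map Y e a)) ` carrier (edge_group Y e)"

lemma fin_digraph: "fin_digraph \<Gamma>" and vertex_group: "v \<in> verts \<Gamma> \<Longrightarrow> group (vertex_group Y v)"
  and edge_group: "e \<in> arcs \<Gamma> \<Longrightarrow> group (edge_group Y e)"
  and tail_map: "e \<in> arcs \<Gamma> \<Longrightarrow> tail_map Y e \<in> hom (edge_group Y e) (tail_group Y e)"
  and head_map: "e \<in> arcs \<Gamma> \<Longrightarrow> head_map Y e \<in> hom (edge_group Y e) (head_group Y e)"
  and \<psi>_iso: "\<psi> \<in> iso P G"
  and spanning_tree: "undirected_spanning_tree T \<Gamma>"
  using splitting
  by (auto simp: splitting_def finite_graph_of_groups_def mon_def fundamental_group_def)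

lemma arcs_T: "arcs T \<subseteq> arcs \<Gamma>"
  using spanning_tree by (auto simp: undirected_spanning_tree_def spanning_def subgraph_def)

lemma tail_in: "e \<in> arcs \<Gamma> \<Longrightarrow> tail \<Gamma> e \<in> verts \<Gamma>" and head_in: "e \<in> arcs \<Gamma> \<Longrightarrow> head \<Gamma> e \<in> verts \<Gamma>"
  using fin_digraph by (auto simp: fin_digraph_def wf_digraph_def)

lemma Elt_in: "v \<in> verts \<Gamma> \<Longrightarrow> g \<in> carrier (vertex_group Y v) \<Longrightarrow> Elt v g \<in> X"
  and Stable_in: "e \<in> arcs \<Gamma> \<Longrightarrow> Stable e \<in> X"
  by (auto simp: gog_gens_def)

lemma \<psi>_mult:
  "u \<in> words X \<Longrightarrow> w \<in> words X \<Longrightarrow>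
    \<psi> (word_class X R (u @ w)) = \<psi> (word_class X R u) \<otimes> \<psi> (word_class X R w)"
  using \<psi>_iso presented_group_mult[of u X w R]
  by (metis (no_types, lifting) hom_mult iso_imp_homomorphism word_class_in_carrier)

lemma \<psi>_closed: "u \<in> words X \<Longrightarrow> \<psi> (word_class X R u) \<in> carrier G"
  using \<psi>_iso by (meson hom_in_carrier iso_imp_homomorphism word_class_in_carrier)

lemma \<psi>_rel: "(r, s) \<in> R \<Longrightarrow> r \<in> words X \<Longrightarrow> s \<in> words X \<Longrightarrow>
    \<psi> (word_class X R r) = \<psi> (word_class X R s)"
  using word_eq.rel[of "[]" X "[]" r s R] by (simp add: word_class_eqI)

lemma \<psi>_hom: "\<psi> \<in> hom P G"
  using \<psi>_iso by (rule iso_imp_homomorphism)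

lemma \<psi>_one: "\<psi> (word_class X R []) = \<one>"
  using hom_one[OF \<psi>_hom group_presented_group is_group] by (simp add: presented_group_def)

lemma \<psi>_inverse_letter:
  assumes "x \<in> X"
  shows "\<psi> (word_class X R [(x, False)]) = inv \<psi> (word_class X R [(x, True)])"
proof -
  have "word_class X R ([(x, False)] @ [(x, True)]) = word_class X R []"
    using word_eq.cancel[of "[]" X "[]" x R False] assms by (simp add: word_class_eqI)
  then have "\<psi> (word_class X R [(x, False)]) \<otimes> \<psi> (word_class X R [(x, True)]) = \<one>"
    using \<psi>_mult[of "[(x, False)]" "[(x, True)]"] assms \<psi>_one by simp
  then show ?thesis using assms by (simp add: inv_equality \<psi>_closed)
qed

lemma vertex_elt_hom: "v \<in> verts \<Gamma> \<Longrightarrow> vertex_elt v \<in> hom (vertex_group Y v) G"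
proof (rule homI)
  fix g h assume v: "v \<in> verts \<Gamma>" and g: "g \<in> carrier (vertex_group Y v)"
  show "vertex_elt v g \<in> carrier G"
    using v g by (simp add: vertex_elt_def \<psi>_closed Elt_in)
  assume h: "h \<in> carrier (vertex_group Y v)"
  have gh: "g \<otimes>\<^bsub>vertex_group Y v\<^esub> h \<in> carrier (vertex_group Y v)"
    using g h vertex_group[OF v] by (simp add: group.subgroup_self subgroup.m_closed)
  have "([(Elt v g, True), (Elt v h, True)], [(Elt v (g \<otimes>\<^bsub>vertex_group Y v\<^esub> h), True)]) \<in> R"
    unfolding gog_rels_def using v g h by blast
  then have "\<psi> (word_class X R ([(Elt v g, True)] @ [(Elt v h, True)])) =
      \<psi> (word_class X R [(Elt v (g \<otimes>\<^bsub>vertex_group Y v\<^esub> h), True)])"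
    using v g h gh by (simp add: \<psi>_rel Elt_in)
  then show "vertex_elt v (g \<otimes>\<^bsub>vertex_group Y v\<^esub> h) =
      vertex_elt v g \<otimes> vertex_elt v h"
    using \<psi>_mult[of "[(Elt v g, True)]" "[(Elt v h, True)]"] v g h
    by (simp add: vertex_elt_def Elt_in)
qed

lemma stable_letter_closed: "e \<in> arcs \<Gamma> \<Longrightarrow> stable_letter e \<in> carrier G"
  by (simp add: stable_letter_def \<psi>_closed Stable_in)

lemma stable_letter_tree: "e \<in> arcs T \<Longrightarrow> stable_letter e = \<one>"
proof -
  assume e: "e \<in> arcs T"
  then have "([(Stable e, True)], []) \<in> R" by (auto simp: gog_rels_def)
  then show ?thesis
    using e arcs_T \<psi>_rel[of "[(Stable e, True)]" "[]"] Stable_in[of e] \<psi>_one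
    by (auto simp: stable_letter_def)
qed

lemma stable_letter_conj:
  assumes e: "e \<in> arcs \<Gamma>" and a: "a \<in> carrier (edge_group Y e)"
  shows "stable_letter e \<otimes> vertex_elt (head \<Gamma> e) (head_map Y e a) \<otimes>
      inv stable_letter e = vertex_elt (tail \<Gamma> e) (tail_map Y e a)"
proof -
  let ?h = "Elt (head \<Gamma> e) (head_map Y e a)" and ?k = "Elt (tail \<Gamma> e) (tail_map Y e a)"
  have in_X: "?h \<in> X" "?k \<in> X" "Stable e \<in> X"
    using e a tail_map head_map tail_in head_in Stable_in
    by (auto intro!: Elt_in dest: hom_in_carrier)
  have "([(Stable e, True), (?h, True), (Stable e, False)], [(?k, True)]) \<in> R"
    unfolding gog_rels_def using e a by blast
  then have "\<psi> (word_class X R ([(Stable e, True)] @ [(?h, True)] @ [(Stable e, False)])) =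
      \<psi> (word_class X R [(?k, True)])"
    using in_X by (simp add: \<psi>_rel)
  then show ?thesis
    using in_X \<psi>_mult[of "[(Stable e, True)]" "[(?h, True)] @ [(Stable e, False)]"]
      \<psi>_mult[of "[(?h, True)]" "[(Stable e, False)]"]
    by (simp add: vertex_elt_def stable_letter_def \<psi>_inverse_letter \<psi>_closed m_assoc)
qed

lemma vertex_subgroup_eq:
  "\<H> v = vertex_elt v ` carrier (vertex_group Y v)"
  by (simp add: vertex_subgroup_def vertex_elt_def)

lemma subgroup_vertex_elt_image:
  assumes v: "v \<in> verts \<Gamma>" and S: "subgroup S (vertex_group Y v)"
  shows "subgroup (vertex_elt v ` S) G"
proof -
  interpret v: group_hom "vertex_group Y v" G "vertex_elt v"
    using vertex_group[OF v] vertex_elt_hom[OF v] is_group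
    by (simp add: group_hom_def group_hom_axioms_def)
  show ?thesis using S by (rule v.subgroup_img_is_subgroup)
qed

lemma subgroup_edge_image:
  assumes "e \<in> arcs \<Gamma>"
  shows "subgroup (head_map Y e ` carrier (edge_group Y e)) (head_group Y e)"
proof -
  interpret e: group_hom "edge_group Y e" "head_group Y e" "head_map Y e"
    using edge_group vertex_group head_in head_map assms
    by (simp add: group_hom_def group_hom_axioms_def)
  show ?thesis by (rule e.subgroup_img_is_subgroup[OF group.subgroup_self[OF edge_group[OF assms]]])
qed

lemma edge_subgroup_eq:
  "edge_subgroup e =
    vertex_elt (head \<Gamma> e) ` (head_map Y e ` carrier (edge_group Y e))"
  by (simp add: edge_subgroup_def image_image)

sublocale graph_of_subgroups G "verts \<Gamma>" "arcs \<Gamma>" "arcs T" "tail \<Gamma>" "head \<Gamma>"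
  "\<H>" "edge_subgroup" "stable_letter"
proof (rule graph_of_subgroups.intro, rule is_group, rule graph_of_subgroups_axioms.intro)
  interpret \<Gamma>: fin_digraph \<Gamma> by (rule fin_digraph)
  show "finite (verts \<Gamma>)" "finite (arcs \<Gamma>)" by auto
  show "grown_tree (tail \<Gamma>) (head \<Gamma>) (verts \<Gamma>) (arcs T)"
    by (rule grown_tree_of_spanning_tree[OF spanning_tree fin_digraph])
  show "arcs T \<subseteq> arcs \<Gamma>" by (rule arcs_T)
  show "subgroup (\<H> v) G" if "v \<in> verts \<Gamma>" for v
    unfolding vertex_subgroup_eq
    by (rule subgroup_vertex_elt_image[OF that group.subgroup_self[OF vertex_group[OF that]]])
  show "stable_letter e = \<one>" if "e \<in> arcs T" for e
    using that by (rule stable_letter_tree)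
  fix e assume e: "e \<in> arcs \<Gamma>"
  then show "tail \<Gamma> e \<in> verts \<Gamma>" "head \<Gamma> e \<in> verts \<Gamma>" "stable_letter e \<in> carrier G"
    by (simp_all add: tail_in head_in stable_letter_closed)
  show "subgroup (edge_subgroup e) G"
    unfolding edge_subgroup_eq
    by (rule subgroup_vertex_elt_image[OF head_in[OF e] subgroup_edge_image[OF e]])
  show "edge_subgroup e \<subseteq> \<H> (head \<Gamma> e)"
    unfolding edge_subgroup_eq vertex_subgroup_eq
    using subgroup.subset[OF subgroup_edge_image[OF e]] by (rule image_mono)
  fix a assume "a \<in> edge_subgroup e"
  then obtain a' where a': "a' \<in> carrier (edge_group Y e)"
    "a = vertex_elt (head \<Gamma> e) (head_map Y e a')"
    by (auto simp: edge_subgroup_def)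
  then show "stable_letter e \<otimes> a \<otimes> inv stable_letter e \<in>
      \<H> (tail \<Gamma> e)"
    using stable_letter_conj[OF e a'(1)] hom_in_carrier[OF tail_map[OF e] a'(1)]
    by (simp add: vertex_subgroup_eq)
next
  fix K assume K: "subgroup K G"
    and KH: "\<And>v. v \<in> verts \<Gamma> \<Longrightarrow> \<H> v \<subseteq> K"
    and Kt: "\<And>e. e \<in> arcs \<Gamma> \<Longrightarrow> stable_letter e \<in> K"
  interpret P: group P by (rule group_presented_group)
  interpret \<psi>: group_hom P G \<psi> by unfold_locales (rule \<psi>_hom)
  have "subgroup {x \<in> carrier P. \<psi> x \<in> K} P"
    using K by (rule \<psi>.subgroup_vimage)
  moreover have "word_class X R [(x, True)] \<in> {x \<in> carrier P. \<psi> x \<in> K}" if "x \<in> X" for x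
    using that KH Kt
    by (auto simp: gog_gens_def word_class_in_carrier vertex_subgroup_eq vertex_elt_def
        stable_letter_def image_subset_iff)
  ultimately have "{x \<in> carrier P. \<psi> x \<in> K} = carrier P"
    by (rule presented_group_generated)
  moreover have "\<psi> ` carrier P = carrier G"
    using \<psi>_iso by (auto simp: iso_def bij_betw_def)
  ultimately have "carrier G \<subseteq> K" by (metis (no_types, lifting) image_subsetI mem_Collect_eq)
  then show "K = carrier G" using subgroup.subset[OF K] by blast
qed

lemma universal:
  assumes L: "group L"
  shows "universal_for L"
  unfolding universal_for_def
proof (intro allI impI)
  interpret L: group L by fact
  fix f s
  assume f: "\<forall>v\<in>verts \<Gamma>. f v \<in> hom (G\<lparr>carrier := \<H> v\<rparr>) L"
    and s: "\<forall>e\<in>arcs \<Gamma>. s e \<in> carrier L"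
    and fs: "\<forall>e\<in>arcs \<Gamma>. \<forall>a\<in>edge_subgroup e. s e \<otimes>\<^bsub>L\<^esub> f (head \<Gamma> e) a =
      f (tail \<Gamma> e) (stable_letter e \<otimes> a \<otimes> inv stable_letter e) \<otimes>\<^bsub>L\<^esub> s e"
    and s_tree: "\<forall>e\<in>arcs T. s e = \<one>\<^bsub>L\<^esub>"
  define F where "F = (\<lambda>x. case x of Elt v g \<Rightarrow> f v (vertex_elt v g) | Stable e \<Rightarrow> s e)"
  have F_elt: "F (Elt v g) = f v (vertex_elt v g)" and F_stable: "F (Stable e) = s e" for v g e
    by (simp_all add: F_def)
  have elt: "vertex_elt v g \<in> \<H> v"
    if "v \<in> verts \<Gamma>" "g \<in> carrier (vertex_group Y v)" for v g
    using that by (simp add: vertex_subgroup_eq)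
  have f_closed: "f v h \<in> carrier L" if "v \<in> verts \<Gamma>" "h \<in> \<H> v" for v h
    using hom_in_carrier[of "f v" "G\<lparr>carrier := \<H> v\<rparr>" L h] f that by simp
  have f_mult: "f v (h \<otimes> k) = f v h \<otimes>\<^bsub>L\<^esub> f v k"
    if "v \<in> verts \<Gamma>" "h \<in> \<H> v" "k \<in> \<H> v" for v h k
    using hom_mult[of "f v" "G\<lparr>carrier := \<H> v\<rparr>" L h k] f that by simp
  have F: "F x \<in> carrier L" if "x \<in> X" for x
    using that s f_closed elt by (auto simp: gog_gens_def F_elt F_stable)
  have rels: "word_eval L F r = word_eval L F r'"
    if "(r, r') \<in> R" "r \<in> words X" "r' \<in> words X" for r r'
  proof -
    from that(1) consider (mult) v g h where "v \<in> verts \<Gamma>" "g \<in> carrier (vertex_group Y v)"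
        "h \<in> carrier (vertex_group Y v)" "r = [(Elt v g, True), (Elt v h, True)]"
        "r' = [(Elt v (g \<otimes>\<^bsub>vertex_group Y v\<^esub> h), True)]"
      | (edge) e a where "e \<in> arcs \<Gamma>" "a \<in> carrier (edge_group Y e)"
        "r = [(Stable e, True), (Elt (head \<Gamma> e) (head_map Y e a), True), (Stable e, False)]"
        "r' = [(Elt (tail \<Gamma> e) (tail_map Y e a), True)]"
      | (tree) e where "e \<in> arcs T" "r = [(Stable e, True)]" "r' = []"
      unfolding gog_rels_def by blast
    then show ?thesis
    proof cases
      case (mult v g h)
      note v = mult(1) and g = mult(2) and h = mult(3) and r = mult(4,5)
      show ?thesis
        using f_mult[OF v elt[OF v g] elt[OF v h]] f_closed[OF v elt[OF v g]]
          f_closed[OF v elt[OF v h]] hom_mult[OF vertex_elt_hom[OF v] g h]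
        by (simp add: r F_elt)
    next
      case (edge e a)
      note e = edge(1) and a = edge(2) and r = edge(3,4)
      let ?a = "vertex_elt (head \<Gamma> e) (head_map Y e a)"
      have "?a \<in> edge_subgroup e" using a by (auto simp: edge_subgroup_def)
      then have "s e \<otimes>\<^bsub>L\<^esub> f (head \<Gamma> e) ?a =
          f (tail \<Gamma> e) (vertex_elt (tail \<Gamma> e) (tail_map Y e a)) \<otimes>\<^bsub>L\<^esub> s e"
        using fs e stable_letter_conj[OF e a] by simp
      moreover have "f (head \<Gamma> e) ?a \<in> carrier L"
        by (intro f_closed elt head_in e hom_in_carrier[OF head_map a])
      moreover have "f (tail \<Gamma> e) (vertex_elt (tail \<Gamma> e) (tail_map Y e a)) \<in> carrier L"
        by (intro f_closed elt tail_in e hom_in_carrier[OF tail_map a])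
      ultimately show ?thesis
        using s e by (simp add: r F_elt F_stable L.m_assoc[symmetric]) (simp add: L.m_assoc)
    next
      case (tree e)
      then show ?thesis using s_tree by (simp add: F_stable)
    qed
  qed
  obtain \<Theta> where \<Theta>: "\<Theta> \<in> hom P L" "\<And>x. x \<in> X \<Longrightarrow> \<Theta> (word_class X R [(x, True)]) = F x"
    using presented_group_hom[OF L F rels] by blast
  define \<psi>' where "\<psi>' = inv_into (carrier P) \<psi>"
  have "\<psi>' \<in> iso G P"
    unfolding \<psi>'_def by (rule group.iso_set_sym[OF group_presented_group \<psi>_iso])
  then have "\<Theta> \<circ> \<psi>' \<in> hom G L"
    using \<Theta>(1) iso_imp_homomorphism[of \<psi>' G P] by (auto simp: hom_def)
  moreover have \<psi>': "\<psi>' (\<psi> x) = x" if "x \<in> carrier P" for x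
    using \<psi>_iso that by (auto simp: \<psi>'_def iso_def bij_betw_def)
  have "(\<Theta> \<circ> \<psi>') h = f v h"
    if v: "v \<in> verts \<Gamma>" and h: "h \<in> \<H> v" for v h
  proof -
    obtain g where "g \<in> carrier (vertex_group Y v)" "h = vertex_elt v g"
      using h by (auto simp: vertex_subgroup_eq)
    then show ?thesis
      using \<Theta>(2)[OF Elt_in] v Elt_in[OF v]
      by (simp add: vertex_elt_def \<psi>' word_class_in_carrier F_elt)
  qed
  moreover have "(\<Theta> \<circ> \<psi>') (stable_letter e) = s e" if "e \<in> arcs \<Gamma>" for e
    using \<Theta>(2)[OF Stable_in] that Stable_in[OF that]
    by (simp add: stable_letter_def \<psi>' word_class_in_carrier F_stable)
  ultimately show "\<exists>\<Theta>\<in>hom G L. (\<forall>v\<in>verts \<Gamma>. \<forall>h\<in>\<H> v. \<Theta> h = f v h) \<and>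
      (\<forall>e\<in>arcs \<Gamma>. \<Theta> (stable_letter e) = s e)"
    by blast
qed

end

context graph_of_subgroups
begin

lemma A_closed: "e \<in> E \<Longrightarrow> a \<in> A e \<Longrightarrow> a \<in> carrier Q"
  using A_subgroup subgroup.mem_carrier by metis

lemma H_closed: "v \<in> V \<Longrightarrow> h \<in> H v \<Longrightarrow> h \<in> carrier Q"
  using H_subgroup subgroup.mem_carrier by metis

lemma V_nonempty: "V \<noteq> {}"
  using tree by cases auto

text \<open>The uniqueness half of the universal property.\<close>

lemma hom_eqI:
  assumes L: "group L" and f: "f \<in> hom Q L" and g: "g \<in> hom Q L"
    and "\<And>v h. v \<in> V \<Longrightarrow> h \<in> H v \<Longrightarrow> f h = g h" "\<And>e. e \<in> E \<Longrightarrow> f (t e) = g (t e)"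
    and x: "x \<in> carrier Q"
  shows "f x = g x"
proof -
  interpret f: group_hom Q L f using L f by (simp add: group_hom_def group_hom_axioms_def)
  interpret g: group_hom Q L g using L g by (simp add: group_hom_def group_hom_axioms_def)
  have "{x \<in> carrier Q. f x = g x} = carrier Q"
  proof (rule generated)
    have "\<one> \<in> {x \<in> carrier Q. f x = g x}" by simp
    then show "subgroup {x \<in> carrier Q. f x = g x} Q"
      by (intro subgroupI) auto
  qed (use assms(4,5) H_closed t_closed in auto)
  then show ?thesis using x by blast
qed

lemma quotient_graph_of_subgroups:
  assumes N: "N \<lhd> Q"
  shows "graph_of_subgroups (Q Mod N) V E D src tgt
    (\<lambda>v. (\<lambda>x. N #> x) ` H v) (\<lambda>e. (\<lambda>x. N #> x) ` A e) (\<lambda>e. N #> t e)"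
proof -
  interpret N: normal N Q by fact
  let ?Q = "Q Mod N" and ?p = "\<lambda>x. N #> x"
  have Q': "group ?Q" by (rule N.factorgroup_is_group)
  interpret p: group_hom Q ?Q ?p
    using Q' N.r_coset_hom_Mod by (simp add: group_hom_def group_hom_axioms_def)
  show ?thesis
  proof (rule graph_of_subgroups.intro, rule Q', rule graph_of_subgroups_axioms.intro)
    show "subgroup (?p ` H v) ?Q" if "v \<in> V" for v
      using H_subgroup[OF that] by (rule p.subgroup_img_is_subgroup)
    show "subgroup (?p ` A e) ?Q" if "e \<in> E" for e
      using A_subgroup[OF that] by (rule p.subgroup_img_is_subgroup)
    show "?p ` A e \<subseteq> ?p ` H (tgt e)" if "e \<in> E" for e
      using A_sub[OF that] by (rule image_mono)
    show "?p (t e) \<in> carrier ?Q" if "e \<in> E" for e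
      using t_closed[OF that] by (rule p.hom_closed)
    show "?p (t e) = \<one>\<^bsub>?Q\<^esub>" if "e \<in> D" for e
      using t_tree[OF that] p.hom_one by simp
    show "?p (t e) \<otimes>\<^bsub>?Q\<^esub> a \<otimes>\<^bsub>?Q\<^esub> inv\<^bsub>?Q\<^esub> ?p (t e) \<in> ?p ` H (src e)"
      if e: "e \<in> E" and a: "a \<in> ?p ` A e" for e a
    proof -
      obtain a' where a': "a' \<in> A e" "a = ?p a'" using a by blast
      have "?p (t e) \<otimes>\<^bsub>?Q\<^esub> a \<otimes>\<^bsub>?Q\<^esub> inv\<^bsub>?Q\<^esub> ?p (t e) = ?p (t e \<otimes> a' \<otimes> inv t e)"
        using t_closed[OF e] A_closed[OF e a'(1)] a'(2)
        by (simp only: p.hom_mult p.hom_inv inv_closed m_closed)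
      then show ?thesis using t_conj[OF e a'(1)] by simp
    qed
    show "K = carrier ?Q"
      if K: "subgroup K ?Q" and HK: "\<And>v. v \<in> V \<Longrightarrow> ?p ` H v \<subseteq> K"
        and tK: "\<And>e. e \<in> E \<Longrightarrow> ?p (t e) \<in> K" for K
    proof -
      have "{x \<in> carrier Q. ?p x \<in> K} = carrier Q"
      proof (rule generated)
        show "subgroup {x \<in> carrier Q. ?p x \<in> K} Q" using K by (rule p.subgroup_vimage)
      qed (use HK tK H_closed t_closed in auto)
      then have "carrier ?Q \<subseteq> K" by (auto simp: carrier_FactGroup)
      then show ?thesis using subgroup.subset[OF K] by blast
    qed
  qed (use finite_V finite_E tree D_sub src_in tgt_in in auto)
qed

text \<open>A homomorphism out of the subgroups of the quotient pulls back to \<open>Q\<close> and extends; the extension is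
  trivial on \<open>N\<close>, because \<open>N\<close> lies in a vertex subgroup, where the extension is prescribed.\<close>

lemma quotient_universal_for:
  assumes N: "N \<lhd> Q" and NH: "v0 \<in> V" "N \<subseteq> H v0" and L: "group L" and univ: "universal_for L"
  shows "graph_of_subgroups.universal_for (Q Mod N) V E D src tgt
    (\<lambda>v. (\<lambda>x. N #> x) ` H v) (\<lambda>e. (\<lambda>x. N #> x) ` A e) (\<lambda>e. N #> t e) L"
proof -
  interpret N: normal N Q by fact
  interpret L: group L by fact
  let ?Q = "Q Mod N" and ?p = "\<lambda>x. N #> x"
  interpret p: group_hom Q ?Q ?p
    using N.factorgroup_is_group N.r_coset_hom_Mod by (simp add: group_hom_def group_hom_axioms_def)
  interpret G': graph_of_subgroups ?Q V E D src tgt "\<lambda>v. ?p ` H v" "\<lambda>e. ?p ` A e" "\<lambda>e. ?p (t e)"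
    using N by (rule quotient_graph_of_subgroups)
  show ?thesis
    unfolding G'.universal_for_def
  proof (intro allI impI)
    fix f s
    assume f: "\<forall>v\<in>V. f v \<in> hom (?Q\<lparr>carrier := ?p ` H v\<rparr>) L" and s: "\<forall>e\<in>E. s e \<in> carrier L"
      and fs: "\<forall>e\<in>E. \<forall>a\<in>?p ` A e. s e \<otimes>\<^bsub>L\<^esub> f (tgt e) a =
        f (src e) (?p (t e) \<otimes>\<^bsub>?Q\<^esub> a \<otimes>\<^bsub>?Q\<^esub> inv\<^bsub>?Q\<^esub> ?p (t e)) \<otimes>\<^bsub>L\<^esub> s e"
      and s_tree: "\<forall>e\<in>D. s e = \<one>\<^bsub>L\<^esub>"
    obtain \<Theta> where \<Theta>: "\<Theta> \<in> hom Q L" "\<And>v h. v \<in> V \<Longrightarrow> h \<in> H v \<Longrightarrow> \<Theta> h = f v (?p h)"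
      "\<And>e. e \<in> E \<Longrightarrow> \<Theta> (t e) = s e"
    proof (rule universal_forE[OF univ, of "\<lambda>v h. f v (?p h)" s])
      fix v assume v: "v \<in> V"
      show "(\<lambda>h. f v (?p h)) \<in> hom (Q\<lparr>carrier := H v\<rparr>) L"
      proof (rule homI)
        fix h assume h: "h \<in> carrier (Q\<lparr>carrier := H v\<rparr>)"
        then show "f v (?p h) \<in> carrier L"
          using hom_in_carrier[of "f v" "?Q\<lparr>carrier := ?p ` H v\<rparr>" L "?p h"] f v by simp
        fix k assume k: "k \<in> carrier (Q\<lparr>carrier := H v\<rparr>)"
        show "f v (?p (h \<otimes>\<^bsub>Q\<lparr>carrier := H v\<rparr>\<^esub> k)) = f v (?p h) \<otimes>\<^bsub>L\<^esub> f v (?p k)"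
          using hom_mult[of "f v" "?Q\<lparr>carrier := ?p ` H v\<rparr>" L "?p h" "?p k"] f v h k
            p.hom_mult[of h k] H_closed[OF v] by simp
      qed
    next
      fix e a assume e: "e \<in> E" and a: "a \<in> A e"
      have "?p (t e) \<otimes>\<^bsub>?Q\<^esub> ?p a \<otimes>\<^bsub>?Q\<^esub> inv\<^bsub>?Q\<^esub> ?p (t e) = ?p (t e \<otimes> a \<otimes> inv t e)"
        using t_closed[OF e] A_closed[OF e a]
        by (simp only: p.hom_mult p.hom_inv inv_closed m_closed)
      then show "s e \<otimes>\<^bsub>L\<^esub> f (tgt e) (?p a) = f (src e) (?p (t e \<otimes> a \<otimes> inv t e)) \<otimes>\<^bsub>L\<^esub> s e"
        using fs e a by force
    qed (use s s_tree in auto)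
    interpret \<Theta>: group_hom Q L \<Theta> using \<Theta>(1) by unfold_locales
    have f_one: "f v0 N = \<one>\<^bsub>L\<^esub>"
      using \<Theta>(2)[OF NH(1) subgroup.one_closed[OF H_subgroup[OF NH(1)]]] \<Theta>.hom_one p.hom_one by simp
    have "N \<subseteq> kernel Q L \<Theta>"
      unfolding kernel_def using \<Theta>(2)[OF NH(1)] NH(2) N.rcos_const[OF is_group] f_one N.subset
      by auto
    from \<Theta>.FactGroup_universal_kernel[OF N this] obtain \<Theta>' where
      \<Theta>': "\<Theta>' \<in> hom ?Q L" "\<And>x. x \<in> carrier Q \<Longrightarrow> \<Theta>' (?p x) = \<Theta> x" by metis
    have "\<forall>v\<in>V. \<forall>h\<in>?p ` H v. \<Theta>' h = f v h"
      using \<Theta>'(2) \<Theta>(2) H_closed by auto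
    moreover have "\<forall>e\<in>E. \<Theta>' (?p (t e)) = s e"
      using \<Theta>'(2) \<Theta>(3) t_closed by auto
    ultimately show "\<exists>\<Theta>\<in>hom ?Q L. (\<forall>v\<in>V. \<forall>h\<in>?p ` H v. \<Theta> h = f v h) \<and> (\<forall>e\<in>E. \<Theta> (?p (t e)) = s e)"
      using \<Theta>'(1) by blast
  qed
qed

end

section \<open>A finite quotient in which the vertex groups embed\<close>

text \<open>Permutations of \<open>{1..n}\<close> rather than of an arbitrary finite set, so that all vertex groups act on
  the same points and the images lie in one symmetric group.\<close>

definition free_action :: "('b, 'c) monoid_scheme \<Rightarrow> nat \<Rightarrow> ('b \<Rightarrow> nat \<Rightarrow> nat) \<Rightarrow> bool" where
  "free_action B n \<rho> \<longleftrightarrow> \<rho> \<in> hom B (sym_group n) \<and>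
     (\<forall>x\<in>{1..n}. inj_on (\<lambda>b. \<rho> b x) (carrier B))"

lemma free_action_mult:
  "free_action B n \<rho> \<Longrightarrow> b \<in> carrier B \<Longrightarrow> c \<in> carrier B \<Longrightarrow> \<rho> (b \<otimes>\<^bsub>B\<^esub> c) x = \<rho> b (\<rho> c x)"
  using hom_mult[of \<rho> B "sym_group n" b c] by (simp add: free_action_def sym_group_mult)

lemma free_action_permutes: "free_action B n \<rho> \<Longrightarrow> b \<in> carrier B \<Longrightarrow> \<rho> b permutes {1..n}"
  using hom_in_carrier[of \<rho> B "sym_group n" b] by (simp add: free_action_def sym_group_carrier)

lemma free_action_one: "group B \<Longrightarrow> free_action B n \<rho> \<Longrightarrow> \<rho> \<one>\<^bsub>B\<^esub> x = x"
  using hom_one[of \<rho> B "sym_group n"] sym_group_is_group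
  by (simp add: free_action_def sym_group_one)

text \<open>Take \<open>m\<close> copies of the regular action.\<close>

lemma free_action_exists:
  assumes B: "group B" and fin: "finite (carrier B)" and n: "n = card (carrier B) * m"
  obtains \<rho> where "free_action B n \<rho>"
proof -
  interpret B: group B by fact
  have "card (carrier B \<times> {..<m}) = card {1..n}"
    using n by (simp add: card_cartesian_product)
  with fin obtain \<beta> where \<beta>: "bij_betw \<beta> (carrier B \<times> {..<m}) {1..n}"
    using finite_same_card_bij[of "carrier B \<times> {..<m}" "{1..n}"] by auto
  define \<gamma> where "\<gamma> = inv_into (carrier B \<times> {..<m}) \<beta>"
  define \<rho> where "\<rho> = (\<lambda>b x. if x \<in> {1..n} then \<beta> (b \<otimes>\<^bsub>B\<^esub> fst (\<gamma> x), snd (\<gamma> x)) else x)"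
  have \<beta>_in: "\<beta> (c, i) \<in> {1..n}" if "c \<in> carrier B" "i < m" for c i
    using \<beta> that by (auto simp: bij_betw_def)
  have \<rho>_\<beta>: "\<rho> b (\<beta> (c, i)) = \<beta> (b \<otimes>\<^bsub>B\<^esub> c, i)" if "c \<in> carrier B" "i < m" for b c i
  proof -
    have "\<gamma> (\<beta> (c, i)) = (c, i)"
      unfolding \<gamma>_def using \<beta> that by (intro inv_into_f_f) (auto simp: bij_betw_def)
    then show ?thesis using \<beta>_in[OF that] unfolding \<rho>_def by simp
  qed
  have cover: "\<exists>c i. c \<in> carrier B \<and> i < m \<and> x = \<beta> (c, i)" if "x \<in> {1..n}" for x
  proof -
    have "x \<in> \<beta> ` (carrier B \<times> {..<m})" using \<beta> that by (simp add: bij_betw_def)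
    then show ?thesis by auto
  qed
  have \<beta>_inj: "c = c' \<and> i = i'"
    if "\<beta> (c, i) = \<beta> (c', i')" "c \<in> carrier B" "c' \<in> carrier B" "i < m" "i' < m" for c c' i i'
    using inj_onD[OF bij_betw_imp_inj_on[OF \<beta>] that(1)] that by simp
  have perm: "\<rho> b permutes {1..n}" if b: "b \<in> carrier B" for b
  proof (rule bij_imp_permutes)
    have "inj_on (\<rho> b) {1..n}"
    proof (rule inj_onI)
      fix x y assume x: "x \<in> {1..n}" and y: "y \<in> {1..n}" and eq: "\<rho> b x = \<rho> b y"
      obtain c i d j where c: "c \<in> carrier B" "i < m" "x = \<beta> (c, i)"
        and d: "d \<in> carrier B" "j < m" "y = \<beta> (d, j)"
        using cover[OF x] cover[OF y] by blast
      have "b \<otimes>\<^bsub>B\<^esub> c = b \<otimes>\<^bsub>B\<^esub> d \<and> i = j"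
        using eq b c d by (intro \<beta>_inj) (simp_all add: \<rho>_\<beta>)
      then show "x = y" using b c d by simp
    qed
    moreover have "\<rho> b ` {1..n} \<subseteq> {1..n}"
    proof
      fix y assume "y \<in> \<rho> b ` {1..n}"
      then obtain x where "x \<in> {1..n}" "y = \<rho> b x" by blast
      with cover[of x] show "y \<in> {1..n}" using \<rho>_\<beta> \<beta>_in b by (metis B.m_closed)
    qed
    ultimately show "bij_betw (\<rho> b) {1..n} {1..n}"
      by (simp add: bij_betw_def endo_inj_surj)
    show "\<rho> b x = x" if "x \<notin> {1..n}" for x
      using that unfolding \<rho>_def by (rule if_not_P)
  qed
  have "\<rho> \<in> hom B (sym_group n)"
  proof (rule homI)
    fix b assume b: "b \<in> carrier B"
    then show "\<rho> b \<in> carrier (sym_group n)" using perm by (simp add: sym_group_carrier)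
    fix c assume c: "c \<in> carrier B"
    have "\<rho> (b \<otimes>\<^bsub>B\<^esub> c) x = \<rho> b (\<rho> c x)" for x
    proof (cases "x \<in> {1..n}")
      case True
      then obtain d i where "d \<in> carrier B" "i < m" "x = \<beta> (d, i)" using cover by blast
      then show ?thesis using b c by (simp add: \<rho>_\<beta> B.m_assoc)
    next
      case False
      then show ?thesis by (auto simp: \<rho>_def)
    qed
    then show "\<rho> (b \<otimes>\<^bsub>B\<^esub> c) = \<rho> b \<otimes>\<^bsub>sym_group n\<^esub> \<rho> c"
      by (simp add: sym_group_mult fun_eq_iff)
  qed
  moreover have "inj_on (\<lambda>b. \<rho> b x) (carrier B)" if x: "x \<in> {1..n}" for x
  proof (rule inj_onI)
    fix b b' assume b: "b \<in> carrier B" "b' \<in> carrier B" and eq: "\<rho> b x = \<rho> b' x"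
    obtain d i where d: "d \<in> carrier B" "i < m" "x = \<beta> (d, i)" using cover[OF x] by blast
    have "b \<otimes>\<^bsub>B\<^esub> d = b' \<otimes>\<^bsub>B\<^esub> d \<and> i = i"
      using eq b d by (intro \<beta>_inj) (simp_all add: \<rho>_\<beta>)
    then show "b = b'" using b d by simp
  qed
  ultimately have "free_action B n \<rho>" by (simp add: free_action_def)
  then show thesis by (rule that)
qed

text \<open>Choosing a point in each orbit identifies the action with copies of the regular one.\<close>

lemma free_action_transversal:
  assumes B: "group B" and \<rho>: "free_action B n \<rho>"
  obtains Z where "Z \<subseteq> {1..n}" "bij_betw (\<lambda>(b, z). \<rho> b z) (carrier B \<times> Z) {1..n}"
proof -
  interpret B: group B by fact
  define orb where "orb = (\<lambda>x. (\<lambda>b. \<rho> b x) ` carrier B)"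
  define pick where "pick = (\<lambda>x. SOME y. y \<in> orb x)"
  have self: "x \<in> orb x" for x
    using free_action_one[OF B \<rho>] unfolding orb_def by (metis B.one_closed image_eqI)
  have pick: "pick x \<in> orb x" for x
    unfolding pick_def using self[of x] by (rule someI)
  have orb_sub: "orb (\<rho> b x) \<subseteq> orb x" if "b \<in> carrier B" for b x
    unfolding orb_def using that
    by (auto simp: free_action_mult[OF \<rho>, symmetric])
  have orb_eq: "orb y = orb x" if "y \<in> orb x" for x y
  proof -
    obtain b where b: "b \<in> carrier B" "y = \<rho> b x" using \<open>y \<in> orb x\<close> by (auto simp: orb_def)
    have "\<rho> (inv\<^bsub>B\<^esub> b) y = x"
      using b free_action_mult[OF \<rho>, of "inv\<^bsub>B\<^esub> b" b x] free_action_one[OF B \<rho>] by simp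
    then show ?thesis
      using orb_sub[of b x] orb_sub[of "inv\<^bsub>B\<^esub> b" y] b by auto
  qed
  have pick_cong: "pick y = pick x" if "y \<in> orb x" for x y
    using orb_eq[OF that] by (simp add: pick_def)
  have orb_in: "orb x \<subseteq> {1..n}" if "x \<in> {1..n}" for x
    using free_action_permutes[OF \<rho>] permutes_in_image that unfolding orb_def by fastforce
  have Z: "pick ` {1..n} \<subseteq> {1..n}" using pick orb_in by blast
  moreover have "bij_betw (\<lambda>(b, z). \<rho> b z) (carrier B \<times> pick ` {1..n}) {1..n}"
  proof (rule bij_betwI')
    fix p q assume "p \<in> carrier B \<times> pick ` {1..n}" "q \<in> carrier B \<times> pick ` {1..n}"
    then obtain b c x y where p: "p = (b, pick x)" "b \<in> carrier B" "x \<in> {1..n}"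
      and q: "q = (c, pick y)" "c \<in> carrier B" "y \<in> {1..n}" by auto
    have "b = c \<and> pick x = pick y" if eq: "\<rho> b (pick x) = \<rho> c (pick y)"
    proof -
      have "pick (pick x) = pick x" "pick (pick y) = pick y" using pick pick_cong by auto
      moreover have "\<rho> b (pick x) \<in> orb (pick x)" "\<rho> c (pick y) \<in> orb (pick y)"
        using p q by (auto simp: orb_def)
      ultimately have "pick x = pick y" using eq pick_cong by metis
      moreover have "pick x \<in> {1..n}" using Z p(3) by blast
      ultimately show ?thesis
        using \<rho> eq p(2) q(2) unfolding free_action_def inj_on_def by metis
    qed
    then show "((case p of (b, z) \<Rightarrow> \<rho> b z) = (case q of (b, z) \<Rightarrow> \<rho> b z)) \<longleftrightarrow> p = q"
      using p(1) q(1) by auto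
  next
    fix p assume "p \<in> carrier B \<times> pick ` {1..n}"
    then obtain b z where "p = (b, z)" "b \<in> carrier B" "z \<in> {1..n}" using Z by blast
    then show "(case p of (b, z) \<Rightarrow> \<rho> b z) \<in> {1..n}"
      using permutes_in_image[OF free_action_permutes[OF \<rho>]] by simp
  next
    fix x assume x: "x \<in> {1..n}"
    have "x \<in> orb (pick x)" using orb_eq[OF pick] self by simp
    then obtain b where "b \<in> carrier B" "x = \<rho> b (pick x)" by (auto simp: orb_def)
    then show "\<exists>p\<in>carrier B \<times> pick ` {1..n}. x = (case p of (b, z) \<Rightarrow> \<rho> b z)"
      using x by (intro bexI[of _ "(b, pick x)"]) auto
  qed
  ultimately show thesis by (rule that)
qed

text \<open>Both actions have \<open>n / |B|\<close> orbits, each of them a copy of the regular action, so a bijection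
  between transversals extends to an equivariant permutation.\<close>

lemma free_actions_equivalent:
  assumes B: "group B" and fin: "finite (carrier B)"
    and \<rho>: "free_action B n \<rho>" and \<rho>': "free_action B n \<rho>'"
  obtains \<sigma> where "\<sigma> permutes {1..n}" "\<And>b x. b \<in> carrier B \<Longrightarrow> \<sigma> (\<rho> b x) = \<rho>' b (\<sigma> x)"
proof -
  interpret B: group B by fact
  obtain Z where Z: "Z \<subseteq> {1..n}" "bij_betw (\<lambda>(b, z). \<rho> b z) (carrier B \<times> Z) {1..n}"
    using free_action_transversal[OF B \<rho>] .
  obtain Z' where Z': "Z' \<subseteq> {1..n}" "bij_betw (\<lambda>(b, z). \<rho>' b z) (carrier B \<times> Z') {1..n}"
    using free_action_transversal[OF B \<rho>'] .
  have "card (carrier B) * card Z = card (carrier B) * card Z'"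
    using bij_betw_same_card[OF Z(2)] bij_betw_same_card[OF Z'(2)]
    by (simp add: card_cartesian_product)
  moreover have "card (carrier B) \<noteq> 0" using fin B.one_closed by auto
  ultimately have "card Z = card Z'" by simp
  moreover have "finite Z" "finite Z'" using Z(1) Z'(1) by (auto intro: finite_subset)
  ultimately obtain \<zeta> where \<zeta>: "bij_betw \<zeta> Z Z'"
    using finite_same_card_bij by blast
  define \<sigma>\<^sub>0 where "\<sigma>\<^sub>0 = (\<lambda>(b, z). \<rho>' b z) \<circ> map_prod id \<zeta> \<circ>
    inv_into (carrier B \<times> Z) (\<lambda>(b, z). \<rho> b z)"
  have "bij_betw (map_prod id \<zeta>) (carrier B \<times> Z) (carrier B \<times> Z')"
    using \<zeta> by (intro bij_betw_map_prod) (auto simp: bij_betw_def)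
  then have bij: "bij_betw \<sigma>\<^sub>0 {1..n} {1..n}"
    unfolding \<sigma>\<^sub>0_def
    by (rule bij_betw_trans[OF bij_betw_inv_into[OF Z(2)] bij_betw_trans[OF _ Z'(2)]])
  define \<sigma> where "\<sigma> = (\<lambda>x. if x \<in> {1..n} then \<sigma>\<^sub>0 x else x)"
  have "bij_betw \<sigma> {1..n} {1..n}"
    using bij by (rule bij_betw_cong[THEN iffD1, rotated]) (simp add: \<sigma>_def)
  then have "\<sigma> permutes {1..n}"
    by (rule bij_imp_permutes) (auto simp: \<sigma>_def)
  moreover have "\<sigma> (\<rho> b x) = \<rho>' b (\<sigma> x)" if b: "b \<in> carrier B" for b x
  proof (cases "x \<in> {1..n}")
    case True
    then have "x \<in> (\<lambda>(b, z). \<rho> b z) ` (carrier B \<times> Z)" using Z(2) by (simp add: bij_betw_def)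
    then obtain c z where c: "c \<in> carrier B" "z \<in> Z" "x = \<rho> c z" by auto
    have \<sigma>: "\<sigma> (\<rho> d z) = \<rho>' d (\<zeta> z)" if d: "d \<in> carrier B" for d
    proof -
      have "\<rho> d z \<in> {1..n}"
        using permutes_in_image[OF free_action_permutes[OF \<rho> d]] c(2) Z(1) by blast
      moreover have "inv_into (carrier B \<times> Z) (\<lambda>(b, z). \<rho> b z) (\<rho> d z) = (d, z)"
        using inv_into_f_f[OF bij_betw_imp_inj_on[OF Z(2)], of "(d, z)"] d c(2) by simp
      ultimately show ?thesis by (simp add: \<sigma>_def \<sigma>\<^sub>0_def)
    qed
    show ?thesis
      using \<sigma>[of c] \<sigma>[of "b \<otimes>\<^bsub>B\<^esub> c"] b c
      by (simp add: free_action_mult[OF \<rho>] free_action_mult[OF \<rho>'])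
  next
    case False
    then have "\<rho> b x = x" "\<rho>' b x = x"
      using free_action_permutes[OF \<rho> b] free_action_permutes[OF \<rho>' b] permutes_not_in by metis+
    moreover have "\<sigma> x = x" using False unfolding \<sigma>_def by (rule if_not_P)
    ultimately show ?thesis by simp
  qed
  ultimately show thesis by (rule that)
qed

lemma (in group) cancel_middle:
  "x \<in> carrier G \<Longrightarrow> p \<in> carrier G \<Longrightarrow> y \<in> carrier G \<Longrightarrow> (x \<otimes> p) \<otimes> (inv p \<otimes> y) = x \<otimes> y"
  using m_assoc[of x p "inv p \<otimes> y"] m_assoc[of p "inv p" y] by simp

text \<open>Let every vertex group act freely on \<open>n\<close> points, where \<open>n\<close> is the product of their orders.  For
  each edge an equivariant permutation \<open>\<sigma> e\<close> between the two actions of its edge group is a candidate for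
  the image of the stable letter.  It would have to be trivial on the edges of the tree; conjugating
  the action of every vertex group by a potential \<open>\<pi>\<close> of \<open>\<sigma>\<close> achieves this.\<close>

lemma (in graph_of_subgroups) finite_quotient_embedding:
  assumes fin: "\<And>v. v \<in> V \<Longrightarrow> finite (H v)" and univ: "\<And>n. universal_for (sym_group n)"
  obtains n \<phi> where "\<phi> \<in> hom Q (sym_group n)" "\<And>v. v \<in> V \<Longrightarrow> inj_on \<phi> (H v)"
proof -
  define n where "n = (\<Prod>v\<in>V. card (H v))"
  let ?S = "sym_group n"
  interpret S: group ?S by (rule sym_group_is_group)
  have H_group: "group (Q\<lparr>carrier := H v\<rparr>)" if "v \<in> V" for v
    using H_subgroup[OF that] is_group by (rule subgroup.subgroup_is_group)
  have A_group: "group (Q\<lparr>carrier := A e\<rparr>)" if "e \<in> E" for e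
    using A_subgroup[OF that] is_group by (rule subgroup.subgroup_is_group)
  have A_fin: "finite (A e)" if "e \<in> E" for e
    using A_sub[OF that] fin[OF tgt_in[OF that]] finite_subset by metis
  have "card (H v) \<noteq> 0" if "v \<in> V" for v
    using fin[OF that] subgroup.one_closed[OF H_subgroup[OF that]] by auto
  (* Freeness yields injectivity only if there is a point to act on. *)
  then have n_pos: "1 \<in> {1..n}"
    using finite_V by (simp add: n_def Suc_le_eq prod_pos)
  have "\<exists>\<rho>. free_action (Q\<lparr>carrier := H v\<rparr>) n \<rho>" if v: "v \<in> V" for v
  proof -
    have "n = card (carrier (Q\<lparr>carrier := H v\<rparr>)) * (\<Prod>w\<in>V - {v}. card (H w))"
      using finite_V v by (simp add: n_def prod.remove)
    moreover have "finite (carrier (Q\<lparr>carrier := H v\<rparr>))" using fin[OF v] by simp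
    ultimately obtain \<rho> where "free_action (Q\<lparr>carrier := H v\<rparr>) n \<rho>"
      using free_action_exists[OF H_group[OF v]] by blast
    then show ?thesis by (intro exI[of _ \<rho>])
  qed
  then have "\<exists>\<rho>. \<forall>v\<in>V. free_action (Q\<lparr>carrier := H v\<rparr>) n (\<rho> v)"
    by (intro bchoice ballI)
  then obtain \<rho> where \<rho>: "\<And>v. v \<in> V \<Longrightarrow> free_action (Q\<lparr>carrier := H v\<rparr>) n (\<rho> v)"
    by blast
  have \<rho>_closed: "\<rho> v h \<in> carrier ?S" if "v \<in> V" "h \<in> H v" for v h
    using free_action_permutes[OF \<rho>[OF that(1)]] that(2) by (simp add: sym_group_carrier)
  have \<rho>_mult: "\<rho> v (h \<otimes> k) = \<rho> v h \<otimes>\<^bsub>?S\<^esub> \<rho> v k" if "v \<in> V" "h \<in> H v" "k \<in> H v" for v h k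
    using free_action_mult[OF \<rho>[OF that(1)], of h k] that(2,3)
    by (simp add: sym_group_mult fun_eq_iff)
  have \<rho>_inj: "h = k" if "v \<in> V" "h \<in> H v" "k \<in> H v" "x \<in> {1..n}" "\<rho> v h x = \<rho> v k x" for v h k x
    using \<rho>[OF that(1)] that(2-5) unfolding free_action_def inj_on_def by simp
  have "\<exists>\<sigma>. \<sigma> permutes {1..n} \<and>
      (\<forall>a\<in>A e. \<forall>x. \<sigma> (\<rho> (tgt e) a x) = \<rho> (src e) (t e \<otimes> a \<otimes> inv t e) (\<sigma> x))" if e: "e \<in> E" for e
  proof -
    let ?c = "\<lambda>a. t e \<otimes> a \<otimes> inv t e"
    have c_mult: "?c (a \<otimes> b) = ?c a \<otimes> ?c b" if "a \<in> A e" "b \<in> A e" for a b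
      using t_closed[OF e] A_closed[OF e that(1)] A_closed[OF e that(2)]
      by (metis inv_solve_right m_assoc m_closed inv_closed cancel_middle)
    have "free_action (Q\<lparr>carrier := A e\<rparr>) n (\<rho> (tgt e))"
      using A_sub[OF e] \<rho>_closed[OF tgt_in[OF e]] \<rho>_mult[OF tgt_in[OF e]] \<rho>_inj[OF tgt_in[OF e]]
      by (auto simp: free_action_def hom_def inj_on_def subset_eq)
    moreover have "free_action (Q\<lparr>carrier := A e\<rparr>) n (\<lambda>a. \<rho> (src e) (?c a))"
      unfolding free_action_def
    proof (intro conjI ballI)
      show "(\<lambda>a. \<rho> (src e) (?c a)) \<in> hom (Q\<lparr>carrier := A e\<rparr>) ?S"
        using \<rho>_closed[OF src_in[OF e] t_conj[OF e]]
          \<rho>_mult[OF src_in[OF e] t_conj[OF e] t_conj[OF e]] c_mult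
        by (auto simp: hom_def)
      show "inj_on (\<lambda>a. \<rho> (src e) (?c a) x) (carrier (Q\<lparr>carrier := A e\<rparr>))" if x: "x \<in> {1..n}" for x
      proof (rule inj_onI)
        fix a b assume ab: "a \<in> carrier (Q\<lparr>carrier := A e\<rparr>)" "b \<in> carrier (Q\<lparr>carrier := A e\<rparr>)"
          and eq: "\<rho> (src e) (?c a) x = \<rho> (src e) (?c b) x"
        have "?c a = ?c b"
          using ab by (intro \<rho>_inj[OF src_in[OF e] _ _ x eq] t_conj[OF e]) simp_all
        then show "a = b"
          using t_closed[OF e] A_closed[OF e] ab by (simp add: m_assoc)
      qed
    qed
    moreover have "finite (carrier (Q\<lparr>carrier := A e\<rparr>))" using A_fin[OF e] by simp
    ultimately obtain \<sigma> where "\<sigma> permutes {1..n}"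
      "\<And>a x. a \<in> carrier (Q\<lparr>carrier := A e\<rparr>) \<Longrightarrow> \<sigma> (\<rho> (tgt e) a x) = \<rho> (src e) (?c a) (\<sigma> x)"
      using free_actions_equivalent[OF A_group[OF e]] by blast
    then show ?thesis by (intro exI[of _ \<sigma>]) simp
  qed
  then have "\<exists>\<sigma>. \<forall>e\<in>E. \<sigma> e permutes {1..n} \<and>
      (\<forall>a\<in>A e. \<forall>x. \<sigma> e (\<rho> (tgt e) a x) = \<rho> (src e) (t e \<otimes> a \<otimes> inv t e) (\<sigma> e x))"
    by (intro bchoice ballI)
  then obtain \<sigma> where \<sigma>: "\<And>e. e \<in> E \<Longrightarrow> \<sigma> e permutes {1..n}"
    and \<sigma>_eq: "\<And>e a x. e \<in> E \<Longrightarrow> a \<in> A e \<Longrightarrow>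
      \<sigma> e (\<rho> (tgt e) a x) = \<rho> (src e) (t e \<otimes> a \<otimes> inv t e) (\<sigma> e x)"
    by blast
  have \<sigma>_closed: "\<sigma> e \<in> carrier ?S" if "e \<in> E" for e
    using \<sigma>[OF that] by (simp add: sym_group_carrier)
  have \<sigma>_mult: "\<sigma> e \<otimes>\<^bsub>?S\<^esub> \<rho> (tgt e) a = \<rho> (src e) (t e \<otimes> a \<otimes> inv t e) \<otimes>\<^bsub>?S\<^esub> \<sigma> e"
    if "e \<in> E" "a \<in> A e" for e a
    using \<sigma>_eq[OF that] by (simp add: sym_group_mult fun_eq_iff)
  have "\<sigma> e \<in> carrier ?S" if "e \<in> D" for e
    using that D_sub by (intro \<sigma>_closed) blast
  from grown_tree_potential_free[OF sym_group_is_group tree this] obtain \<pi> where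
    \<pi>_all: "(\<forall>v. \<pi> v \<in> carrier ?S) \<and>
      (\<forall>e\<in>D. \<pi> (src e) = \<sigma> e \<otimes>\<^bsub>?S\<^esub> \<pi> (tgt e))"
    by (rule exE)
  then have \<pi>: "\<And>v. \<pi> v \<in> carrier ?S"
    and \<pi>_tree: "\<And>e. e \<in> D \<Longrightarrow> \<pi> (src e) = \<sigma> e \<otimes>\<^bsub>?S\<^esub> \<pi> (tgt e)"
    by simp_all
  define f where "f = (\<lambda>v h. inv\<^bsub>?S\<^esub> \<pi> v \<otimes>\<^bsub>?S\<^esub> \<rho> v h \<otimes>\<^bsub>?S\<^esub> \<pi> v)"
  define s where "s = (\<lambda>e. inv\<^bsub>?S\<^esub> \<pi> (src e) \<otimes>\<^bsub>?S\<^esub> \<sigma> e \<otimes>\<^bsub>?S\<^esub> \<pi> (tgt e))"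
  have collect: "(inv\<^bsub>?S\<^esub> p \<otimes>\<^bsub>?S\<^esub> a \<otimes>\<^bsub>?S\<^esub> q) \<otimes>\<^bsub>?S\<^esub>
      (inv\<^bsub>?S\<^esub> q \<otimes>\<^bsub>?S\<^esub> b \<otimes>\<^bsub>?S\<^esub> r) =
      inv\<^bsub>?S\<^esub> p \<otimes>\<^bsub>?S\<^esub> (a \<otimes>\<^bsub>?S\<^esub> b) \<otimes>\<^bsub>?S\<^esub> r"
    if "p \<in> carrier ?S" "q \<in> carrier ?S" "r \<in> carrier ?S"
      "a \<in> carrier ?S" "b \<in> carrier ?S" for p q r a b
    using S.cancel_middle[of "inv\<^bsub>?S\<^esub> p \<otimes>\<^bsub>?S\<^esub> a" q "b \<otimes>\<^bsub>?S\<^esub> r"] that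
    by (simp only: S.m_assoc S.m_closed S.inv_closed)
  have f_closed: "f v h \<in> carrier ?S" if "v \<in> V" "h \<in> H v" for v h
    unfolding f_def by (intro S.m_closed S.inv_closed \<pi> \<rho>_closed[OF that])
  have s_closed: "s e \<in> carrier ?S" if "e \<in> E" for e
    unfolding s_def by (intro S.m_closed S.inv_closed \<pi> \<sigma>_closed[OF that])
  obtain \<phi> where \<phi>: "\<phi> \<in> hom Q ?S" "\<And>v h. v \<in> V \<Longrightarrow> h \<in> H v \<Longrightarrow> \<phi> h = f v h"
  proof (rule universal_forE[OF univ, of f n s])
    show "f v \<in> hom (Q\<lparr>carrier := H v\<rparr>) ?S" if "v \<in> V" for v
    proof (rule homI)
      fix h k assume hk: "h \<in> carrier (Q\<lparr>carrier := H v\<rparr>)" "k \<in> carrier (Q\<lparr>carrier := H v\<rparr>)"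
      then show "f v (h \<otimes>\<^bsub>Q\<lparr>carrier := H v\<rparr>\<^esub> k) = f v h \<otimes>\<^bsub>?S\<^esub> f v k"
        using collect[OF \<pi> \<pi> \<pi>] \<rho>_closed[OF that] \<rho>_mult[OF that] by (simp add: f_def)
    qed (use f_closed that in simp)
    show "s e \<in> carrier ?S" if "e \<in> E" for e
      using that by (rule s_closed)
    show "s e \<otimes>\<^bsub>?S\<^esub> f (tgt e) a = f (src e) (t e \<otimes> a \<otimes> inv t e) \<otimes>\<^bsub>?S\<^esub> s e"
      if e: "e \<in> E" and a: "a \<in> A e" for e a
      using collect[OF \<pi> \<pi> \<pi> \<sigma>_closed[OF e] \<rho>_closed[OF tgt_in[OF e]]]
        collect[OF \<pi> \<pi> \<pi> \<rho>_closed[OF src_in[OF e] t_conj[OF e a]] \<sigma>_closed[OF e]]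
        \<sigma>_mult[OF e a] A_sub[OF e] a
      by (auto simp: f_def s_def)
    show "s e = \<one>\<^bsub>?S\<^esub>" if "e \<in> D" for e
    proof -
      have "\<sigma> e \<in> carrier ?S" using that D_sub \<sigma>_closed by blast
      then show ?thesis
        using \<pi>_tree[OF that] \<pi>
        by (simp only: s_def S.m_assoc S.m_closed S.inv_closed) (metis S.l_inv)
    qed
  qed blast
  have "inj_on \<phi> (H v)" if v: "v \<in> V" for v
  proof (rule inj_onI)
    fix h k assume h: "h \<in> H v" and k: "k \<in> H v" and eq: "\<phi> h = \<phi> k"
    have "f v h = f v k" using eq \<phi>(2)[OF v] h k by simp
    then have "\<rho> v h = \<rho> v k"
      by (simp only: f_def S.right_cancel S.Units_l_cancel S.Units_eq S.m_closed S.inv_closed \<pi>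
          \<rho>_closed[OF v h] \<rho>_closed[OF v k])
    then show "h = k" using \<rho>_inj[OF v h k n_pos] by simp
  qed
  with \<phi>(1) show thesis by (rule that)
qed

section \<open>The kernel is free\<close>

text \<open>Homomorphisms to this group over a fixed homomorphism to \<open>P\<close> are the cocycles of the left action
  on \<open>P\<close> with values in \<open>F\<close>.  Functions are extensional on \<open>carrier P\<close> so that the group laws hold.\<close>

definition wreath_group :: "('p, 'm) monoid_scheme \<Rightarrow> ('f, 'n) monoid_scheme \<Rightarrow> ('p \<times> ('p \<Rightarrow> 'f)) monoid" where
  "wreath_group P F =
     \<lparr>carrier = carrier P \<times> (carrier P \<rightarrow>\<^sub>E carrier F),
      monoid.mult = (\<lambda>(a, c) (b, d). (a \<otimes>\<^bsub>P\<^esub> b, \<lambda>x\<in>carrier P. c (b \<otimes>\<^bsub>P\<^esub> x) \<otimes>\<^bsub>F\<^esub> d x)),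
      one = (\<one>\<^bsub>P\<^esub>, \<lambda>x\<in>carrier P. \<one>\<^bsub>F\<^esub>)\<rparr>"

lemma wreath_group_mult [simp]:
  "(a, c) \<otimes>\<^bsub>wreath_group P F\<^esub> (b, d) =
    (a \<otimes>\<^bsub>P\<^esub> b, \<lambda>x\<in>carrier P. c (b \<otimes>\<^bsub>P\<^esub> x) \<otimes>\<^bsub>F\<^esub> d x)"
  and wreath_group_one [simp]: "\<one>\<^bsub>wreath_group P F\<^esub> = (\<one>\<^bsub>P\<^esub>, \<lambda>x\<in>carrier P. \<one>\<^bsub>F\<^esub>)"
  and wreath_group_carrier: "carrier (wreath_group P F) = carrier P \<times> (carrier P \<rightarrow>\<^sub>E carrier F)"
  by (simp_all add: wreath_group_def)

lemma group_wreath_group: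
  assumes "group P" "group F"
  shows "group (wreath_group P F)"
proof (rule groupI)
  interpret P: group P by fact
  interpret F: group F by fact
  let ?W = "wreath_group P F"
  show "\<one>\<^bsub>?W\<^esub> \<in> carrier ?W" by (auto simp: wreath_group_carrier)
  fix u assume "u \<in> carrier ?W"
  then obtain a c where u: "u = (a, c)" and a: "a \<in> carrier P" and c: "c \<in> carrier P \<rightarrow>\<^sub>E carrier F"
    by (auto simp: wreath_group_carrier)
  have c': "c x \<in> carrier F" if "x \<in> carrier P" for x using c that by auto
  show "\<one>\<^bsub>?W\<^esub> \<otimes>\<^bsub>?W\<^esub> u = u"
    using a c c' by (auto simp: u PiE_def intro!: extensionalityI[of _ "carrier P"])
  show "\<exists>w\<in>carrier ?W. w \<otimes>\<^bsub>?W\<^esub> u = \<one>\<^bsub>?W\<^esub>"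
  proof
    let ?w = "(inv\<^bsub>P\<^esub> a, \<lambda>x\<in>carrier P. inv\<^bsub>F\<^esub> c (inv\<^bsub>P\<^esub> a \<otimes>\<^bsub>P\<^esub> x))"
    show "?w \<in> carrier ?W" using a c' by (auto simp: wreath_group_carrier)
    have "inv\<^bsub>P\<^esub> a \<otimes>\<^bsub>P\<^esub> (a \<otimes>\<^bsub>P\<^esub> x) = x" if "x \<in> carrier P" for x
      using a that P.m_assoc[of "inv\<^bsub>P\<^esub> a" a x] by simp
    then show "?w \<otimes>\<^bsub>?W\<^esub> u = \<one>\<^bsub>?W\<^esub>"
      using a c' by (auto simp: u intro!: restrict_ext)
  qed
  fix v assume "v \<in> carrier ?W"
  then obtain b d where v: "v = (b, d)" and b: "b \<in> carrier P" and d: "d \<in> carrier P \<rightarrow>\<^sub>E carrier F"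
    by (auto simp: wreath_group_carrier)
  have d': "d x \<in> carrier F" if "x \<in> carrier P" for x using d that by auto
  show "u \<otimes>\<^bsub>?W\<^esub> v \<in> carrier ?W"
    using a b c' d' by (auto simp: u v wreath_group_carrier)
  fix w assume "w \<in> carrier ?W"
  then obtain g k where w: "w = (g, k)" and g: "g \<in> carrier P" and k: "k \<in> carrier P \<rightarrow>\<^sub>E carrier F"
    by (auto simp: wreath_group_carrier)
  have k': "k x \<in> carrier F" if "x \<in> carrier P" for x using k that by auto
  show "u \<otimes>\<^bsub>?W\<^esub> v \<otimes>\<^bsub>?W\<^esub> w = u \<otimes>\<^bsub>?W\<^esub> (v \<otimes>\<^bsub>?W\<^esub> w)"
    using a b g c' d' k' by (auto simp: u v w P.m_assoc F.m_assoc intro!: restrict_ext)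
qed

lemma wreath_group_snd_mult:
  assumes "x \<in> carrier P"
  shows "snd (u \<otimes>\<^bsub>wreath_group P F\<^esub> w) x = snd u (fst w \<otimes>\<^bsub>P\<^esub> x) \<otimes>\<^bsub>F\<^esub> snd w x"
  using assms by (cases u; cases w) simp

lemma fst_wreath_group_hom: "fst \<in> hom (wreath_group P F) P"
  by (rule homI) (auto simp: wreath_group_carrier)

lemma (in group) cancel_left: "x \<in> carrier G \<Longrightarrow> y \<in> carrier G \<Longrightarrow> x \<otimes> (inv x \<otimes> y) = y"
  and cancel_left': "x \<in> carrier G \<Longrightarrow> y \<in> carrier G \<Longrightarrow> inv x \<otimes> (x \<otimes> y) = y"
  using m_assoc[of x "inv x" y] m_assoc[of "inv x" x y] by simp_all

text \<open>The finite group \<open>P\<close> serves as a set on which \<open>Q\<close> acts transitively, through \<open>\<phi>\<close> and left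
  multiplication; the vertex subgroups act freely because \<open>\<phi>\<close> is injective on them.\<close>

locale embedded_quotient = graph_of_subgroups Q V E D src tgt H A t
  for Q :: "('q, 'm) monoid_scheme" (structure) and V :: "'v set" and E D :: "'e set"
    and src tgt H A t +
  fixes P :: "('p, 'n) monoid_scheme" and \<phi> :: "'q \<Rightarrow> 'p"
  assumes P: "group P" and finite_P: "finite (carrier P)"
    and \<phi>_hom: "\<phi> \<in> hom Q P" and \<phi>_surj: "\<phi> ` carrier Q = carrier P"
    and \<phi>_inj: "v \<in> V \<Longrightarrow> inj_on \<phi> (H v)"
begin

interpretation P: group P by (rule P)

interpretation \<phi>: group_hom Q P \<phi> by unfold_locales (rule \<phi>_hom)

abbreviation "\<epsilon> \<equiv> \<one>\<^bsub>P\<^esub>"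

abbreviation act :: "'q \<Rightarrow> 'p \<Rightarrow> 'p" (infixr "\<star>" 75) where
  "g \<star> x \<equiv> \<phi> g \<otimes>\<^bsub>P\<^esub> x"

lemma act_act:
  "g \<in> carrier Q \<Longrightarrow> h \<in> carrier Q \<Longrightarrow> x \<in> carrier P \<Longrightarrow> (g \<otimes> h) \<star> x = g \<star> h \<star> x"
  by (simp add: P.m_assoc)

lemma act_closed: "g \<in> carrier Q \<Longrightarrow> x \<in> carrier P \<Longrightarrow> g \<star> x \<in> carrier P"
  by simp

lemma act_free:
  assumes "v \<in> V" "h \<in> H v" "k \<in> H v" "x \<in> carrier P" "h \<star> x = k \<star> x"
  shows "h = k"
  using assms H_closed[OF assms(1)] inj_onD[OF \<phi>_inj[OF assms(1)], of h k] by simp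

text \<open>The group \<open>Q\<close> acts on \<open>P\<close> by \<open>\<star>\<close>.  Consider the graph whose vertices are the pairs of a vertex \<open>v\<close> and
  an \<open>H v\<close>-orbit on \<open>P\<close>, in which a point \<open>x\<close> gives an edge from the orbit of \<open>x\<close> at \<open>tgt e\<close> to the
  orbit of \<open>t e \<star> x\<close> at \<open>src e\<close>.  A partial section is a lift of a subtree of this graph: \<open>S\<close> is the
  union of its orbits, and \<open>\<R> v x\<close> is the element of \<open>Q\<close> over \<open>x\<close> chosen at \<open>v\<close>, equivariantly under
  \<open>H v\<close>.  The last condition says that the edges along which \<open>\<R>\<close> is compatible with the stable letters
  connect all orbits in \<open>S\<close>.  It is stated as an induction principle, which is how it is used.\<close>

definition partial_section :: "'v \<Rightarrow> ('v \<times> 'p) set \<Rightarrow> ('v \<Rightarrow> 'p \<Rightarrow> 'q) \<Rightarrow> bool" where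
  "partial_section v0 S \<R> \<longleftrightarrow>
     S \<subseteq> V \<times> carrier P \<and> (v0, \<epsilon>) \<in> S \<and> \<R> v0 \<epsilon> = \<one> \<and>
     (\<forall>v x. (v, x) \<in> S \<longrightarrow> \<R> v x \<in> carrier Q \<and> \<phi> (\<R> v x) = x) \<and>
     (\<forall>v x. \<forall>h\<in>H v. (v, x) \<in> S \<longrightarrow> (v, h \<star> x) \<in> S \<and> \<R> v (h \<star> x) = h \<otimes> \<R> v x) \<and>
     (\<forall>q. q v0 \<epsilon> \<longrightarrow>
        (\<forall>v x. \<forall>h\<in>H v. (v, x) \<in> S \<longrightarrow> q v x \<longrightarrow> q v (h \<star> x)) \<longrightarrow>
        (\<forall>e\<in>E. \<forall>x. (tgt e, x) \<in> S \<longrightarrow> (src e, t e \<star> x) \<in> S \<longrightarrow>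
           \<R> (src e) (t e \<star> x) = t e \<otimes> \<R> (tgt e) x \<longrightarrow> (q (tgt e) x \<longleftrightarrow> q (src e) (t e \<star> x))) \<longrightarrow>
        (\<forall>v x. (v, x) \<in> S \<longrightarrow> q v x))"

lemma
  assumes "partial_section v0 S \<R>"
  shows section_sub: "S \<subseteq> V \<times> carrier P"
    and section_base: "(v0, \<epsilon>) \<in> S" "\<R> v0 \<epsilon> = \<one>"
    and section_closed: "(v, x) \<in> S \<Longrightarrow> \<R> v x \<in> carrier Q"
    and section_\<phi>: "(v, x) \<in> S \<Longrightarrow> \<phi> (\<R> v x) = x"
    and section_orbit: "h \<in> H v \<Longrightarrow> (v, x) \<in> S \<Longrightarrow> (v, h \<star> x) \<in> S"
    and section_equivariant: "h \<in> H v \<Longrightarrow> (v, x) \<in> S \<Longrightarrow> \<R> v (h \<star> x) = h \<otimes> \<R> v x"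
  using assms unfolding partial_section_def by simp_all

lemma section_connected:
  assumes "partial_section v0 S \<R>" "q v0 \<epsilon>"
    and "\<And>v x h. h \<in> H v \<Longrightarrow> (v, x) \<in> S \<Longrightarrow> q v x \<Longrightarrow> q v (h \<star> x)"
    and "\<And>e x. e \<in> E \<Longrightarrow> (tgt e, x) \<in> S \<Longrightarrow> (src e, t e \<star> x) \<in> S \<Longrightarrow>
      \<R> (src e) (t e \<star> x) = t e \<otimes> \<R> (tgt e) x \<Longrightarrow> q (tgt e) x \<longleftrightarrow> q (src e) (t e \<star> x)"
    and "(v, x) \<in> S"
  shows "q v x"
proof -
  have "\<forall>v x. (v, x) \<in> S \<longrightarrow> q v x"
    using assms(1)[unfolded partial_section_def, THEN conjunct2, THEN conjunct2, THEN conjunct2,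
        THEN conjunct2, THEN conjunct2, rule_format, of q] assms(2-4) by simp
  then show ?thesis using assms(5) by simp
qed

text \<open>The orbit of the base point alone; the action of \<open>H v0\<close> is free, so \<open>\<R>\<close> can be transported
  along it.\<close>

lemma section_exists:
  assumes v0: "v0 \<in> V"
  shows "\<exists>S \<R>. partial_section v0 S \<R>"
proof -
  define S where "S = {v0} \<times> \<phi> ` H v0"
  define \<R> where "\<R> = (\<lambda>v::'v. inv_into (H v0) \<phi>)"
  have \<R>: "\<R> v (\<phi> h) = h" if "h \<in> H v0" for v h
    unfolding \<R>_def by (rule inv_into_f_f[OF \<phi>_inj[OF v0] that])
  have one: "\<one> \<in> H v0" by (rule subgroup.one_closed[OF H_subgroup[OF v0]])
  have mult: "h \<otimes> k \<in> H v0" "\<phi> h \<otimes>\<^bsub>P\<^esub> \<phi> k = \<phi> (h \<otimes> k)" if "h \<in> H v0" "k \<in> H v0" for h k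
    using subgroup.m_closed[OF H_subgroup[OF v0] that] H_closed[OF v0] that by simp_all
  have S_elim: "\<exists>k. v = v0 \<and> x = \<phi> k \<and> k \<in> H v0" if "(v, x) \<in> S" for v x
    using that unfolding S_def by blast
  have "partial_section v0 S \<R>"
    unfolding partial_section_def
  proof (intro conjI allI impI ballI)
    show "S \<subseteq> V \<times> carrier P" using v0 H_closed[OF v0] unfolding S_def by auto
    show "(v0, \<epsilon>) \<in> S" using one unfolding S_def by (metis SigmaI \<phi>.hom_one image_eqI singletonI)
    show "\<R> v0 \<epsilon> = \<one>" using \<R>[OF one] by simp
  next
    fix v x assume "(v, x) \<in> S"
    then obtain k where k: "v = v0" "x = \<phi> k" "k \<in> H v0" using S_elim by blast
    then show "\<R> v x \<in> carrier Q" "\<phi> (\<R> v x) = x" using \<R> H_closed[OF v0] by simp_all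
  next
    fix v x h assume h: "h \<in> H v" and "(v, x) \<in> S"
    then obtain k where k: "v = v0" "x = \<phi> k" "k \<in> H v0" using S_elim by blast
    show "(v, h \<star> x) \<in> S" "\<R> v (h \<star> x) = h \<otimes> \<R> v x"
      using mult[of h k] h k \<R> unfolding S_def by simp_all
  next
    fix q :: "'v \<Rightarrow> 'p \<Rightarrow> bool" and v x
    assume q: "q v0 \<epsilon>" "\<forall>v x. \<forall>h\<in>H v. (v, x) \<in> S \<longrightarrow> q v x \<longrightarrow> q v (h \<star> x)"
      and "(v, x) \<in> S"
    then obtain k where k: "v = v0" "x = \<phi> k" "k \<in> H v0" using S_elim by blast
    moreover have "(v0, \<epsilon>) \<in> S" using one unfolding S_def by (metis SigmaI \<phi>.hom_one image_eqI singletonI)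
    ultimately have "q v0 (k \<star> \<epsilon>)" using q by blast
    then show "q v x" using k H_closed[OF v0] by simp
  qed
  then show ?thesis by blast
qed

text \<open>If an edge leads from \<open>S\<close> to a new orbit, the value of \<open>\<R>\<close> at the new end is forced by the requirement
  that the edge be compatible, and freeness transports it along the new orbit.\<close>

lemma section_extend:
  assumes sec: "partial_section v0 S \<R>" and new: "(v, x) \<notin> S" and v: "v \<in> V"
    and r: "r \<in> carrier Q" "\<phi> r = x" and e: "e \<in> E"
    and link: "(tgt e, z) \<in> S \<and> v = src e \<and> x = t e \<star> z \<and> r = t e \<otimes> \<R> (tgt e) z \<or>
      (src e, t e \<star> z) \<in> S \<and> v = tgt e \<and> x = z \<and> \<R> (src e) (t e \<star> z) = t e \<otimes> r"
  shows "\<exists>S' \<R>'. partial_section v0 S' \<R>' \<and> S \<subset> S'"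
proof -
  define S' where "S' = S \<union> {v} \<times> (\<lambda>h. h \<star> x) ` H v"
  define \<R>' where "\<R>' = (\<lambda>w y. if (w, y) \<in> S then \<R> w y else inv_into (H v) (\<lambda>h. h \<star> x) y \<otimes> r)"
  have x: "x \<in> carrier P" using r by auto
  note Hv = H_subgroup[OF v]
  have one: "\<one> \<in> H v" by (rule subgroup.one_closed[OF Hv])
  have new_orbit: "(v, h \<star> x) \<notin> S" if "h \<in> H v" for h
  proof
    assume "(v, h \<star> x) \<in> S"
    from section_orbit[OF sec subgroup.m_inv_closed[OF Hv that] this]
    have "(v, inv h \<star> h \<star> x) \<in> S" .
    then show False
      using new H_closed[OF v that] x act_act[of "inv h" h x] by simp
  qed
  have inj: "inj_on (\<lambda>h. h \<star> x) (H v)"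
    using act_free[OF v _ _ x] by (auto intro: inj_onI)
  have \<R>'_old: "\<R>' w y = \<R> w y" if "(w, y) \<in> S" for w y
    using that by (simp add: \<R>'_def)
  have \<R>'_new: "\<R>' v (h \<star> x) = h \<otimes> r" if "h \<in> H v" for h
    using new_orbit[OF that] inv_into_f_f[OF inj that] by (simp add: \<R>'_def)
  have S'_elim: "(w, y) \<in> S \<or> (\<exists>h. w = v \<and> y = h \<star> x \<and> h \<in> H v)" if "(w, y) \<in> S'" for w y
    using that unfolding S'_def by blast
  have S'_new: "(v, h \<star> x) \<in> S'" if "h \<in> H v" for h
    using that unfolding S'_def by blast
  have one_x: "\<one> \<star> x = x" using x by simp
  have x_new: "(v, x) \<in> S'" "\<R>' v x = r"
    using S'_new[OF one] \<R>'_new[OF one] one_x r(1) by simp_all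
  have mult: "h \<otimes> k \<in> H v" "h \<star> k \<star> x = (h \<otimes> k) \<star> x" if "h \<in> H v" "k \<in> H v" for h k
    using subgroup.m_closed[OF Hv that] H_closed[OF v] that x act_act by simp_all
  have "partial_section v0 S' \<R>'"
    unfolding partial_section_def
  proof (intro conjI allI impI ballI)
    show "S' \<subseteq> V \<times> carrier P"
      using section_sub[OF sec] v x H_closed[OF v] unfolding S'_def by auto
    show "(v0, \<epsilon>) \<in> S'" using section_base(1)[OF sec] unfolding S'_def by blast
    show "\<R>' v0 \<epsilon> = \<one>" using section_base[OF sec] \<R>'_old by simp
  next
    fix w y assume "(w, y) \<in> S'"
    from S'_elim[OF this] have "\<R>' w y \<in> carrier Q \<and> \<phi> (\<R>' w y) = y"
    proof (elim disjE exE conjE)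
      assume "(w, y) \<in> S"
      then show ?thesis using section_closed[OF sec] section_\<phi>[OF sec] \<R>'_old by simp
    next
      fix h assume "w = v" "y = h \<star> x" "h \<in> H v"
      then show ?thesis using \<R>'_new r H_closed[OF v] by simp
    qed
    then show "\<R>' w y \<in> carrier Q" "\<phi> (\<R>' w y) = y" by simp_all
  next
    fix w y h assume h: "h \<in> H w" and "(w, y) \<in> S'"
    from S'_elim[OF this(2)] have "(w, h \<star> y) \<in> S' \<and> \<R>' w (h \<star> y) = h \<otimes> \<R>' w y"
    proof (elim disjE exE conjE)
      assume "(w, y) \<in> S"
      then show ?thesis
        using section_orbit[OF sec h] section_equivariant[OF sec h] \<R>'_old unfolding S'_def by simp
    next
      fix k assume k: "w = v" "y = k \<star> x" "k \<in> H v"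
      then show ?thesis
        using mult[of h k] h S'_new[of "h \<otimes> k"] \<R>'_new[of "h \<otimes> k"] \<R>'_new[of k]
          H_closed[OF v] r(1) by (simp add: m_assoc)
    qed
    then show "(w, h \<star> y) \<in> S'" "\<R>' w (h \<star> y) = h \<otimes> \<R>' w y" by simp_all
  next
    fix q :: "'v \<Rightarrow> 'p \<Rightarrow> bool" and w y
    assume q0: "q v0 \<epsilon>"
      and q1: "\<forall>v x. \<forall>h\<in>H v. (v, x) \<in> S' \<longrightarrow> q v x \<longrightarrow> q v (h \<star> x)"
      and q2: "\<forall>e\<in>E. \<forall>x. (tgt e, x) \<in> S' \<longrightarrow> (src e, t e \<star> x) \<in> S' \<longrightarrow>
        \<R>' (src e) (t e \<star> x) = t e \<otimes> \<R>' (tgt e) x \<longrightarrow> (q (tgt e) x \<longleftrightarrow> q (src e) (t e \<star> x))"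
      and wy: "(w, y) \<in> S'"
    have old_new: "(w, y) \<in> S'" if "(w, y) \<in> S" for w y using that unfolding S'_def by blast
    have old: "q w y" if "(w, y) \<in> S" for w y
    proof (rule section_connected[OF sec, of q, OF q0 _ _ that])
      show "q v (h \<star> x)" if "h \<in> H v" "(v, x) \<in> S" "q v x" for v x h
        using q1 old_new[OF that(2)] that(1,3) by blast
      show "q (tgt e) x \<longleftrightarrow> q (src e) (t e \<star> x)"
        if "e \<in> E" "(tgt e, x) \<in> S" "(src e, t e \<star> x) \<in> S"
          "\<R> (src e) (t e \<star> x) = t e \<otimes> \<R> (tgt e) x" for e x
        using q2 that(1) old_new[OF that(2)] old_new[OF that(3)] \<R>'_old[OF that(2)]
          \<R>'_old[OF that(3)] that(4) by simp
    qed
    from link have "q v x"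
    proof (elim disjE conjE)
      assume l: "(tgt e, z) \<in> S" "v = src e" "x = t e \<star> z" "r = t e \<otimes> \<R> (tgt e) z"
      then have "q (tgt e) z \<longleftrightarrow> q (src e) (t e \<star> z)"
        using q2[rule_format, OF e old_new[OF l(1)]] x_new \<R>'_old[OF l(1)] by simp
      then show ?thesis using old[OF l(1)] l(2,3) by simp
    next
      assume l: "(src e, t e \<star> z) \<in> S" "v = tgt e" "x = z" "\<R> (src e) (t e \<star> z) = t e \<otimes> r"
      then have "q (tgt e) z \<longleftrightarrow> q (src e) (t e \<star> z)"
        using q2[rule_format, OF e _ old_new[OF l(1)]] x_new \<R>'_old[OF l(1)] by simp
      then show ?thesis using old[OF l(1)] l(2,3) by simp
    qed
    then show "q w y"
      using S'_elim[OF wy] old q1 x_new(1) by blast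
  qed
  moreover have "S \<subset> S'" using x_new(1) new unfolding S'_def by blast
  ultimately show ?thesis by blast
qed

text \<open>A maximal partial section is closed under all edges.  Along the edges of the tree the stable letters
  are trivial, so whether \<open>(v, x)\<close> belongs to \<open>S\<close> depends on \<open>x\<close> only; the elements that preserve this
  condition form a subgroup that contains all generators, and \<open>Q\<close> acts transitively on \<open>P\<close>.\<close>

lemma section_total:
  assumes v0: "v0 \<in> V"
  shows "\<exists>\<R>. partial_section v0 (V \<times> carrier P) \<R>"
proof -
  define good where "good = (\<lambda>S. \<exists>\<R>. partial_section v0 S \<R>)"
  have fin: "finite (V \<times> carrier P)" using finite_V finite_P by simp
  obtain S1 where S1: "good S1" using section_exists[OF v0] unfolding good_def by blast
  have "\<forall>S. good S \<longrightarrow> card S < Suc (card (V \<times> carrier P))"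
    using card_mono[OF fin section_sub] unfolding good_def less_Suc_eq_le by blast
  from ex_has_greatest_nat[of good, OF S1 this] obtain S
    where "good S" and max: "\<And>S'. good S' \<Longrightarrow> card S' \<le> card S"
    by metis
  then obtain \<R> where sec: "partial_section v0 S \<R>" unfolding good_def by blast
  note sub = section_sub[OF sec]
  have no_ext: False if "partial_section v0 S' \<R>'" "S \<subset> S'" for S' \<R>'
  proof -
    have "finite S'" using section_sub[OF that(1)] fin finite_subset by blast
    then show False
      using psubset_card_mono[OF _ that(2)] max[of S'] that(1) unfolding good_def by (meson not_le)
  qed
  have edge: "(tgt e, z) \<in> S \<longleftrightarrow> (src e, t e \<star> z) \<in> S" if e: "e \<in> E" and z: "z \<in> carrier P" for e z
  proof (rule ccontr)
    assume "\<not> ?thesis"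
    then consider "(tgt e, z) \<in> S" "(src e, t e \<star> z) \<notin> S" | "(src e, t e \<star> z) \<in> S" "(tgt e, z) \<notin> S"
      by blast
    then show False
    proof cases
      case 1
      have "\<phi> (t e \<otimes> \<R> (tgt e) z) = t e \<star> z"
        using t_closed[OF e] section_closed[OF sec 1(1)] section_\<phi>[OF sec 1(1)] by simp
      moreover have "t e \<otimes> \<R> (tgt e) z \<in> carrier Q"
        using t_closed[OF e] section_closed[OF sec 1(1)] by simp
      ultimately have "\<exists>S' \<R>'. partial_section v0 S' \<R>' \<and> S \<subset> S'"
        using 1(1) by (intro section_extend[OF sec 1(2) src_in[OF e] _ _ e disjI1]) blast+
      then show False using no_ext by (elim exE conjE)
    next
      case 2
      let ?r = "inv t e \<otimes> \<R> (src e) (t e \<star> z)"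
      have "\<phi> ?r = inv\<^bsub>P\<^esub> \<phi> (t e) \<otimes>\<^bsub>P\<^esub> (t e \<star> z)"
        using t_closed[OF e] section_closed[OF sec 2(1)] section_\<phi>[OF sec 2(1)] by simp
      then have "\<phi> ?r = z" using t_closed[OF e] z by (simp add: P.cancel_left')
      moreover have "\<R> (src e) (t e \<star> z) = t e \<otimes> ?r"
        using t_closed[OF e] section_closed[OF sec 2(1)] by (simp add: cancel_left)
      moreover have "?r \<in> carrier Q"
        using t_closed[OF e] section_closed[OF sec 2(1)] by simp
      ultimately have "\<exists>S' \<R>'. partial_section v0 S' \<R>' \<and> S \<subset> S'"
        using 2(1) by (intro section_extend[OF sec 2(2) tgt_in[OF e] _ _ e disjI2]) blast+
      then show False using no_ext by (elim exE conjE)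
    qed
  qed
  have tree_const: "((v, x) \<in> S) = ((w, x) \<in> S)" if x: "x \<in> carrier P" and "v \<in> V" "w \<in> V" for v w x
  proof (rule grown_tree_connected[OF tree _ that(2,3)])
    fix e assume "e \<in> D"
    then show "((src e, x) \<in> S) = ((tgt e, x) \<in> S)"
      using edge[of e x] D_sub t_tree[of e] x by auto
  qed
  define K where "K = {g \<in> carrier Q. \<forall>x\<in>carrier P. (v0, x) \<in> S \<longleftrightarrow> (v0, g \<star> x) \<in> S}"
  have K_inv: "inv g \<in> K" if "g \<in> K" for g
  proof -
    have g: "g \<in> carrier Q" and *: "\<And>x. x \<in> carrier P \<Longrightarrow> (v0, x) \<in> S \<longleftrightarrow> (v0, g \<star> x) \<in> S"
      using that unfolding K_def by blast+
    have "(v0, x) \<in> S \<longleftrightarrow> (v0, inv g \<star> x) \<in> S" if x: "x \<in> carrier P" for x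
      using *[of "inv g \<star> x"] g x by (simp add: P.cancel_left)
    then show ?thesis using g unfolding K_def by simp
  qed
  have "K = carrier Q"
  proof (rule generated)
    show "subgroup K Q"
    proof (rule subgroupI)
      show "K \<subseteq> carrier Q" unfolding K_def by blast
      have "\<one> \<in> K" unfolding K_def by simp
      then show "K \<noteq> {}" by blast
      show "inv g \<in> K" if "g \<in> K" for g using that by (rule K_inv)
      show "g \<otimes> h \<in> K" if g: "g \<in> K" and h: "h \<in> K" for g h
      proof -
        have gh: "g \<in> carrier Q" "h \<in> carrier Q" using g h unfolding K_def by blast+
        have "(v0, x) \<in> S \<longleftrightarrow> (v0, (g \<otimes> h) \<star> x) \<in> S" if x: "x \<in> carrier P" for x
          unfolding act_act[OF gh x] using g h act_closed[OF gh(2) x] x unfolding K_def by blast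
        then show ?thesis using gh unfolding K_def by simp
      qed
    qed
    show "H v \<subseteq> K" if v: "v \<in> V" for v
    proof
      fix h assume h: "h \<in> H v"
      have "(v0, x) \<in> S \<longleftrightarrow> (v0, h \<star> x) \<in> S" if x: "x \<in> carrier P" for x
      proof -
        have hx: "h \<star> x \<in> carrier P" using H_closed[OF v h] x by simp
        have "(v, h \<star> x) \<in> S \<Longrightarrow> (v, inv h \<star> h \<star> x) \<in> S"
          by (rule section_orbit[OF sec subgroup.m_inv_closed[OF H_subgroup[OF v] h]])
        then have "(v, x) \<in> S \<longleftrightarrow> (v, h \<star> x) \<in> S"
          using section_orbit[OF sec h] H_closed[OF v h] x by (auto simp: P.cancel_left')
        then show ?thesis using tree_const[OF x v0 v] tree_const[OF hx v0 v] by simp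
      qed
      then show "h \<in> K" using H_closed[OF v h] unfolding K_def by blast
    qed
    show "t e \<in> K" if e: "e \<in> E" for e
    proof -
      have "(v0, x) \<in> S \<longleftrightarrow> (v0, t e \<star> x) \<in> S" if x: "x \<in> carrier P" for x
        using edge[OF e x] tree_const[OF x v0 tgt_in[OF e]]
          tree_const[OF act_closed[OF t_closed[OF e] x] v0 src_in[OF e]] by simp
      then show ?thesis using t_closed[OF e] unfolding K_def by blast
    qed
  qed
  have "(v, x) \<in> S" if v: "v \<in> V" and x: "x \<in> carrier P" for v x
  proof -
    have "x \<in> \<phi> ` carrier Q" using x \<phi>_surj by simp
    then obtain g where g: "g \<in> K" "x = \<phi> g" unfolding \<open>K = carrier Q\<close> by blast
    then have "(v0, \<epsilon>) \<in> S \<longleftrightarrow> (v0, g \<star> \<epsilon>) \<in> S"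
      using P.one_closed unfolding K_def by blast
    then show ?thesis
      using g section_base(1)[OF sec] tree_const[OF x v0 v] x by simp
  qed
  then have "S = V \<times> carrier P" using sub by auto
  with sec show ?thesis by blast
qed

text \<open>Every edge \<open>e\<close> and point \<open>x\<close> give an element \<open>Y e x\<close> of the kernel, which measures how far \<open>\<R>\<close> is from
  being compatible with \<open>t e\<close> at \<open>x\<close>.  The nontrivial ones form the basis \<open>X\<close>.  Letters are elements of the
  kernel rather than edges of the graph of orbits: pairs \<open>(e, x)\<close> with the same element share their
  letter by construction, and the evaluation \<open>\<beta>\<close> is induced by the inclusion of \<open>X\<close>.\<close>

lemma kernel_is_free:
  assumes univ: "\<And>X :: 'q set. universal_for (wreath_group P (free_group X))"
  shows "is_free (Q\<lparr>carrier := kernel Q P \<phi>\<rparr>)"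
proof -
  obtain v0 where v0: "v0 \<in> V" using V_nonempty by blast
  obtain \<R> where sec: "partial_section v0 (V \<times> carrier P) \<R>"
    using section_total[OF v0] by blast
  have \<R>_closed [simp]: "\<R> v x \<in> carrier Q" and \<R>_\<phi> [simp]: "\<phi> (\<R> v x) = x"
    if "v \<in> V" "x \<in> carrier P" for v x
    using section_closed[OF sec, of v x] section_\<phi>[OF sec, of v x] that by simp_all
  have \<R>_H: "\<R> v (h \<star> x) = h \<otimes> \<R> v x" if "v \<in> V" "h \<in> H v" "x \<in> carrier P" for v h x
    using section_equivariant[OF sec, of h v x] that by simp
  have \<R>_base: "\<R> v0 \<epsilon> = \<one>" by (rule section_base(2)[OF sec])

  define Y where "Y = (\<lambda>e x. inv \<R> (src e) (t e \<star> x) \<otimes> (t e \<otimes> \<R> (tgt e) x))"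
  define X where "X = {Y e x | e x. e \<in> E \<and> x \<in> carrier P} - {\<one>}"
  define F where "F = free_group X"
  have F_group: "group F" unfolding F_def free_group_def by (rule group_presented_group)
  interpret F: group F by (rule F_group)
  define \<iota> where "\<iota> = (\<lambda>k. word_class X {} [(k, True)])"
  define y where "y = (\<lambda>e x. if Y e x = \<one> then \<one>\<^bsub>F\<^esub> else \<iota> (Y e x))"
  have act_in [simp]: "g \<star> x \<in> carrier P" if "g \<in> carrier Q" "x \<in> carrier P" for g x
    using that by (rule act_closed)
  have Y_closed [simp]: "Y e x \<in> carrier Q" if "e \<in> E" "x \<in> carrier P" for e x
    using that t_closed src_in tgt_in by (simp add: Y_def)
  have Y_ker: "\<phi> (Y e x) = \<epsilon>" if "e \<in> E" "x \<in> carrier P" for e x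
    using that t_closed src_in tgt_in by (simp add: Y_def)
  have X_sub: "X \<subseteq> carrier Q" and X_ker: "\<And>k. k \<in> X \<Longrightarrow> \<phi> k = \<epsilon>"
    using Y_closed Y_ker by (auto simp: X_def)
  have \<iota>_closed: "\<iota> k \<in> carrier F" if "k \<in> X" for k
    using that by (simp add: \<iota>_def F_def free_group_def word_class_in_carrier)
  have y_closed [simp]: "y e x \<in> carrier F" if "e \<in> E" "x \<in> carrier P" for e x
  proof (cases "Y e x = \<one>")
    case False
    then have "Y e x \<in> X" using that unfolding X_def by blast
    with False show ?thesis by (simp add: y_def \<iota>_closed)
  qed (simp add: y_def)

  have X_car: "k \<in> carrier Q" if "k \<in> X" for k using X_sub that by blast
  have "\<exists>\<beta>. \<beta> \<in> hom F Q \<and> (\<forall>k\<in>X. \<beta> (\<iota> k) = k)"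
    unfolding F_def free_group_def \<iota>_def
    by (rule presented_group_hom[where f = "\<lambda>k. k" and R = "{}", OF is_group X_car]) auto
  then obtain \<beta> where \<beta>: "\<beta> \<in> hom F Q" "\<And>k. k \<in> X \<Longrightarrow> \<beta> (\<iota> k) = k" by blast
  interpret \<beta>: group_hom F Q \<beta> by unfold_locales (rule \<beta>(1))
  have \<beta>_y: "\<beta> (y e x) = Y e x" if "e \<in> E" "x \<in> carrier P" for e x
  proof (cases "Y e x = \<one>")
    case False
    then have "Y e x \<in> X" using that unfolding X_def by blast
    with False show ?thesis by (simp add: y_def \<beta>(2))
  qed (simp add: y_def)

  have t_A: "t e \<star> a \<star> x = (t e \<otimes> a \<otimes> inv t e) \<star> t e \<star> x"
    if e: "e \<in> E" and a: "a \<in> A e" and x: "x \<in> carrier P" for e a x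
  proof -
    have "(t e \<otimes> a \<otimes> inv t e) \<otimes> t e = t e \<otimes> a"
      using t_closed[OF e] A_closed[OF e a] by (simp add: m_assoc)
    then show ?thesis
      using act_act[of "t e \<otimes> a \<otimes> inv t e" "t e" x] act_act[of "t e" a x]
        t_closed[OF e] A_closed[OF e a] x by simp
  qed
  (* Y e x depends on the orbit of x under the edge group only, hence so does the letter y e x. *)
  have Y_A: "Y e (a \<star> x) = Y e x" if e: "e \<in> E" and a: "a \<in> A e" and x: "x \<in> carrier P" for e a x
  proof -
    note [simp] = t_closed[OF e] A_closed[OF e a] src_in[OF e] tgt_in[OF e] x
    let ?c = "t e \<otimes> a \<otimes> inv t e" and ?r = "\<R> (src e) (t e \<star> x)" and ?r' = "\<R> (tgt e) x"
    have r: "?r \<in> carrier Q" "?r' \<in> carrier Q" by (auto intro: \<R>_closed)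
    have "\<R> (src e) (t e \<star> a \<star> x) = ?c \<otimes> ?r"
      unfolding t_A[OF e a x] by (rule \<R>_H[OF src_in[OF e] t_conj[OF e a]]) simp
    moreover have "\<R> (tgt e) (a \<star> x) = a \<otimes> ?r'"
      using A_sub[OF e] a by (intro \<R>_H[OF tgt_in[OF e]]) auto
    moreover have "t e \<otimes> (a \<otimes> ?r') = ?c \<otimes> (t e \<otimes> ?r')"
      using r by (simp add: m_assoc cancel_left')
    moreover have "inv (?c \<otimes> ?r) \<otimes> (?c \<otimes> (t e \<otimes> ?r')) = inv ?r \<otimes> (t e \<otimes> ?r')"
      using r by (simp add: inv_mult_group[of ?c ?r] m_assoc[of "inv ?r" "inv ?c"] cancel_left'
          del: m_assoc)
    ultimately show ?thesis unfolding Y_def by simp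
  qed
  then have y_A: "y e (a \<star> x) = y e x" if "e \<in> E" "a \<in> A e" "x \<in> carrier P" for e a x
    using that by (simp add: y_def)

  (* p x v is the product of letters along the path in the tree from v to the base vertex,
     lifted to the graph of orbits at x. *)
  have "\<exists>p. (\<forall>v. p v \<in> carrier F) \<and> (\<forall>e\<in>D. p (src e) = y e x \<otimes>\<^bsub>F\<^esub> p (tgt e)) \<and> p v0 = \<one>\<^bsub>F\<^esub>"
    if x: "x \<in> carrier P" for x
  proof -
    have y_D: "y e x \<in> carrier F" if "e \<in> D" for e using that x D_sub by auto
    show ?thesis
      by (rule grown_tree_potential[OF F_group tree y_D, of _ v0]) blast+
  qed
  then have "\<exists>p. \<forall>x\<in>carrier P. (\<forall>v. p x v \<in> carrier F) \<and>
      (\<forall>e\<in>D. p x (src e) = y e x \<otimes>\<^bsub>F\<^esub> p x (tgt e)) \<and> p x v0 = \<one>\<^bsub>F\<^esub>"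
    by (intro bchoice ballI)
  then obtain p where p_closed [simp]: "\<And>x v. x \<in> carrier P \<Longrightarrow> p x v \<in> carrier F"
    and p_tree: "\<And>x e. x \<in> carrier P \<Longrightarrow> e \<in> D \<Longrightarrow> p x (src e) = y e x \<otimes>\<^bsub>F\<^esub> p x (tgt e)"
    and p_base: "\<And>x. x \<in> carrier P \<Longrightarrow> p x v0 = \<one>\<^bsub>F\<^esub>"
    by blast

  let ?W = "wreath_group P F"
  have W_group: "group ?W" by (rule group_wreath_group[OF P F_group])
  interpret W: group ?W by (rule W_group)
  (* An element of H v moves x inside one vertex of the graph of orbits; seen from the base
     vertex this is the path from x to that vertex and back to h \<star> x. *)
  define f where "f = (\<lambda>v h. (\<phi> h, \<lambda>x\<in>carrier P. inv\<^bsub>F\<^esub> p (h \<star> x) v \<otimes>\<^bsub>F\<^esub> p x v))"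
  define s where "s = (\<lambda>e. (\<phi> (t e), \<lambda>x\<in>carrier P.
    inv\<^bsub>F\<^esub> p (t e \<star> x) (src e) \<otimes>\<^bsub>F\<^esub> (y e x \<otimes>\<^bsub>F\<^esub> p x (tgt e))))"
  obtain \<Theta> where \<Theta>_hom: "\<Theta> \<in> hom Q ?W" and \<Theta>_H: "\<And>v h. v \<in> V \<Longrightarrow> h \<in> H v \<Longrightarrow> \<Theta> h = f v h"
    and \<Theta>_t: "\<And>e. e \<in> E \<Longrightarrow> \<Theta> (t e) = s e"
  proof (rule universal_forE[OF univ[of X, folded F_def], of f s])
    show "f v \<in> hom (Q\<lparr>carrier := H v\<rparr>) ?W" if v: "v \<in> V" for v
    proof (rule homI)
      fix h assume h: "h \<in> carrier (Q\<lparr>carrier := H v\<rparr>)"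
      then show "f v h \<in> carrier ?W"
        using H_closed[OF v] by (auto simp: f_def wreath_group_carrier)
      fix k assume k: "k \<in> carrier (Q\<lparr>carrier := H v\<rparr>)"
      have hk: "h \<in> carrier Q" "k \<in> carrier Q" using h k H_closed[OF v] by simp_all
      have "inv\<^bsub>F\<^esub> p ((h \<otimes> k) \<star> x) v \<otimes>\<^bsub>F\<^esub> p x v =
          (inv\<^bsub>F\<^esub> p (h \<star> k \<star> x) v \<otimes>\<^bsub>F\<^esub> p (k \<star> x) v) \<otimes>\<^bsub>F\<^esub> (inv\<^bsub>F\<^esub> p (k \<star> x) v \<otimes>\<^bsub>F\<^esub> p x v)"
        if x: "x \<in> carrier P" for x
        using hk x unfolding act_act[OF hk x] by (subst F.cancel_middle) auto
      then show "f v (h \<otimes>\<^bsub>Q\<lparr>carrier := H v\<rparr>\<^esub> k) = f v h \<otimes>\<^bsub>?W\<^esub> f v k"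
        using hk by (auto simp: f_def intro!: restrict_ext)
    qed
    show "s e \<in> carrier ?W" if "e \<in> E" for e
      using that t_closed by (auto simp: s_def wreath_group_carrier)
    show "s e \<otimes>\<^bsub>?W\<^esub> f (tgt e) a = f (src e) (t e \<otimes> a \<otimes> inv t e) \<otimes>\<^bsub>?W\<^esub> s e"
      if e: "e \<in> E" and a: "a \<in> A e" for e a
    proof -
      note [simp] = t_closed[OF e] A_closed[OF e a]
      let ?c = "t e \<otimes> a \<otimes> inv t e"
      have c: "?c \<in> carrier Q" by simp
      have snd_eq: "(inv\<^bsub>F\<^esub> p (t e \<star> a \<star> x) (src e) \<otimes>\<^bsub>F\<^esub> (y e (a \<star> x) \<otimes>\<^bsub>F\<^esub> p (a \<star> x) (tgt e))) \<otimes>\<^bsub>F\<^esub>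
            (inv\<^bsub>F\<^esub> p (a \<star> x) (tgt e) \<otimes>\<^bsub>F\<^esub> p x (tgt e)) =
          (inv\<^bsub>F\<^esub> p (?c \<star> t e \<star> x) (src e) \<otimes>\<^bsub>F\<^esub> p (t e \<star> x) (src e)) \<otimes>\<^bsub>F\<^esub>
            (inv\<^bsub>F\<^esub> p (t e \<star> x) (src e) \<otimes>\<^bsub>F\<^esub> (y e x \<otimes>\<^bsub>F\<^esub> p x (tgt e)))" (is "?l = ?r")
        if x: "x \<in> carrier P" for x
      proof -
        have [simp]: "t e \<star> x \<in> carrier P" "a \<star> x \<in> carrier P" "t e \<star> a \<star> x \<in> carrier P"
          using x by (auto intro: act_in)
        have "?l = inv\<^bsub>F\<^esub> p (t e \<star> a \<star> x) (src e) \<otimes>\<^bsub>F\<^esub> (y e x \<otimes>\<^bsub>F\<^esub> p x (tgt e))"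
          using e x by (simp add: y_A[OF e a x] F.m_assoc F.cancel_left)
        moreover have "?r = inv\<^bsub>F\<^esub> p (?c \<star> t e \<star> x) (src e) \<otimes>\<^bsub>F\<^esub> (y e x \<otimes>\<^bsub>F\<^esub> p x (tgt e))"
          using e x c unfolding t_A[OF e a x, symmetric] by (subst F.cancel_middle) auto
        ultimately show ?thesis by (simp only: t_A[OF e a x])
      qed
      have fst_eq: "\<phi> (t e) \<otimes>\<^bsub>P\<^esub> \<phi> a = \<phi> ?c \<otimes>\<^bsub>P\<^esub> \<phi> (t e)"
        using t_A[OF e a P.one_closed] by (simp add: P.m_assoc)
      show ?thesis
        unfolding f_def s_def wreath_group_mult
        by (intro arg_cong2[of _ _ _ _ Pair] restrict_ext fst_eq)
          (simp only: restrict_apply' act_in t_closed[OF e] A_closed[OF e a] snd_eq)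
    qed
    show "s e = \<one>\<^bsub>?W\<^esub>" if e: "e \<in> D" for e
    proof -
      have "inv\<^bsub>F\<^esub> p (t e \<star> x) (src e) \<otimes>\<^bsub>F\<^esub> (y e x \<otimes>\<^bsub>F\<^esub> p x (tgt e)) = \<one>\<^bsub>F\<^esub>"
        if x: "x \<in> carrier P" for x
        using p_tree[OF x e, symmetric] x t_tree[OF e] by simp
      then show ?thesis using t_tree[OF e] by (auto simp: s_def intro!: restrict_ext)
    qed
  qed blast
  interpret \<Theta>: group_hom Q ?W \<Theta> by unfold_locales (rule \<Theta>_hom)
  define c where "c = (\<lambda>g. snd (\<Theta> g))"
  have fst_\<Theta>: "fst (\<Theta> g) = \<phi> g" if "g \<in> carrier Q" for g
  proof -
    have "(fst \<circ> \<Theta>) g = \<phi> g"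
      by (rule hom_eqI[OF P Group.hom_compose[OF \<Theta>_hom fst_wreath_group_hom] \<phi>_hom _ _ that])
        (simp_all add: \<Theta>_H \<Theta>_t f_def s_def)
    then show ?thesis by simp
  qed
  have c_closed [simp]: "c g x \<in> carrier F" if "g \<in> carrier Q" "x \<in> carrier P" for g x
    using \<Theta>.hom_closed[OF that(1)] that(2) by (auto simp: c_def wreath_group_carrier)
  have c_mult: "c (g \<otimes> h) x = c g (h \<star> x) \<otimes>\<^bsub>F\<^esub> c h x"
    if "g \<in> carrier Q" "h \<in> carrier Q" "x \<in> carrier P" for g h x
    using that by (simp add: c_def wreath_group_snd_mult fst_\<Theta> del: wreath_group_mult)
  have c_one: "c \<one> x = \<one>\<^bsub>F\<^esub>" if "x \<in> carrier P" for x
    using \<Theta>.hom_one that by (simp add: c_def)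
  have c_H: "c h x = inv\<^bsub>F\<^esub> p (h \<star> x) v \<otimes>\<^bsub>F\<^esub> p x v" if "v \<in> V" "h \<in> H v" "x \<in> carrier P" for v h x
    using that by (simp add: c_def \<Theta>_H f_def)
  have c_t: "c (t e) x = inv\<^bsub>F\<^esub> p (t e \<star> x) (src e) \<otimes>\<^bsub>F\<^esub> (y e x \<otimes>\<^bsub>F\<^esub> p x (tgt e))"
    if "e \<in> E" "x \<in> carrier P" for e x
    using that by (simp add: c_def \<Theta>_t s_def)

  (* The left side is constant along the tree. *)
  have \<beta>_p: "\<R> v x \<otimes> \<beta> (p x v) = \<R> v0 x" if v: "v \<in> V" and x: "x \<in> carrier P" for v x
  proof -
    have "\<R> v x \<otimes> \<beta> (p x v) = \<R> v0 x \<otimes> \<beta> (p x v0)"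
    proof (rule grown_tree_connected[OF tree _ v v0])
      fix e assume eD: "e \<in> D"
      then have e: "e \<in> E" using D_sub by blast
      note [simp] = src_in[OF e] tgt_in[OF e] x
      have "Y e x = inv \<R> (src e) x \<otimes> \<R> (tgt e) x" by (simp add: Y_def t_tree[OF eD])
      then show "\<R> (src e) x \<otimes> \<beta> (p x (src e)) = \<R> (tgt e) x \<otimes> \<beta> (p x (tgt e))"
        using e by (simp add: p_tree[OF x eD] \<beta>_y[OF e x] m_assoc cancel_left)
    qed
    then show ?thesis using x v0 by (simp add: p_base)
  qed
  have \<beta>_p': "\<beta> (p x v) = inv \<R> v x \<otimes> \<R> v0 x" if v: "v \<in> V" and x: "x \<in> carrier P" for v x
    using \<beta>_p[OF v x, symmetric] v x by (simp add: cancel_left')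

  (* Evaluating the cocycle recovers g up to the section; it suffices to check generators. *)
  define good where "good = (\<lambda>g. \<forall>x\<in>carrier P. \<R> v0 (g \<star> x) \<otimes> \<beta> (c g x) = g \<otimes> \<R> v0 x)"
  let ?C = "{g \<in> carrier Q. good g}"
  have "?C = carrier Q"
  proof (rule generated)
    show "subgroup ?C Q"
    proof (rule subgroupI)
      have "good \<one>" using v0 by (simp add: good_def c_one)
      then show "?C \<noteq> {}" by blast
      fix g assume "g \<in> ?C"
      then have g: "g \<in> carrier Q" "good g" by simp_all
      have "\<R> v0 (inv g \<star> x) \<otimes> \<beta> (c (inv g) x) = inv g \<otimes> \<R> v0 x" if x: "x \<in> carrier P" for x
      proof -
        let ?x = "inv g \<star> x"
        have x': "?x \<in> carrier P" "g \<star> ?x = x"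
          using g x by (simp_all add: P.cancel_left)
        have "c g ?x \<otimes>\<^bsub>F\<^esub> c (inv g) x = \<one>\<^bsub>F\<^esub>"
          using c_mult[of g "inv g" x] g x c_one by simp
        then have "\<beta> (c g ?x) \<otimes> \<beta> (c (inv g) x) = \<one>"
          using g x x'(1) \<beta>.hom_mult[of "c g ?x" "c (inv g) x"] by simp
        moreover have "\<R> v0 x \<otimes> \<beta> (c g ?x) = g \<otimes> \<R> v0 ?x"
          using g(2) x' unfolding good_def by metis
        moreover have in_Q: "\<R> v0 x \<in> carrier Q" "\<R> v0 ?x \<in> carrier Q" "\<beta> (c g ?x) \<in> carrier Q"
          "\<beta> (c (inv g) x) \<in> carrier Q"
          using v0 x x'(1) g(1) by (auto intro: \<R>_closed \<beta>.hom_closed c_closed)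
        ultimately have "g \<otimes> (\<R> v0 ?x \<otimes> \<beta> (c (inv g) x)) = \<R> v0 x"
          using g(1) m_assoc[of g "\<R> v0 ?x" "\<beta> (c (inv g) x)"]
            m_assoc[of "\<R> v0 x" "\<beta> (c g ?x)" "\<beta> (c (inv g) x)"] by simp
        then show ?thesis
          using in_Q g(1) cancel_left'[of g "\<R> v0 ?x \<otimes> \<beta> (c (inv g) x)"] by simp
      qed
      then show "inv g \<in> ?C" using g(1) unfolding good_def by simp
      fix h assume "h \<in> ?C"
      then have h: "h \<in> carrier Q" "good h" by simp_all
      have "\<R> v0 ((g \<otimes> h) \<star> x) \<otimes> \<beta> (c (g \<otimes> h) x) = (g \<otimes> h) \<otimes> \<R> v0 x" if x: "x \<in> carrier P" for x
      proof -
        have x': "h \<star> x \<in> carrier P" "g \<star> h \<star> x \<in> carrier P" using g h x by (auto intro: act_in)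
        have in_Q: "\<R> v0 (g \<star> h \<star> x) \<in> carrier Q" "\<R> v0 (h \<star> x) \<in> carrier Q" "\<R> v0 x \<in> carrier Q"
          "\<beta> (c g (h \<star> x)) \<in> carrier Q" "\<beta> (c h x) \<in> carrier Q"
          using v0 x x' g(1) h(1) by (auto intro: \<R>_closed \<beta>.hom_closed c_closed)
        have "\<beta> (c (g \<otimes> h) x) = \<beta> (c g (h \<star> x)) \<otimes> \<beta> (c h x)"
          using c_mult[OF g(1) h(1) x] g(1) h(1) x x' by simp
        moreover have "\<R> v0 (g \<star> h \<star> x) \<otimes> \<beta> (c g (h \<star> x)) = g \<otimes> \<R> v0 (h \<star> x)"
          using g(2) x'(1) unfolding good_def by blast
        moreover have "\<R> v0 (h \<star> x) \<otimes> \<beta> (c h x) = h \<otimes> \<R> v0 x"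
          using h(2) x unfolding good_def by blast
        ultimately show ?thesis
          unfolding act_act[OF g(1) h(1) x] using in_Q g(1) h(1)
          by (metis m_assoc)
      qed
      then show "g \<otimes> h \<in> ?C" using g(1) h(1) unfolding good_def by simp
    qed blast
    show "H v \<subseteq> ?C" if v: "v \<in> V" for v
    proof
      fix h assume h: "h \<in> H v"
      note [simp] = H_closed[OF v h] v v0
      have "\<R> v0 (h \<star> x) \<otimes> \<beta> (c h x) = h \<otimes> \<R> v0 x" if x: "x \<in> carrier P" for x
      proof -
        have x': "h \<star> x \<in> carrier P" using x by (auto intro: act_in)
        have in_Q: "\<R> v0 (h \<star> x) \<in> carrier Q" "\<R> v x \<in> carrier Q" "\<R> v0 x \<in> carrier Q"
          "\<beta> (p x v) \<in> carrier Q" "\<beta> (p (h \<star> x) v) \<in> carrier Q"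
          using x x' by (auto intro: \<R>_closed \<beta>.hom_closed)
        have "\<beta> (c h x) = inv \<beta> (p (h \<star> x) v) \<otimes> \<beta> (p x v)"
          using x x' by (simp add: c_H[OF v h x] del: \<phi>.hom_mult)
        moreover have "\<R> v0 (h \<star> x) = (h \<otimes> \<R> v x) \<otimes> \<beta> (p (h \<star> x) v)"
          using \<beta>_p[OF v x'] \<R>_H[OF v h x] by simp
        moreover have "\<R> v0 x = \<R> v x \<otimes> \<beta> (p x v)" using \<beta>_p[OF v x] by simp
        ultimately show ?thesis
          using in_Q by (simp add: cancel_middle m_assoc[of h "\<R> v x" "\<beta> (p x v)"])
      qed
      then show "h \<in> ?C" unfolding good_def by simp
    qed
    show "t e \<in> ?C" if e: "e \<in> E" for e
    proof -
      note [simp] = t_closed[OF e] src_in[OF e] tgt_in[OF e] v0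
      have "\<R> v0 (t e \<star> x) \<otimes> \<beta> (c (t e) x) = t e \<otimes> \<R> v0 x" if x: "x \<in> carrier P" for x
      proof -
        let ?x = "t e \<star> x"
        have x': "?x \<in> carrier P" using x by (auto intro: act_in)
        have in_Q: "\<R> (src e) ?x \<in> carrier Q" "\<R> (tgt e) x \<in> carrier Q"
          "\<beta> (p ?x (src e)) \<in> carrier Q" "\<beta> (p x (tgt e)) \<in> carrier Q"
          using x x' by (auto intro: \<R>_closed \<beta>.hom_closed)
        have "\<beta> (c (t e) x) = inv \<beta> (p ?x (src e)) \<otimes> (Y e x \<otimes> \<beta> (p x (tgt e)))"
          using x x' e by (simp add: c_t[OF e x] \<beta>_y[OF e x])
        moreover have "\<R> v0 ?x = \<R> (src e) ?x \<otimes> \<beta> (p ?x (src e))"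
          using \<beta>_p[OF src_in[OF e] x'] by simp
        ultimately have "\<R> v0 ?x \<otimes> \<beta> (c (t e) x) = \<R> (src e) ?x \<otimes> (Y e x \<otimes> \<beta> (p x (tgt e)))"
          using in_Q Y_closed[OF e x] by (simp add: cancel_middle)
        also have "\<dots> = (\<R> (src e) ?x \<otimes> Y e x) \<otimes> \<beta> (p x (tgt e))"
          using in_Q Y_closed[OF e x] by (simp add: m_assoc)
        also have "\<R> (src e) ?x \<otimes> Y e x = t e \<otimes> \<R> (tgt e) x"
          using in_Q unfolding Y_def by (simp add: cancel_left)
        also have "(t e \<otimes> \<R> (tgt e) x) \<otimes> \<beta> (p x (tgt e)) = t e \<otimes> \<R> v0 x"
          using in_Q \<beta>_p[OF tgt_in[OF e] x] by (simp add: m_assoc)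
        finally show ?thesis .
      qed
      then show ?thesis unfolding good_def by simp
    qed
  qed
  then have \<beta>_c: "\<R> v0 (g \<star> x) \<otimes> \<beta> (c g x) = g \<otimes> \<R> v0 x"
    if "g \<in> carrier Q" "x \<in> carrier P" for g x
    using that unfolding good_def by blast

  let ?K = "Q\<lparr>carrier := kernel Q P \<phi>\<rparr>"
  define \<alpha> where "\<alpha> = (\<lambda>k. c k \<epsilon>)"
  have ker: "k \<in> kernel Q P \<phi> \<longleftrightarrow> k \<in> carrier Q \<and> \<phi> k = \<epsilon>" for k
    by (simp add: kernel_def)
  have \<beta>_\<alpha>: "\<beta> (\<alpha> k) = k" if "k \<in> carrier ?K" for k
    using \<beta>_c[of k "\<epsilon>"] that v0 by (simp add: ker \<alpha>_def \<R>_base)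
  have \<alpha>_hom: "\<alpha> \<in> hom ?K F"
    by (rule homI) (simp_all add: ker \<alpha>_def c_mult)
  have \<alpha>_inj: "inj_on \<alpha> (carrier ?K)"
    using \<beta>_\<alpha> by (rule inj_on_inverseI)

  (* Triviality of the left side passes along orbits and compatible edges, which connect everything. *)
  have q: "p x v \<otimes>\<^bsub>F\<^esub> c (\<R> v x) \<epsilon> = \<one>\<^bsub>F\<^esub>" if "v \<in> V" "x \<in> carrier P" for v x
  proof (rule section_connected[OF sec, of "\<lambda>v x. p x v \<otimes>\<^bsub>F\<^esub> c (\<R> v x) \<epsilon> = \<one>\<^bsub>F\<^esub>"])
    show "p \<epsilon> v0 \<otimes>\<^bsub>F\<^esub> c (\<R> v0 \<epsilon>) \<epsilon> = \<one>\<^bsub>F\<^esub>"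
      by (simp add: p_base \<R>_base c_one)
    show "(v, x) \<in> V \<times> carrier P" using that by simp
  next
    fix v x h assume h: "h \<in> H v" and "(v, x) \<in> V \<times> carrier P"
      and q: "p x v \<otimes>\<^bsub>F\<^esub> c (\<R> v x) \<epsilon> = \<one>\<^bsub>F\<^esub>"
    then have v: "v \<in> V" and x: "x \<in> carrier P" by simp_all
    note [simp] = H_closed[OF v h] v x
    have x': "h \<star> x \<in> carrier P" by (auto intro: act_in)
    have "c (\<R> v (h \<star> x)) \<epsilon> = c h x \<otimes>\<^bsub>F\<^esub> c (\<R> v x) \<epsilon>"
      using c_mult[of h "\<R> v x" "\<epsilon>"] by (simp add: \<R>_H[OF v h x])
    then show "p (h \<star> x) v \<otimes>\<^bsub>F\<^esub> c (\<R> v (h \<star> x)) \<epsilon> = \<one>\<^bsub>F\<^esub>"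
      using q x' by (simp add: c_H[OF v h x] F.m_assoc F.cancel_left)
  next
    fix e x assume e: "e \<in> E" and "(tgt e, x) \<in> V \<times> carrier P"
      and link: "\<R> (src e) (t e \<star> x) = t e \<otimes> \<R> (tgt e) x"
    then have x: "x \<in> carrier P" by simp
    note [simp] = t_closed[OF e] src_in[OF e] tgt_in[OF e] x
    have x': "t e \<star> x \<in> carrier P" by (auto intro: act_in)
    have "Y e x = \<one>" unfolding Y_def link by simp
    then have "y e x = \<one>\<^bsub>F\<^esub>" by (simp add: y_def)
    then have "p (t e \<star> x) (src e) \<otimes>\<^bsub>F\<^esub> c (\<R> (src e) (t e \<star> x)) \<epsilon> =
        p x (tgt e) \<otimes>\<^bsub>F\<^esub> c (\<R> (tgt e) x) \<epsilon>"
      using c_mult[of "t e" "\<R> (tgt e) x" "\<epsilon>"] x'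
      by (simp add: link c_t[OF e x] F.m_assoc F.cancel_left)
    then show "(p x (tgt e) \<otimes>\<^bsub>F\<^esub> c (\<R> (tgt e) x) \<epsilon> = \<one>\<^bsub>F\<^esub>) \<longleftrightarrow>
        (p (t e \<star> x) (src e) \<otimes>\<^bsub>F\<^esub> c (\<R> (src e) (t e \<star> x)) \<epsilon> = \<one>\<^bsub>F\<^esub>)"
      by simp
  qed
  (* So the cocycle sends the basis elements of the kernel to the corresponding letters. *)
  have \<alpha>_Y: "\<alpha> (Y e x) = y e x" if e: "e \<in> E" and x: "x \<in> carrier P" for e x
  proof -
    note [simp] = t_closed[OF e] src_in[OF e] tgt_in[OF e] x Y_closed[OF e x]
    let ?x = "t e \<star> x" and ?r = "\<R> (src e) (t e \<star> x)" and ?r' = "\<R> (tgt e) x"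
    have x': "?x \<in> carrier P" by (auto intro: act_in)
    then have r: "?r \<in> carrier Q" "?r' \<in> carrier Q" by (auto intro: \<R>_closed)
    have "?r \<otimes> Y e x = t e \<otimes> ?r'" using r unfolding Y_def by (simp add: cancel_left)
    then have "c (?r \<otimes> Y e x) \<epsilon> = c (t e \<otimes> ?r') \<epsilon>" by simp
    then have "c ?r \<epsilon> \<otimes>\<^bsub>F\<^esub> \<alpha> (Y e x) = c (t e) x \<otimes>\<^bsub>F\<^esub> c ?r' \<epsilon>"
      using c_mult[OF r(1), of "Y e x" "\<epsilon>"] c_mult[of "t e" ?r' "\<epsilon>"] r
        Y_ker[OF e x] by (simp add: \<alpha>_def)
    then have "p ?x (src e) \<otimes>\<^bsub>F\<^esub> (c ?r \<epsilon> \<otimes>\<^bsub>F\<^esub> \<alpha> (Y e x)) =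
        p ?x (src e) \<otimes>\<^bsub>F\<^esub> (c (t e) x \<otimes>\<^bsub>F\<^esub> c ?r' \<epsilon>)"
      by simp
    moreover have "p ?x (src e) \<otimes>\<^bsub>F\<^esub> (c ?r \<epsilon> \<otimes>\<^bsub>F\<^esub> \<alpha> (Y e x)) = \<alpha> (Y e x)"
      using q[OF src_in[OF e] x'] r x' F.m_assoc[of "p ?x (src e)" "c ?r \<epsilon>" "\<alpha> (Y e x)"]
      by (simp add: \<alpha>_def)
    moreover have "p ?x (src e) \<otimes>\<^bsub>F\<^esub> (c (t e) x \<otimes>\<^bsub>F\<^esub> c ?r' \<epsilon>) = y e x"
      using q[OF tgt_in[OF e] x] r x' e by (simp add: c_t[OF e x] F.m_assoc F.cancel_left)
    ultimately show ?thesis by simp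
  qed
  have "\<alpha> ` carrier ?K = carrier F"
  proof -
    have K_group: "group ?K"
      using \<phi>.subgroup_kernel is_group by (rule subgroup.subgroup_is_group)
    interpret \<alpha>: group_hom ?K F \<alpha>
      using K_group F_group \<alpha>_hom by (simp add: group_hom_def group_hom_axioms_def)
    have "word_class X {} [(k, True)] \<in> \<alpha> ` carrier ?K" if k: "k \<in> X" for k
    proof -
      obtain e x where e: "e \<in> E" "x \<in> carrier P" "k = Y e x" "k \<noteq> \<one>"
        using k unfolding X_def by blast
      then have "\<alpha> k = word_class X {} [(k, True)]" using \<alpha>_Y[OF e(1,2)] by (simp add: y_def \<iota>_def)
      moreover have "k \<in> carrier ?K" using X_car[OF k] X_ker[OF k] by (simp add: ker)
      ultimately show ?thesis by (metis image_eqI)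
    qed
    then show ?thesis
      using presented_group_generated[of "\<alpha> ` carrier ?K" X "{}"] \<alpha>.img_is_subgroup
      unfolding F_def free_group_def by simp
  qed
  then have "\<alpha> \<in> iso ?K F" using \<alpha>_hom \<alpha>_inj by (simp add: iso_def bij_betw_def)
  then have "?K \<cong> free_group X" unfolding is_iso_def F_def by blast
  then show ?thesis unfolding is_free_def by blast
qed

end

section \<open>Virtual freeness\<close>

context graph_of_subgroups
begin

text \<open>The kernel of a homomorphism to a finite group that embeds the vertex groups is free of finite
  index.  The target is cut down to the image, since \<open>kernel_is_free\<close> needs transitivity on \<open>P\<close>.\<close>

lemma virtually_free_of_finite_vertex_groups:
  assumes fin: "\<And>v. v \<in> V \<Longrightarrow> finite (H v)"
    and univ_sym: "\<And>n. universal_for (sym_group n)"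
    and univ_wreath: "\<And>(P :: (nat \<Rightarrow> nat) monoid) (X :: 'q set).
      group P \<Longrightarrow> universal_for (wreath_group P (free_group X))"
  shows "virtually_free Q"
proof -
  obtain n \<phi> where \<phi>: "\<phi> \<in> hom Q (sym_group n)" "\<And>v. v \<in> V \<Longrightarrow> inj_on \<phi> (H v)"
    using finite_quotient_embedding[OF fin univ_sym] by blast
  interpret \<phi>': group_hom Q "sym_group n" \<phi>
    using \<phi>(1) sym_group_is_group by (simp add: group_hom_def group_hom_axioms_def)
  define P where "P = (sym_group n)\<lparr>carrier := \<phi> ` carrier Q\<rparr>"
  have P: "group P"
    unfolding P_def using \<phi>'.img_is_subgroup sym_group_is_group by (rule subgroup.subgroup_is_group)
  have finite_P: "finite (carrier P)"
  proof -
    have "carrier P \<subseteq> carrier (sym_group n)" using \<phi>'.hom_closed unfolding P_def by auto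
    moreover have "finite (carrier (sym_group n))"
      by (simp add: sym_group_def finite_permutations)
    ultimately show ?thesis by (rule finite_subset)
  qed
  have \<phi>_P: "\<phi> \<in> hom Q P" using \<phi>(1) by (auto simp: P_def hom_def)
  interpret embedded_quotient Q V E D src tgt H A t P \<phi>
  proof (rule embedded_quotient.intro[OF graph_of_subgroups_axioms],
      rule embedded_quotient_axioms.intro[OF P finite_P \<phi>_P])
    show "\<phi> ` carrier Q = carrier P" by (simp add: P_def)
    show "inj_on \<phi> (H v)" if "v \<in> V" for v using that by (rule \<phi>(2))
  qed
  interpret \<phi>: group_hom Q P \<phi>
    using P \<phi>_P by (simp add: group_hom_def group_hom_axioms_def)
  have "is_free (Q\<lparr>carrier := kernel Q P \<phi>\<rparr>)"
    using kernel_is_free[OF univ_wreath[OF P]] .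
  moreover have "finite (rcosets kernel Q P \<phi>)"
  proof (rule finite_imageD)
    show "inj_on (\<lambda>X. the_elem (\<phi> ` X)) (rcosets kernel Q P \<phi>)"
      using \<phi>.FactGroup_inj_on by (simp add: FactGroup_def)
    have "(\<lambda>X. the_elem (\<phi> ` X)) ` (rcosets kernel Q P \<phi>) \<subseteq> carrier P"
      using \<phi>.FactGroup_the_elem_mem by (auto simp: FactGroup_def)
    then show "finite ((\<lambda>X. the_elem (\<phi> ` X)) ` (rcosets kernel Q P \<phi>))"
      using finite_P finite_subset by blast
  qed
  ultimately show ?thesis
    unfolding virtually_free_def finite_index_subgroup_def using \<phi>.subgroup_kernel by blast
qed

lemma finitely_generated_of_finite_vertex_groups:
  assumes fin: "\<And>v. v \<in> V \<Longrightarrow> finite (H v)"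
  shows "finitely_generated Q"
proof -
  let ?S = "(\<Union>v\<in>V. H v) \<union> t ` E"
  have S: "?S \<subseteq> carrier Q" using H_closed t_closed by blast
  have "generate Q ?S = carrier Q"
    by (rule generated[OF generate_is_subgroup[OF S]]) (blast intro: generate.incl)+
  moreover have "finite ?S" using finite_V finite_E fin by simp
  ultimately show ?thesis unfolding finitely_generated_def using S by blast
qed

end

lemma (in group) finite_index_restrict_iff:
  assumes "subgroup N G" "subgroup K G"
  shows "finite_index_subgroup N (G\<lparr>carrier := K\<rparr>) \<longleftrightarrow>
    N \<subseteq> K \<and> finite ((\<lambda>x. N #> x) ` K)"
proof -
  have "rcosets\<^bsub>G\<lparr>carrier := K\<rparr>\<^esub> N = (\<lambda>x. N #> x) ` K"
    by (auto simp: RCOSETS_def r_coset_def)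
  then show ?thesis
    using subgroup_incl[OF assms] subgroup.subset[of N "G\<lparr>carrier := K\<rparr>"]
    by (auto simp: finite_index_subgroup_def)
qed

lemma (in split_group) quotient_virtually_free:
  assumes N: "N \<lhd> G"
    and fin: "\<And>v. v \<in> verts \<Gamma> \<Longrightarrow> finite_index_subgroup N (G\<lparr>carrier := \<H> v\<rparr>)"
  shows "finitely_generated (G Mod N)" and "virtually_free (G Mod N)"
proof -
  let ?p = "\<lambda>x. N #> x"
  interpret Q: graph_of_subgroups "G Mod N" "verts \<Gamma>" "arcs \<Gamma>" "arcs T" "tail \<Gamma>" "head \<Gamma>"
    "\<lambda>v. ?p ` \<H> v" "\<lambda>e. ?p ` edge_subgroup e"
    "\<lambda>e. ?p (stable_letter e)"
    by (rule quotient_graph_of_subgroups[OF N])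
  have index: "N \<subseteq> \<H> v \<and> finite (?p ` \<H> v)" if "v \<in> verts \<Gamma>" for v
    using fin[OF that] finite_index_restrict_iff[OF normal_imp_subgroup[OF N] H_subgroup[OF that]]
    by simp
  then have finite_H: "finite (?p ` \<H> v)" if "v \<in> verts \<Gamma>" for v using that by simp
  obtain v0 where v0: "v0 \<in> verts \<Gamma>" using V_nonempty by blast
  from index[OF this] have "N \<subseteq> \<H> v0" by simp
  then have univ: "Q.universal_for L" if "group L" for L
    by (rule quotient_universal_for[OF N v0 _ that universal[OF that]])
  show "finitely_generated (G Mod N)"
    by (rule Q.finitely_generated_of_finite_vertex_groups[OF finite_H])
  show "virtually_free (G Mod N)"
  proof (rule Q.virtually_free_of_finite_vertex_groups[OF finite_H])
    show "Q.universal_for (sym_group n)" for n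
      by (rule univ[OF sym_group_is_group])
    show "Q.universal_for (wreath_group P (free_group X))"
      if "group P" for P :: "(nat \<Rightarrow> nat) monoid" and X :: "'a set set"
      by (intro univ group_wreath_group that) (simp add: free_group_def group_presented_group)
  qed
qed

section \<open>Commensurable subgroups\<close>

lemma conjugate_eq: "conjugate G g K = (\<lambda>k. g \<otimes>\<^bsub>G\<^esub> k \<otimes>\<^bsub>G\<^esub> inv\<^bsub>G\<^esub> g) ` K"
  by (auto simp: conjugate_def l_coset_def r_coset_def)

context group
begin

lemma conjugate_one: "K \<subseteq> carrier G \<Longrightarrow> conjugate G \<one> K = K"
  by (force simp: conjugate_eq)

lemma conjugate_mult:
  assumes "g \<in> carrier G" "h \<in> carrier G" "K \<subseteq> carrier G"
  shows "conjugate G (g \<otimes> h) K = conjugate G g (conjugate G h K)"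
  unfolding conjugate_eq image_image
  by (rule image_cong[OF HOL.refl]) (use assms in \<open>auto simp: inv_mult_group m_assoc subset_eq\<close>)

lemma conjugate_sub: "g \<in> carrier G \<Longrightarrow> K \<subseteq> carrier G \<Longrightarrow> conjugate G g K \<subseteq> carrier G"
  by (auto simp: conjugate_eq)

lemma conjugate_subgroup:
  assumes g: "g \<in> carrier G" and K: "subgroup K G"
  shows "subgroup (conjugate G g K) G"
proof -
  have "(\<lambda>k. g \<otimes> k \<otimes> inv g) \<in> hom G G"
    using g by (intro homI) (simp_all add: m_assoc cancel_left')
  then interpret c: group_hom G G "\<lambda>k. g \<otimes> k \<otimes> inv g" by unfold_locales
  show ?thesis unfolding conjugate_eq using K by (rule c.subgroup_img_is_subgroup)
qed

text \<open>For subgroups this says that \<open>K \<inter> L\<close> has finite index in \<open>K\<close>.  In terms of coverings, transitivity and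
  compatibility with conjugation need no counting.\<close>

definition almost_sub :: "'a set \<Rightarrow> 'a set \<Rightarrow> bool" where
  "almost_sub K L \<longleftrightarrow> (\<exists>F. finite F \<and> F \<subseteq> carrier G \<and> K \<subseteq> (\<Union>f\<in>F. L #> f))"

lemma almost_sub_of_sub: "K \<subseteq> L \<Longrightarrow> L \<subseteq> carrier G \<Longrightarrow> almost_sub K L"
  unfolding almost_sub_def by (intro exI[of _ "{\<one>}"]) simp

lemma almost_sub_trans:
  assumes KL: "almost_sub K L" and LM: "almost_sub L M" and M: "M \<subseteq> carrier G"
  shows "almost_sub K M"
proof -
  obtain F where F: "finite F" "F \<subseteq> carrier G" "K \<subseteq> (\<Union>f\<in>F. L #> f)"
    using KL unfolding almost_sub_def by blast
  obtain F' where F': "finite F'" "F' \<subseteq> carrier G" "L \<subseteq> (\<Union>f\<in>F'. M #> f)"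
    using LM unfolding almost_sub_def by blast
  have "K \<subseteq> (\<Union>f\<in>(\<lambda>(f', f). f' \<otimes> f) ` (F' \<times> F). M #> f)"
  proof
    fix k assume "k \<in> K"
    then obtain f l where f: "f \<in> F" and l: "l \<in> L" and k: "k = l \<otimes> f"
      using F(3) by (auto simp: r_coset_def)
    obtain f' m where f': "f' \<in> F'" and m: "m \<in> M" and l_eq: "l = m \<otimes> f'"
      using F'(3) l by (auto simp: r_coset_def)
    have "k = m \<otimes> (f' \<otimes> f)"
      using k l_eq f f' m F(2) F'(2) M by (simp add: m_assoc subset_eq)
    then have "k \<in> M #> (f' \<otimes> f)" using m by (auto simp: r_coset_def)
    then show "k \<in> (\<Union>f\<in>(\<lambda>(f', f). f' \<otimes> f) ` (F' \<times> F). M #> f)" using f f' by blast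
  qed
  moreover have "(\<lambda>(f', f). f' \<otimes> f) ` (F' \<times> F) \<subseteq> carrier G" using F(2) F'(2) by auto
  ultimately show ?thesis
    unfolding almost_sub_def using F(1) F'(1) by (metis finite_SigmaI finite_imageI)
qed

lemma almost_sub_conjugate:
  assumes g: "g \<in> carrier G" and L: "L \<subseteq> carrier G" and KL: "almost_sub K L"
  shows "almost_sub (conjugate G g K) (conjugate G g L)"
proof -
  obtain F where F: "finite F" "F \<subseteq> carrier G" "K \<subseteq> (\<Union>f\<in>F. L #> f)"
    using KL unfolding almost_sub_def by blast
  have "conjugate G g K \<subseteq> (\<Union>f\<in>(\<lambda>f. g \<otimes> f \<otimes> inv g) ` F. conjugate G g L #> f)"
  proof
    fix x assume "x \<in> conjugate G g K"
    then obtain k where k: "k \<in> K" "x = g \<otimes> k \<otimes> inv g" by (auto simp: conjugate_eq)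
    then obtain f l where f: "f \<in> F" and l: "l \<in> L" and kl: "k = l \<otimes> f"
      using F(3) by (auto simp: r_coset_def)
    have "x = (g \<otimes> l \<otimes> inv g) \<otimes> (g \<otimes> f \<otimes> inv g)"
      using k(2) kl f l F(2) L g by (simp add: m_assoc subset_eq cancel_left')
    then show "x \<in> (\<Union>f\<in>(\<lambda>f. g \<otimes> f \<otimes> inv g) ` F. conjugate G g L #> f)"
      using f l by (auto simp: r_coset_def conjugate_eq)
  qed
  moreover have "(\<lambda>f. g \<otimes> f \<otimes> inv g) ` F \<subseteq> carrier G" using F(2) g by auto
  ultimately show ?thesis unfolding almost_sub_def using F(1) by (metis finite_imageI)
qed

text \<open>A nonempty intersection of a right coset of \<open>L\<close> with one of \<open>M\<close> is a right coset of \<open>L \<inter> M\<close>.\<close>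

lemma almost_sub_Int:
  assumes L: "subgroup L G" and M: "subgroup M G" and K: "K \<subseteq> carrier G"
    and KL: "almost_sub K L" and KM: "almost_sub K M"
  shows "almost_sub K (L \<inter> M)"
proof -
  obtain F where F: "finite F" "F \<subseteq> carrier G" "K \<subseteq> (\<Union>f\<in>F. L #> f)"
    using KL unfolding almost_sub_def by blast
  obtain F' where F': "finite F'" "F' \<subseteq> carrier G" "K \<subseteq> (\<Union>f\<in>F'. M #> f)"
    using KM unfolding almost_sub_def by blast
  define r where "r = (\<lambda>(f, f'). SOME x. x \<in> K \<and> x \<in> L #> f \<and> x \<in> M #> f')"
  have same: "x \<otimes> inv y \<in> U"
    if U: "subgroup U G" and f: "f \<in> carrier G" and xy: "x \<in> U #> f" "y \<in> U #> f" for U f x y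
  proof -
    obtain u w where u: "u \<in> U" "x = u \<otimes> f" and w: "w \<in> U" "y = w \<otimes> f"
      using xy by (auto simp: r_coset_def)
    then have "u \<in> carrier G" "w \<in> carrier G" using subgroup.mem_carrier[OF U] by auto
    then have "x \<otimes> inv y = u \<otimes> inv w"
      using f u(2) w(2) by (simp add: inv_mult_group m_assoc cancel_left)
    then show ?thesis
      using u(1) w(1) subgroup.m_closed[OF U] subgroup.m_inv_closed[OF U] by simp
  qed
  let ?F = "r ` (F \<times> F') \<inter> carrier G"
  have "K \<subseteq> (\<Union>f\<in>?F. (L \<inter> M) #> f)"
  proof
    fix k assume k: "k \<in> K"
    then obtain f f' where f: "f \<in> F" "f' \<in> F'" "k \<in> L #> f" "k \<in> M #> f'"
      using F(3) F'(3) by blast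
    have r: "r (f, f') \<in> K \<and> r (f, f') \<in> L #> f \<and> r (f, f') \<in> M #> f'"
      unfolding r_def prod.case by (rule someI[of _ k]) (use k f in blast)
    let ?x = "r (f, f')"
    have x: "?x \<in> carrier G" "k \<in> carrier G" using r k K by auto
    have fG: "f \<in> carrier G" "f' \<in> carrier G" using f F(2) F'(2) by auto
    have "k \<otimes> inv ?x \<in> L \<inter> M"
      using same[OF L fG(1) f(3)] same[OF M fG(2) f(4)] r by blast
    moreover have "k = (k \<otimes> inv ?x) \<otimes> ?x" using x by (simp add: m_assoc)
    ultimately have "k \<in> (L \<inter> M) #> ?x" unfolding r_coset_def by blast
    then show "k \<in> (\<Union>f\<in>?F. (L \<inter> M) #> f)" using f(1,2) x by blast
  qed
  then show ?thesis unfolding almost_sub_def using F(1) F'(1) by (intro exI[of _ ?F]) auto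
qed

lemma finite_cosets_of_almost_sub:
  assumes N: "subgroup N G" and HN: "almost_sub K N"
  shows "finite ((\<lambda>x. N #> x) ` K)"
proof -
  obtain F where F: "finite F" "F \<subseteq> carrier G" "K \<subseteq> (\<Union>f\<in>F. N #> f)"
    using HN unfolding almost_sub_def by blast
  have "(\<lambda>x. N #> x) ` K \<subseteq> (\<lambda>x. N #> x) ` F"
  proof
    fix C assume "C \<in> (\<lambda>x. N #> x) ` K"
    then obtain k f where "k \<in> K" "C = N #> k" "f \<in> F" "k \<in> N #> f" using F(3) by blast
    then have "C = N #> f" using repr_independence[of k N f] N F(2) by blast
    then show "C \<in> (\<lambda>x. N #> x) ` F" using \<open>f \<in> F\<close> by blast
  qed
  then show ?thesis using F(1) finite_surj by blast
qed

end

lemma (in group_hom) almost_sub_image: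
  assumes S: "subgroup S G" and fin: "finite (rcosets\<^bsub>G\<^esub> S)"
  shows "H.almost_sub (h ` carrier G) (h ` S)"
proof -
  define rep where "rep = (\<lambda>C :: 'a set. SOME x. x \<in> C)"
  have rep: "rep (S #>\<^bsub>G\<^esub> k) \<in> S #>\<^bsub>G\<^esub> k" if "k \<in> carrier G" for k
    unfolding rep_def by (rule someI[of _ k]) (rule G.rcos_self[OF that S])
  let ?F = "h ` rep ` (rcosets\<^bsub>G\<^esub> S)"
  have rep_closed: "rep C \<in> carrier G" if C: "C \<in> rcosets\<^bsub>G\<^esub> S" for C
  proof -
    obtain k where k: "k \<in> carrier G" "C = S #>\<^bsub>G\<^esub> k" using C by (auto simp: RCOSETS_def)
    then show ?thesis
      using rep[OF k(1)] G.r_coset_subset_G[OF subgroup.subset[OF S] k(1)] by blast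
  qed
  have "h ` carrier G \<subseteq> (\<Union>f\<in>?F. (h ` S) #>\<^bsub>H\<^esub> f)"
  proof
    fix y assume "y \<in> h ` carrier G"
    then obtain k where k: "k \<in> carrier G" "y = h k" by blast
    have C: "S #>\<^bsub>G\<^esub> k \<in> rcosets\<^bsub>G\<^esub> S" using k(1) by (auto simp: RCOSETS_def)
    let ?x = "rep (S #>\<^bsub>G\<^esub> k)"
    have "k \<in> S #>\<^bsub>G\<^esub> ?x"
      using G.repr_independence[OF rep[OF k(1)] k(1) S] G.rcos_self[OF k(1) S] by simp
    then obtain s where s: "s \<in> S" "k = s \<otimes>\<^bsub>G\<^esub> ?x" by (auto simp: r_coset_def)
    then have "y = h s \<otimes>\<^bsub>H\<^esub> h ?x"
      using k(2) hom_mult[OF subgroup.mem_carrier[OF S s(1)] rep_closed[OF C]] by simp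
    then have "y \<in> (h ` S) #>\<^bsub>H\<^esub> h ?x" using s(1) unfolding r_coset_def by blast
    then show "y \<in> (\<Union>f\<in>?F. (h ` S) #>\<^bsub>H\<^esub> f)" using C by blast
  qed
  moreover have "?F \<subseteq> carrier H" using rep_closed by auto
  ultimately show ?thesis
    unfolding H.almost_sub_def using fin by (intro exI[of _ ?F]) simp
qed

context group
begin

definition commensurable :: "'a set \<Rightarrow> 'a set \<Rightarrow> bool" where
  "commensurable K L \<longleftrightarrow> almost_sub K L \<and> almost_sub L K"

lemma commensurable_refl: "K \<subseteq> carrier G \<Longrightarrow> commensurable K K"
  by (simp add: commensurable_def almost_sub_of_sub)

lemma commensurable_sym: "commensurable K L \<Longrightarrow> commensurable L K"
  by (simp add: commensurable_def)

lemma commensurable_trans: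
  "commensurable K L \<Longrightarrow> commensurable L M \<Longrightarrow> K \<subseteq> carrier G \<Longrightarrow> M \<subseteq> carrier G \<Longrightarrow>
    commensurable K M"
  unfolding commensurable_def using almost_sub_trans by blast

lemma commensurable_conjugate:
  "g \<in> carrier G \<Longrightarrow> commensurable K L \<Longrightarrow> K \<subseteq> carrier G \<Longrightarrow> L \<subseteq> carrier G \<Longrightarrow>
    commensurable (conjugate G g K) (conjugate G g L)"
  unfolding commensurable_def using almost_sub_conjugate by blast

text \<open>The commensurator is a subgroup; so it is the whole group as soon as it contains generators.\<close>

lemma subgroup_commensurator:
  assumes K: "K \<subseteq> carrier G"
  shows "subgroup {g \<in> carrier G. commensurable (conjugate G g K) K} G" (is "subgroup ?C G")
proof (rule subgroupI)
  have "\<one> \<in> ?C" using K by (simp add: conjugate_one commensurable_refl)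
  then show "?C \<noteq> {}" by blast
  fix g assume "g \<in> ?C"
  then have g: "g \<in> carrier G" "commensurable (conjugate G g K) K" by simp_all
  have "commensurable (conjugate G (inv g) (conjugate G g K)) (conjugate G (inv g) K)"
    using g K by (intro commensurable_conjugate conjugate_sub) simp_all
  then have "commensurable K (conjugate G (inv g) K)"
    using conjugate_mult[of "inv g" g K] conjugate_one[OF K] g(1) K by simp
  then show "inv g \<in> ?C" using g(1) commensurable_sym by simp
  fix h assume "h \<in> ?C"
  then have h: "h \<in> carrier G" "commensurable (conjugate G h K) K" by simp_all
  have "commensurable (conjugate G g (conjugate G h K)) (conjugate G g K)"
    using g(1) h K by (intro commensurable_conjugate conjugate_sub)
  then have "commensurable (conjugate G (g \<otimes> h) K) (conjugate G g K)"
    using conjugate_mult[OF g(1) h(1) K] by simp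
  then have "commensurable (conjugate G (g \<otimes> h) K) K"
    using g h K by (intro commensurable_trans[OF _ g(2)] conjugate_sub) simp_all
  then show "g \<otimes> h \<in> ?C" using g(1) h(1) by simp
qed blast

end

text \<open>Stable letters on the tree are trivial, so all vertex subgroups are commensurable to each other.
  Hence each of them, and each stable letter, lies in the commensurator of \<open>H v\<close>.\<close>

lemma (in graph_of_subgroups) commensurable_conjugates:
  assumes edge: "\<And>e. e \<in> E \<Longrightarrow> commensurable (conjugate Q (t e) (H (tgt e))) (H (src e))"
    and u: "u \<in> V" and v: "v \<in> V" and g: "g \<in> carrier Q"
  shows "commensurable (conjugate Q g (H u)) (H v)"
proof -
  have sub: "H w \<subseteq> carrier Q" if "w \<in> V" for w using H_closed[OF that] by blast
  have "commensurable (H v) (H w) = commensurable (H v) (H w')" if "w \<in> V" "w' \<in> V" for w w'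
  proof (rule grown_tree_connected[OF tree _ that])
    fix e assume eD: "e \<in> D"
    then have e: "e \<in> E" using D_sub by blast
    have "commensurable (H (tgt e)) (H (src e))"
      using edge[OF e] t_tree[OF eD] conjugate_one[OF sub[OF tgt_in[OF e]]] by simp
    then show "commensurable (H v) (H (src e)) = commensurable (H v) (H (tgt e))"
      using commensurable_trans[OF _ _ sub[OF v]] commensurable_sym sub[OF src_in[OF e]]
        sub[OF tgt_in[OF e]] by blast
  qed
  then have all: "commensurable (H v) (H w)" if "w \<in> V" for w
    using commensurable_refl[OF sub[OF v]] that v by blast
  let ?C = "{g \<in> carrier Q. commensurable (conjugate Q g (H v)) (H v)}"
  have "?C = carrier Q"
  proof (rule generated[OF subgroup_commensurator[OF sub[OF v]]])
    show "H w \<subseteq> ?C" if w: "w \<in> V" for w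
    proof
      fix h assume h: "h \<in> H w"
      have "commensurable (conjugate Q h (H v)) (conjugate Q h (H w))"
        using all[OF w] sub v w H_closed[OF w h] by (intro commensurable_conjugate) simp_all
      moreover have "conjugate Q h (H w) = H w"
      proof -
        have sub1: "conjugate Q k (H w) \<subseteq> H w" if "k \<in> H w" for k
          using that subgroup.m_closed[OF H_subgroup[OF w]] subgroup.m_inv_closed[OF H_subgroup[OF w]]
          by (auto simp: conjugate_eq)
        have "H w = conjugate Q h (conjugate Q (inv h) (H w))"
          using conjugate_mult[of h "inv h" "H w"] conjugate_one[OF sub[OF w]] H_closed[OF w h]
            sub[OF w] by simp
        also have "\<dots> \<subseteq> conjugate Q h (H w)"
          using sub1[OF subgroup.m_inv_closed[OF H_subgroup[OF w] h]] unfolding conjugate_eq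
          by (rule image_mono)
        finally show ?thesis using sub1[OF h] by blast
      qed
      ultimately have "commensurable (conjugate Q h (H v)) (H v)"
        using all[OF w] commensurable_sym H_closed[OF w h] sub[OF v]
        by (metis commensurable_trans conjugate_sub)
      then show "h \<in> ?C"
        using H_closed[OF w h] by simp
    qed
    show "t e \<in> ?C" if e: "e \<in> E" for e
    proof -
      note te = t_closed[OF e] and tg = sub[OF tgt_in[OF e]] and sr = sub[OF src_in[OF e]]
      have "commensurable (conjugate Q (t e) (H v)) (conjugate Q (t e) (H (tgt e)))"
        using all[OF tgt_in[OF e]] sub[OF v] tg te by (intro commensurable_conjugate)
      then have "commensurable (conjugate Q (t e) (H v)) (H (src e))"
        by (rule commensurable_trans[OF _ edge[OF e] conjugate_sub[OF te sub[OF v]] sr])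
      then have "commensurable (conjugate Q (t e) (H v)) (H v)"
        by (rule commensurable_trans[OF _ commensurable_sym[OF all[OF src_in[OF e]]]
              conjugate_sub[OF te sub[OF v]] sub[OF v]])
      then show ?thesis using te by simp
    qed
  qed
  then have "commensurable (conjugate Q g (H v)) (H v)" using g by blast
  moreover have "commensurable (conjugate Q g (H u)) (conjugate Q g (H v))"
    using commensurable_sym[OF all[OF u]] sub u v g by (intro commensurable_conjugate) simp_all
  ultimately show ?thesis
    using commensurable_trans[of "conjugate Q g (H u)" "conjugate Q g (H v)" "H v"]
      conjugate_sub[OF g] sub u v by simp
qed

text \<open>Along an edge both conjugated vertex groups contain the image of the edge group with finite index.\<close>

lemma (in split_group) vertex_subgroups_commensurable:
  assumes fin: "finite_index_edge_groups Y"
    and "u \<in> verts \<Gamma>" "v \<in> verts \<Gamma>" "g \<in> carrier G"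
  shows "commensurable (conjugate G g (\<H> u)) (\<H> v)"
proof (rule commensurable_conjugates[OF _ assms(2-4)])
  fix e assume e: "e \<in> arcs \<Gamma>"
  let ?t = "stable_letter e" and ?A = "edge_subgroup e"
  let ?h = "\<H> (head \<Gamma> e)" and ?k = "\<H> (tail \<Gamma> e)"
  have hom: "group_hom (vertex_group Y v) G (vertex_elt v)" if "v \<in> verts \<Gamma>" for v
    using vertex_group[OF that] vertex_elt_hom[OF that] is_group
    by (simp add: group_hom_def group_hom_axioms_def)
  have "almost_sub ?h ?A"
    unfolding vertex_subgroup_eq edge_subgroup_eq
    by (rule group_hom.almost_sub_image[OF hom[OF head_in[OF e]]])
      (use fin e in \<open>auto simp: finite_index_edge_groups_def finite_index_subgroup_def\<close>)
  then have "almost_sub (conjugate G ?t ?h) (conjugate G ?t ?A)"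
    using t_closed[OF e] A_closed[OF e] by (intro almost_sub_conjugate) auto
  moreover have A_conj: "conjugate G ?t ?A =
      vertex_elt (tail \<Gamma> e) ` (tail_map Y e ` carrier (edge_group Y e))"
    unfolding conjugate_eq edge_subgroup_def image_image
    by (rule image_cong[OF HOL.refl]) (rule stable_letter_conj[OF e])
  moreover have "almost_sub ?k (conjugate G ?t ?A)"
    unfolding vertex_subgroup_eq A_conj
    by (rule group_hom.almost_sub_image[OF hom[OF tail_in[OF e]]])
      (use fin e in \<open>auto simp: finite_index_edge_groups_def finite_index_subgroup_def\<close>)
  moreover have "conjugate G ?t ?A \<subseteq> conjugate G ?t ?h"
    using A_sub[OF e] unfolding conjugate_eq by (rule image_mono)
  moreover have "conjugate G ?t ?A \<subseteq> ?k"
    using t_conj[OF e] unfolding conjugate_eq by blast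
  moreover have h: "conjugate G ?t ?h \<subseteq> carrier G"
    using t_closed[OF e] H_closed[OF head_in[OF e]] by (intro conjugate_sub) auto
  moreover have k: "?k \<subseteq> carrier G" using H_closed[OF tail_in[OF e]] by blast
  ultimately show "commensurable (conjugate G ?t ?h) ?k"
    unfolding commensurable_def
    by (meson almost_sub_of_sub almost_sub_trans)
qed

section \<open>Stature, depth and minimal intersections\<close>

locale commensurable_family = group G for G :: "('a, 'm) monoid_scheme" (structure) +
  fixes V :: "'v set" and H :: "'v \<Rightarrow> 'a set"
  assumes V_finite: "finite V" and V_ne: "V \<noteq> {}"
    and H_sub: "v \<in> V \<Longrightarrow> subgroup (H v) G"
    and comm: "u \<in> V \<Longrightarrow> v \<in> V \<Longrightarrow> g \<in> carrier G \<Longrightarrow> commensurable (conjugate G g (H u)) (H v)"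
begin

abbreviation "\<C> \<equiv> conjugates G (H ` V)"

lemma H_carrier: "v \<in> V \<Longrightarrow> H v \<subseteq> carrier G"
  using H_sub subgroup.subset by blast

lemma conj_subgroup: "C \<in> \<C> \<Longrightarrow> subgroup C G"
  unfolding conjugates_def using conjugate_subgroup H_sub by blast

lemma H_in_conjugates: "v \<in> V \<Longrightarrow> H v \<in> \<C>"
  unfolding conjugates_def using conjugate_one[OF H_carrier] one_closed by blast

lemma conjugate_in_conjugates:
  assumes "C \<in> \<C>" "g \<in> carrier G"
  shows "conjugate G g C \<in> \<C>"
proof -
  obtain h v where h: "h \<in> carrier G" "v \<in> V" "C = conjugate G h (H v)"
    using assms(1) unfolding conjugates_def by blast
  then have "conjugate G g C = conjugate G (g \<otimes> h) (H v)"
    using conjugate_mult[OF assms(2) h(1) H_carrier[OF h(2)]] by simp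
  then show ?thesis unfolding conjugates_def using assms(2) h by blast
qed

lemma almost_sub_conj: "v \<in> V \<Longrightarrow> C \<in> \<C> \<Longrightarrow> almost_sub (H v) C"
  unfolding conjugates_def using comm unfolding commensurable_def by blast

lemma Inter_subgroup: "\<A> \<noteq> {} \<Longrightarrow> \<A> \<subseteq> \<C> \<Longrightarrow> subgroup (\<Inter>\<A>) G"
  using subgroups_Inter[of \<A>] conj_subgroup by blast

lemma almost_sub_Inter:
  assumes v: "v \<in> V"
  shows "finite \<A> \<Longrightarrow> \<A> \<noteq> {} \<Longrightarrow> \<A> \<subseteq> \<C> \<Longrightarrow> almost_sub (H v) (\<Inter>\<A>)"
proof (induction rule: finite_ne_induct)
  case (singleton C)
  then show ?case using almost_sub_conj[OF v] by simp
next
  case (insert C \<A>)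
  then have C: "C \<in> \<C>" and \<A>: "\<A> \<subseteq> \<C>" by simp_all
  have "almost_sub (H v) (C \<inter> \<Inter>\<A>)"
    by (rule almost_sub_Int[OF conj_subgroup[OF C] Inter_subgroup[OF insert.hyps(2) \<A>]
          H_carrier[OF v] almost_sub_conj[OF v C] insert.IH[OF \<A>]])
  then show ?case by simp
qed

text \<open>The condition through which the three properties of the theorem are compared.\<close>

definition has_minimal_intersection :: bool where
  "has_minimal_intersection \<longleftrightarrow>
    (\<exists>\<A>. finite \<A> \<and> \<A> \<noteq> {} \<and> \<A> \<subseteq> \<C> \<and> (\<forall>C\<in>\<C>. \<Inter>\<A> \<subseteq> C))"

text \<open>An intersection of conjugates that lies in all conjugates is the intersection of all of them, and
  conjugation permutes these.\<close>

lemma normal_of_minimal_intersection: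
  assumes "has_minimal_intersection"
  obtains N where "N \<lhd> G" "\<And>v. v \<in> V \<Longrightarrow> finite_index_subgroup N (G\<lparr>carrier := H v\<rparr>)"
proof -
  obtain \<A> where all: "finite \<A> \<and> \<A> \<noteq> {} \<and> \<A> \<subseteq> \<C> \<and> (\<forall>C\<in>\<C>. \<Inter>\<A> \<subseteq> C)"
    using assms unfolding has_minimal_intersection_def by (rule exE)
  then have \<A>: "finite \<A>" "\<A> \<noteq> {}" "\<A> \<subseteq> \<C>" by simp_all
  have least: "\<Inter>\<A> \<subseteq> C" if "C \<in> \<C>" for C using all that by blast
  let ?N = "\<Inter>\<A>"
  have N: "subgroup ?N G" using \<A>(2,3) by (rule Inter_subgroup)
  have normal: "?N \<lhd> G"
  proof (rule normal_invI[OF N])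
    fix x h assume x: "x \<in> carrier G" and h: "h \<in> ?N"
    show "x \<otimes> h \<otimes> inv x \<in> ?N"
    proof
      fix C assume C: "C \<in> \<A>"
      have C': "C \<in> \<C>" using C \<A>(3) by blast
      have "\<Inter>\<A> \<subseteq> conjugate G (inv x) C"
        using x by (intro least conjugate_in_conjugates[OF C']) simp
      then have "h \<in> conjugate G (inv x) C" using h by (rule subsetD)
      then obtain k where k: "k \<in> C" "h = inv x \<otimes> k \<otimes> x" using x by (auto simp: conjugate_eq)
      have "k \<in> carrier G" by (rule subgroup.mem_carrier[OF conj_subgroup[OF C'] k(1)])
      then have "x \<otimes> h \<otimes> inv x = k" using x k(2) by (simp add: m_assoc cancel_left)
      then show "x \<otimes> h \<otimes> inv x \<in> C" using k(1) by simp
    qed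
  qed
  have "finite_index_subgroup ?N (G\<lparr>carrier := H v\<rparr>)" if v: "v \<in> V" for v
  proof -
    have NH: "?N \<subseteq> H v" by (rule least[OF H_in_conjugates[OF v]])
    have "finite ((\<lambda>x. ?N #> x) ` H v)"
      by (rule finite_cosets_of_almost_sub[OF N almost_sub_Inter[OF v \<A>]])
    then show ?thesis using NH finite_index_restrict_iff[OF N H_sub[OF v]] by simp
  qed
  with normal show thesis by (rule that)
qed

lemma normal_sub_conj:
  assumes N: "N \<lhd> G" and NH: "\<And>v. v \<in> V \<Longrightarrow> N \<subseteq> H v" and C: "C \<in> \<C>"
  shows "N \<subseteq> C"
proof
  interpret N: normal N G by fact
  obtain g v where g: "g \<in> carrier G" "v \<in> V" "C = conjugate G g (H v)"
    using C unfolding conjugates_def by blast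
  fix x assume x: "x \<in> N"
  then have xG: "x \<in> carrier G" by (rule N.mem_carrier)
  have "inv g \<otimes> x \<otimes> g \<in> H v" using N.inv_op_closed1[OF g(1) x] NH[OF g(2)] by blast
  moreover have "x = g \<otimes> (inv g \<otimes> x \<otimes> g) \<otimes> inv g"
    using g(1) xG by (simp add: m_assoc cancel_left)
  ultimately show "x \<in> C" unfolding g(3) conjugate_eq by blast
qed

text \<open>All conjugates contain \<open>N\<close>, so an intersection inside \<open>H \<mu>\<close> is the union of some of the finitely many
  cosets of \<open>N\<close> in \<open>H \<mu>\<close>.\<close>

lemma finite_stature_of_normal:
  assumes N: "N \<lhd> G" and fin: "\<And>v. v \<in> V \<Longrightarrow> finite_index_subgroup N (G\<lparr>carrier := H v\<rparr>)"
  shows "finite_stature G V H"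
  unfolding finite_stature_def
proof (intro ballI finite_imageI)
  interpret N: normal N G by fact
  have index: "N \<subseteq> H v \<and> finite ((\<lambda>x. N #> x) ` H v)" if "v \<in> V" for v
    using fin[OF that] finite_index_restrict_iff[OF N.subgroup_axioms H_sub[OF that]] by simp
  then have NH: "N \<subseteq> H v" if "v \<in> V" for v using that by simp
  fix \<mu> assume \<mu>: "\<mu> \<in> V"
  let ?R = "(\<lambda>x. N #> x) ` H \<mu>"
  let ?\<D> = "{D. infinite D \<and> (\<exists>\<A>. \<A> \<noteq> {} \<and> \<A> \<subseteq> \<C> \<and> D = H \<mu> \<inter> \<Inter>\<A>)}"
  have "?\<D> \<subseteq> Union ` Pow ?R"
  proof
    fix D assume "D \<in> ?\<D>"
    then obtain \<A> where \<A>: "\<A> \<noteq> {}" "\<A> \<subseteq> \<C>" and D: "D = H \<mu> \<inter> \<Inter>\<A>" by blast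
    have Dsub: "subgroup D G"
      unfolding D by (rule subgroups_Inter_pair[OF H_sub[OF \<mu>] Inter_subgroup[OF \<A>]])
    have "N \<subseteq> C" if "C \<in> \<A>" for C
      by (rule normal_sub_conj[OF N NH subsetD[OF \<A>(2) that]])
    then have ND: "N \<subseteq> D" using NH[OF \<mu>] unfolding D by blast
    have "D = \<Union>((\<lambda>x. N #> x) ` D)"
    proof
      show "D \<subseteq> \<Union>((\<lambda>x. N #> x) ` D)"
      proof
        fix x assume "x \<in> D"
        then show "x \<in> \<Union>((\<lambda>x. N #> x) ` D)"
          using rcos_self[OF subgroup.mem_carrier[OF Dsub] N.subgroup_axioms] by blast
      qed
      show "\<Union>((\<lambda>x. N #> x) ` D) \<subseteq> D"
        using ND subgroup.m_closed[OF Dsub] by (auto simp: r_coset_def)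
    qed
    moreover have "(\<lambda>x. N #> x) ` D \<in> Pow ?R" unfolding D by blast
    ultimately show "D \<in> Union ` Pow ?R" by blast
  qed
  then show "finite ?\<D>"
    by (rule finite_subset) (use index[OF \<mu>] in simp)
qed

text \<open>Along a strictly increasing chain the number of cosets of \<open>N\<close> increases strictly.  A conjugate has as
  many of them as the vertex group, which bounds these numbers uniformly.\<close>

lemma finite_depth_of_normal:
  assumes N: "N \<lhd> G" and fin: "\<And>v. v \<in> V \<Longrightarrow> finite_index_subgroup N (G\<lparr>carrier := H v\<rparr>)"
  shows "commensurable_depth G (H ` V) < \<infinity>"
proof -
  interpret N: normal N G by fact
  let ?p = "\<lambda>x. N #> x"
  have index: "N \<subseteq> H v \<and> finite (?p ` H v)" if "v \<in> V" for v
    using fin[OF that] finite_index_restrict_iff[OF N.subgroup_axioms H_sub[OF that]] by simp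
  then have NH: "N \<subseteq> H v" and finH: "finite (?p ` H v)" if "v \<in> V" for v using that by simp_all
  define B where "B = (\<Sum>v\<in>V. card (?p ` H v))"
  have bound: "finite (?p ` C) \<and> card (?p ` C) \<le> B" if C: "C \<in> \<C>" for C
  proof -
    obtain g v where g: "g \<in> carrier G" "v \<in> V" "C = conjugate G g (H v)"
      using C unfolding conjugates_def by blast
    have "?p ` C = (\<lambda>X. ?p g <#> X <#> ?p (inv g)) ` ?p ` H v"
      unfolding g(3) conjugate_eq image_image
    proof (rule image_cong[OF HOL.refl])
      fix h assume "h \<in> H v"
      then have h: "h \<in> carrier G" using H_carrier[OF g(2)] by blast
      show "?p (g \<otimes> h \<otimes> inv g) = ?p g <#> ?p h <#> ?p (inv g)"
        using g(1) h by (simp add: N.rcos_sum)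
    qed
    then have "card (?p ` C) \<le> card (?p ` H v)" "finite (?p ` C)"
      using card_image_le[OF finH[OF g(2)]] finH[OF g(2)] by simp_all
    moreover have "card (?p ` H v) \<le> B"
      unfolding B_def using V_finite g(2) by (intro member_le_sum) simp_all
    ultimately show ?thesis by simp
  qed
  have "enat (length Ls) \<le> enat (Suc B)"
    if Ls: "sorted_wrt (\<subset>) Ls" "set Ls \<subseteq> {\<Inter>\<A> | \<A>. \<A> \<noteq> {} \<and> finite \<A> \<and> \<A> \<subseteq> \<C>}" for Ls
  proof -
    have L: "subgroup L G \<and> N \<subseteq> L \<and> finite (?p ` L) \<and> card (?p ` L) \<le> B" if "L \<in> set Ls" for L
    proof -
      have "L \<in> {\<Inter>\<A> | \<A>. \<A> \<noteq> {} \<and> finite \<A> \<and> \<A> \<subseteq> \<C>}" using that Ls(2) by blast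
      then obtain \<A> where \<A>: "\<A> \<noteq> {}" "\<A> \<subseteq> \<C>" "L = \<Inter>\<A>" by blast
      obtain C where C: "C \<in> \<A>" using \<A>(1) by blast
      have "?p ` L \<subseteq> ?p ` C" using C \<A>(3) by blast
      moreover have "finite (?p ` C)" "card (?p ` C) \<le> B" using bound C \<A>(2) by blast+
      ultimately have "finite (?p ` L)" "card (?p ` L) \<le> B"
        using finite_subset[of "?p ` L" "?p ` C"] card_mono[of "?p ` C" "?p ` L"] by simp_all
      moreover have "N \<subseteq> C" if "C \<in> \<A>" for C
        by (rule normal_sub_conj[OF N NH subsetD[OF \<A>(2) that]])
      then have "N \<subseteq> L" unfolding \<A>(3) by blast
      ultimately show ?thesis using Inter_subgroup[OF \<A>(1,2)] \<A>(3) by simp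
    qed
    have strict: "card (?p ` K) < card (?p ` L)" if K: "K \<in> set Ls" and L': "L \<in> set Ls" and KL: "K \<subset> L" for K L
    proof (rule psubset_card_mono)
      show "finite (?p ` L)" using L[OF L'] by blast
      show "?p ` K \<subset> ?p ` L"
      proof
        show "?p ` K \<subseteq> ?p ` L" using KL by blast
        show "?p ` K \<noteq> ?p ` L"
        proof
          assume eq: "?p ` K = ?p ` L"
          obtain x where x: "x \<in> L" "x \<notin> K" using KL by blast
          then obtain y where y: "y \<in> K" "?p x = ?p y" using eq by blast
          have "x \<in> carrier G" using L[OF L'] x(1) by (intro subgroup.mem_carrier[of L]) simp_all
          then have "x \<in> ?p y" using rcos_self[OF _ N.subgroup_axioms, of x] y(2) by simp
          then have "x \<in> K" using y(1) L[OF K] subgroup.m_closed[of K G] by (auto simp: r_coset_def)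
          then show False using x(2) by simp
        qed
      qed
    qed
    have "sorted_wrt (<) (map (\<lambda>L. card (?p ` L)) Ls)"
      unfolding sorted_wrt_map using Ls(1) strict by (rule sorted_wrt_mono_rel[rotated])
    then have "distinct (map (\<lambda>L. card (?p ` L)) Ls)"
      by (simp add: strict_sorted_iff)
    moreover have "set (map (\<lambda>L. card (?p ` L)) Ls) \<subseteq> {..B}" using L by auto
    ultimately have "length (map (\<lambda>L. card (?p ` L)) Ls) \<le> card {..B}"
      by (metis card_mono distinct_card finite_atMost)
    then show ?thesis by simp
  qed
  then have "commensurable_depth G (H ` V) \<le> enat (Suc B)"
    unfolding commensurable_depth_def by (intro Sup_least) blast
  then show ?thesis by (metis enat_ord_simps(4) enat_ord_code(4) le_less_trans)
qed

text \<open>If the first term of a longest chain were not contained in some conjugate, its intersection with that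
  conjugate could be put in front of the chain.\<close>

lemma minimal_intersection_of_finite_depth:
  assumes "commensurable_depth G (H ` V) < \<infinity>"
  shows "has_minimal_intersection"
proof -
  define meets where "meets = {\<Inter>\<A> | \<A>. \<A> \<noteq> {} \<and> finite \<A> \<and> \<A> \<subseteq> \<C>}"
  define chain where "chain = (\<lambda>Ls. sorted_wrt (\<subset>) Ls \<and> set Ls \<subseteq> meets)"
  obtain n where n: "commensurable_depth G (H ` V) = enat n" using assms by auto
  have "length Ls < Suc n" if "chain Ls" for Ls
  proof -
    have "enat (length Ls) \<le> commensurable_depth G (H ` V)"
      unfolding commensurable_depth_def
      by (rule Sup_upper) (use that in \<open>auto simp: chain_def meets_def\<close>)
    then show ?thesis by (simp add: n)
  qed
  then have bounded: "\<forall>Ls. chain Ls \<longrightarrow> length Ls < Suc n" by blast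
  obtain v where v: "v \<in> V" using V_ne by blast
  have "H v \<in> meets"
    unfolding meets_def using H_in_conjugates[OF v] by (intro CollectI exI[of _ "{H v}"]) simp
  then have chain1: "chain [H v]" by (simp add: chain_def)
  from ex_has_greatest_nat[of chain, OF chain1 bounded] obtain Ls
    where Ls: "chain Ls" and longest: "\<And>Ls'. chain Ls' \<Longrightarrow> length Ls' \<le> length Ls" by metis
  have "Ls \<noteq> []" using longest[OF chain1] by auto
  then obtain L Ls' where Ls_eq: "Ls = L # Ls'" by (cases Ls) auto
  then have "L \<in> meets" using Ls by (simp add: chain_def)
  then obtain \<A> where \<A>: "\<A> \<noteq> {}" "finite \<A>" "\<A> \<subseteq> \<C>" "L = \<Inter>\<A>" unfolding meets_def by blast
  have "\<Inter>\<A> \<subseteq> C" if C: "C \<in> \<C>" for C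
  proof (rule ccontr)
    assume "\<not> \<Inter>\<A> \<subseteq> C"
    then have sub: "L \<inter> C \<subset> L" using \<A>(4) by blast
    have "L \<inter> C \<in> meets"
      unfolding meets_def using \<A> C by (intro CollectI exI[of _ "insert C \<A>"]) auto
    then have "chain ((L \<inter> C) # Ls)" using Ls sub unfolding chain_def Ls_eq by auto
    then show False using longest by fastforce
  qed
  then show ?thesis unfolding has_minimal_intersection_def using \<A> by blast
qed

definition index_in :: "'a set \<Rightarrow> 'a set \<Rightarrow> nat" where
  "index_in K D = card ((\<lambda>x. D #> x) ` K)"

text \<open>Mapping cosets of \<open>D'\<close> to cosets of \<open>D\<close> is surjective, so by counting it is injective.\<close>

lemma eq_of_index_le:
  assumes D: "subgroup D G" and D': "subgroup D' G" and sub: "D' \<subseteq> D" "D \<subseteq> K" "K \<subseteq> carrier G"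
    and fin: "finite ((\<lambda>x. D' #> x) ` K)" and le: "index_in K D' \<le> index_in K D"
    and K1: "\<one> \<in> K"
  shows "D' = D"
proof -
  let ?R = "(\<lambda>x. D #> x) ` K" and ?R' = "(\<lambda>x. D' #> x) ` K"
  have DD': "D <#> D' = D"
  proof
    show "D <#> D' \<subseteq> D" using subgroup.m_closed[OF D] sub(1) unfolding set_mult_def by blast
    show "D \<subseteq> D <#> D'"
    proof
      fix d assume "d \<in> D"
      moreover have "\<one> \<in> D'" by (rule subgroup.one_closed[OF D'])
      moreover have "d = d \<otimes> \<one>" using \<open>d \<in> D\<close> subgroup.mem_carrier[OF D] by simp
      ultimately show "d \<in> D <#> D'" unfolding set_mult_def by blast
    qed
  qed
  have "D <#> (D' #> x) = D #> x" if "x \<in> K" for x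
    using setmult_rcos_assoc[OF subgroup.subset[OF D] subgroup.subset[OF D'], of x] DD' sub(3) that
    by auto
  then have img: "(\<lambda>X. D <#> X) ` ?R' = ?R" by (simp add: image_image)
  have "inj_on (\<lambda>X. D <#> X) ?R'"
  proof (rule eq_card_imp_inj_on[OF fin])
    show "card ((\<lambda>X. D <#> X) ` ?R') = card ?R'"
      using card_image_le[OF fin, of "\<lambda>X. D <#> X"] le unfolding img index_in_def by simp
  qed
  have "D \<subseteq> D'"
  proof
    fix d assume d: "d \<in> D"
    then have dG: "d \<in> carrier G" and dK: "d \<in> K" using sub(2) subgroup.mem_carrier[OF D] by auto
    have "D #> d = D #> \<one>"
      using coset_join2[OF dG D d] coset_mult_one[OF subgroup.subset[OF D]] by simp
    then have "D <#> (D' #> d) = D <#> (D' #> \<one>)"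
      using \<open>\<And>x. x \<in> K \<Longrightarrow> D <#> (D' #> x) = D #> x\<close> dK K1 by simp
    then have "D' #> d = D' #> \<one>"
      using inj_onD[OF \<open>inj_on (\<lambda>X. D <#> X) ?R'\<close>] dK K1 by blast
    then have "d \<in> D' #> \<one>" using rcos_self[OF dG D'] by simp
    then show "d \<in> D'" using coset_mult_one[OF subgroup.subset[OF D']] by simp
  qed
  with sub(1) show ?thesis by blast
qed

lemma index_in_conjugate_le:
  assumes K: "subgroup K G" and h: "h \<in> K" and D: "D \<subseteq> carrier G"
    and fin: "finite ((\<lambda>x. D #> x) ` K)"
  shows "index_in K (conjugate G h D) \<le> index_in K D"
proof -
  have hG: "h \<in> carrier G" using h subgroup.mem_carrier[OF K] by blast
  have "(\<lambda>x. conjugate G h D #> x) ` K \<subseteq> (\<lambda>X. h <# X) ` (\<lambda>x. D #> x) ` K"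
  proof
    fix Z assume "Z \<in> (\<lambda>x. conjugate G h D #> x) ` K"
    then obtain x where x: "x \<in> K" "Z = conjugate G h D #> x" by blast
    have xG: "x \<in> carrier G" using x(1) subgroup.mem_carrier[OF K] by blast
    have "h \<otimes> d \<otimes> inv h \<otimes> x = h \<otimes> (d \<otimes> (inv h \<otimes> x))" if "d \<in> D" for d
      using that D hG xG by (simp add: m_assoc subset_eq)
    then have "Z = h <# (D #> (inv h \<otimes> x))"
      unfolding x(2) conjugate_eq r_coset_def l_coset_def by auto
    moreover have "inv h \<otimes> x \<in> K"
      using h x(1) subgroup.m_closed[OF K] subgroup.m_inv_closed[OF K] by blast
    ultimately show "Z \<in> (\<lambda>X. h <# X) ` (\<lambda>x. D #> x) ` K" by blast
  qed
  then have "index_in K (conjugate G h D) \<le> card ((\<lambda>X. h <# X) ` (\<lambda>x. D #> x) ` K)"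
    unfolding index_in_def by (rule card_mono[OF finite_imageI[OF fin]])
  also have "\<dots> \<le> index_in K D"
    unfolding index_in_def by (rule card_image_le[OF fin])
  finally show ?thesis .
qed

text \<open>Let \<open>\<mu>\<close> be a vertex.  If \<open>H \<mu>\<close> is finite, where finite stature says nothing, a finite intersection with
  the fewest elements in \<open>H \<mu>\<close> will do.  Otherwise all finite intersections inside \<open>H \<mu>\<close> are infinite, and
  since their index in \<open>H \<mu>\<close> depends on their conjugacy class only, it takes finitely many values; one
  of largest index cannot be made smaller.\<close>

lemma minimal_intersection_of_finite_stature:
  assumes stature: "finite_stature G V H"
  shows "has_minimal_intersection"
proof -
  obtain \<mu> where \<mu>: "\<mu> \<in> V" using V_ne by blast
  let ?K = "H \<mu>"
  have K: "subgroup ?K G" by (rule H_sub[OF \<mu>])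
  define fam where "fam = (\<lambda>\<A>. finite \<A> \<and> \<A> \<noteq> {} \<and> \<A> \<subseteq> \<C>)"
  have fam1: "fam {?K}" using H_in_conjugates[OF \<mu>] by (simp add: fam_def)
  have fam_insert: "fam (insert C \<A>)" if "fam \<A>" "C \<in> \<C>" for C \<A>
    using that by (simp add: fam_def)
  have sub: "subgroup (?K \<inter> \<Inter>\<A>) G" if "fam \<A>" for \<A>
    using that by (intro subgroups_Inter_pair K Inter_subgroup) (simp_all add: fam_def)
  have almost: "almost_sub ?K (?K \<inter> \<Inter>\<A>)" if "fam \<A>" for \<A>
  proof -
    have "almost_sub ?K (\<Inter>(insert ?K \<A>))"
      using fam_insert[OF that H_in_conjugates[OF \<mu>]] unfolding fam_def
      by (intro almost_sub_Inter[OF \<mu>]) simp_all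
    then show ?thesis by simp
  qed
  have conclude: "has_minimal_intersection"
    if \<A>: "fam \<A>" and stable: "\<And>C. C \<in> \<C> \<Longrightarrow> ?K \<inter> \<Inter>\<A> \<inter> C = ?K \<inter> \<Inter>\<A>" for \<A>
    unfolding has_minimal_intersection_def
    using fam_insert[OF \<A> H_in_conjugates[OF \<mu>]] stable
    by (intro exI[of _ "insert ?K \<A>"]) (auto simp: fam_def)
  show ?thesis
  proof (cases "finite ?K")
    case True
    obtain \<A> where \<A>: "fam \<A>" and least: "\<And>\<B>. fam \<B> \<Longrightarrow> card (?K \<inter> \<Inter>\<A>) \<le> card (?K \<inter> \<Inter>\<B>)"
      using ex_has_least_nat[of fam "{?K}" "\<lambda>\<A>. card (?K \<inter> \<Inter>\<A>)", OF fam1] by (elim exE conjE) simp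
    show ?thesis
    proof (rule conclude[OF \<A>])
      fix C assume C: "C \<in> \<C>"
      have "card (?K \<inter> \<Inter>\<A>) \<le> card (?K \<inter> \<Inter>\<A> \<inter> C)"
        using least[OF fam_insert[OF \<A> C]] by (simp add: Int_ac)
      then show "?K \<inter> \<Inter>\<A> \<inter> C = ?K \<inter> \<Inter>\<A>"
        using True by (intro card_seteq) auto
    qed
  next
    case False
    define \<D> where "\<D> = {?K \<inter> \<Inter>\<A> | \<A>. fam \<A>}"
    define cls where "cls = (\<lambda>D. {conjugate G h D | h. h \<in> ?K})"
    have \<D>: "subgroup D G \<and> D \<subseteq> ?K \<and> finite ((\<lambda>x. D #> x) ` ?K)" if D: "D \<in> \<D>" for D
    proof -
      obtain \<A> where \<A>: "D = ?K \<inter> \<Inter>\<A>" "fam \<A>" using D unfolding \<D>_def by blast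
      show ?thesis
        unfolding \<A>(1) using sub[OF \<A>(2)] finite_cosets_of_almost_sub[OF sub almost, OF \<A>(2) \<A>(2)]
        by blast
    qed
    have infinite_D: "infinite D" if D: "D \<in> \<D>" for D
    proof
      assume "finite D"
      obtain \<A> where \<A>: "fam \<A>" "D = ?K \<inter> \<Inter>\<A>" using D unfolding \<D>_def by blast
      obtain F where F: "finite F" "?K \<subseteq> (\<Union>f\<in>F. D #> f)"
        using almost[OF \<A>(1)] unfolding almost_sub_def \<A>(2) by blast
      have "finite (D #> f)" for f using \<open>finite D\<close> by (simp add: r_coset_def)
      then show False using F False finite_subset by blast
    qed
    let ?\<D> = "{D. infinite D \<and> (\<exists>\<A>. \<A> \<noteq> {} \<and> \<A> \<subseteq> \<C> \<and> D = ?K \<inter> \<Inter>\<A>)}"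
    have "cls ` \<D> \<subseteq> cls ` ?\<D>"
      using infinite_D unfolding \<D>_def fam_def by blast
    moreover have "finite (cls ` ?\<D>)"
      using stature \<mu> unfolding finite_stature_def cls_def by blast
    ultimately have fin_cls: "finite (cls ` \<D>)" by (rule finite_subset)
    have idx_le: "index_in ?K D \<le> index_in ?K D'" if "D \<in> \<D>" "D' \<in> \<D>" "cls D = cls D'" for D D'
    proof -
      have DG: "D \<subseteq> carrier G" "D' \<subseteq> carrier G"
        using \<D>[OF that(1)] \<D>[OF that(2)] subgroup.subset[of D G] subgroup.subset[of D' G] by simp_all
      have "conjugate G \<one> D \<in> cls D" unfolding cls_def using subgroup.one_closed[OF K] by blast
      then have "D \<in> cls D'" using conjugate_one[OF DG(1)] that(3) by simp
      then obtain h where "h \<in> ?K" "D = conjugate G h D'" unfolding cls_def by blast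
      then show ?thesis
        using index_in_conjugate_le[OF K _ DG(2)] \<D>[OF that(2)] by simp
    qed
    have "index_in ?K ` \<D> \<subseteq> (\<lambda>c. index_in ?K (SOME D. D \<in> \<D> \<and> cls D = c)) ` cls ` \<D>"
    proof
      fix n assume "n \<in> index_in ?K ` \<D>"
      then obtain D where D: "D \<in> \<D>" "n = index_in ?K D" by blast
      define D' where "D' = (SOME D'. D' \<in> \<D> \<and> cls D' = cls D)"
      have D': "D' \<in> \<D> \<and> cls D' = cls D" unfolding D'_def by (rule someI[of _ D]) (simp add: D(1))
      then have "n = index_in ?K D'"
        using D idx_le[of D D'] idx_le[of D' D] by simp
      then show "n \<in> (\<lambda>c. index_in ?K (SOME D. D \<in> \<D> \<and> cls D = c)) ` cls ` \<D>"
        unfolding D'_def using D(1) by blast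
    qed
    then have fin_idx: "finite (index_in ?K ` \<D>)"
      using fin_cls by (meson finite_imageI finite_subset)
    have "index_in ?K ` \<D> \<noteq> {}" unfolding \<D>_def using fam1 by blast
    then have "Max (index_in ?K ` \<D>) \<in> index_in ?K ` \<D>" by (rule Max_in[OF fin_idx])
    then obtain D where D: "Max (index_in ?K ` \<D>) = index_in ?K D" "D \<in> \<D>" by (rule imageE)
    obtain \<A> where \<A>: "fam \<A>" "D = ?K \<inter> \<Inter>\<A>" using D(2) unfolding \<D>_def by blast
    show ?thesis
    proof (rule conclude[OF \<A>(1)])
      fix C assume C: "C \<in> \<C>"
      have "D \<inter> C = ?K \<inter> \<Inter>(insert C \<A>)" unfolding \<A>(2) by blast
      then have DC: "D \<inter> C \<in> \<D>" unfolding \<D>_def using fam_insert[OF \<A>(1) C] by blast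
      have "index_in ?K (D \<inter> C) \<le> index_in ?K D"
        unfolding D(1)[symmetric] by (rule Max_ge[OF fin_idx]) (rule imageI[OF DC])
      then have "D \<inter> C = D"
        using \<D>[OF D(2)] \<D>[OF DC] subgroup.subset[OF K] subgroup.one_closed[OF K]
          eq_of_index_le[of D "D \<inter> C" ?K] by simp
      then show "?K \<inter> \<Inter>\<A> \<inter> C = ?K \<inter> \<Inter>\<A>" unfolding \<A>(2) .
    qed
  qed
qed

end

theorem proposition3p28:
  fixes G :: "('a, 'm) monoid_scheme"
    and Y :: "('v, 'e, 'g, 'h) graph_of_groups"
    and T :: "('v, 'e) pre_digraph"
    and \<psi> :: "('v, 'e, 'g) gog_gen word set \<Rightarrow> 'a"
  defines "V \<equiv> gverts Y" and "H \<equiv> vertex_subgroup Y T \<psi>"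
  assumes "group G" and "splitting G Y T \<psi>" and "finite_index_edge_groups Y"
  shows "(finite_stature G V H \<longleftrightarrow> commensurable_depth G (H ` V) < \<infinity>) \<and>
         (commensurable_depth G (H ` V) < \<infinity> \<longleftrightarrow>
            (\<exists>N. N \<lhd> G \<and> (\<forall>v\<in>V. finite_index_subgroup N (G\<lparr>carrier := H v\<rparr>)) \<and>
                 finitely_generated (G Mod N) \<and> virtually_free (G Mod N)))"
proof -
  interpret S: split_group G Y T \<psi>
    using assms(3,4) by (simp add: split_group_def split_group_axioms_def)
  interpret F: commensurable_family G V H
    unfolding V_def H_def
  proof (rule commensurable_family.intro[OF assms(3)], rule commensurable_family_axioms.intro)
    show "finite (gverts Y)" by (rule S.finite_V)
    show "gverts Y \<noteq> {}" by (rule S.V_nonempty)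
    show "subgroup (vertex_subgroup Y T \<psi> v) G" if "v \<in> gverts Y" for v
      using that by (rule S.H_subgroup)
    show "S.commensurable (conjugate G g (vertex_subgroup Y T \<psi> u)) (vertex_subgroup Y T \<psi> v)"
      if "u \<in> gverts Y" "v \<in> gverts Y" "g \<in> carrier G" for u v g
      using assms(5) that by (rule S.vertex_subgroups_commensurable)
  qed
  let ?N = "\<lambda>N. N \<lhd> G \<and> (\<forall>v\<in>V. finite_index_subgroup N (G\<lparr>carrier := H v\<rparr>))"
  have quotient: "finitely_generated (G Mod N) \<and> virtually_free (G Mod N)" if "?N N" for N
    using S.quotient_virtually_free[of N] that unfolding V_def H_def by blast
  have "finite_stature G V H \<Longrightarrow> F.has_minimal_intersection"
    by (rule F.minimal_intersection_of_finite_stature)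
  moreover have "commensurable_depth G (H ` V) < \<infinity> \<Longrightarrow> F.has_minimal_intersection"
    by (rule F.minimal_intersection_of_finite_depth)
  moreover have "F.has_minimal_intersection \<Longrightarrow> \<exists>N. ?N N"
    using F.normal_of_minimal_intersection by metis
  moreover have "?N N \<Longrightarrow> finite_stature G V H" for N
    using F.finite_stature_of_normal[of N] by blast
  moreover have "?N N \<Longrightarrow> commensurable_depth G (H ` V) < \<infinity>" for N
    using F.finite_depth_of_normal[of N] by blast
  ultimately show ?thesis using quotient by blast
qed

end
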